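(* Let $\alpha$ be an action of a compact quantum group $\mathcal{G}=(A,\Delta)$ with Haar measure $h$ on a compact Hausdorff space $X$. For $x\in X$ let $\mu_x=(ev_x\otimes h)\alpha$. Then for every $x\in X$ one has ${\rm supp}\,\mu_x\subseteq\mathcal{M}_x\subseteq{\rm Orb}_x$, and ${\rm supp}\,\mu_x$ is a minimal $\alpha$-invariant subset of $X$. Moreover, if the Haar measure $h$ of $\mathcal{G}$ is faithful, then ${\rm supp}\,\mu_x=\mathcal{M}_x$.
   Context: $\otimes$ denotes the minimal tensor product of $C^*$-algebras. A compact quantum group $\mathcal{G}$ is a pair $(A,\Delta)$ with $A$ a unital $C^*$-algebra and $\Delta:A\to A\otimes A$ a unital $*$-homomorphism such that $(id\otimes\Delta)\Delta=(\Delta\otimes id)\Delta$ and the linear spans of $\Delta(A)(1\otimes A)$ and of $\Delta(A)(A\otimes 1)$ are dense in $A\otimes A$. Its Haar measure is the unique state $h$ on $A$ with $(h\otimes id)\Delta(a)=(id\otimes h)\Delta(a)=h(a)1_A$ for all $a\in A$; $h$ is faithful if $h(a^*a)=0$ implies $a=0$. An action of $\mathcal{G}$ on a compact Hausdorff space $X$ is a unital $*$-homomorphism $\alpha:B\to B\otimes A$, where $B=C(X)$, with $(\alpha\otimes id)\alpha=(id\otimes\Delta)\alpha$ and such that the linear span of $\alpha(B)(1\otimes A)$ is dense in $B\otimes A$. For $x\in X$, $ev_x:B\to\mathbb{C}$ is evaluation at $x$; $\alpha_x=(ev_x\otimes id)\alpha:B\to A$; $\mathcal{M}_x=\{y\in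 X: f(y)=0\text{ for all }f\in\ker\alpha_x\}$; and ${\rm Orb}_x=\{x'\in X:(ev_x\otimes h)\alpha=(ev_{x'}\otimes h)\alpha\}$. The functional $\mu_x$ is a state on $C(X)$, and ${\rm supp}\,\mu_x$ is the support of the corresponding regular Borel probability measure. A closed subset $Y\subseteq X$ is $\alpha$-invariant if the ideal $J_Y=\{f\in B: f=0\text{ on }Y\}$ satisfies $(\pi_Y\otimes id)\alpha(f)=0$ for all $f\in J_Y$, where $\pi_Y:B\to B/J_Y$ is the quotient map. A nonempty $\alpha$-invariant closed subset is minimal if it contains no nonempty $\alpha$-invariant closed subset other than itself. *)

theory Defs
  imports "HOL-Analysis.Analysis"
begin

section \<open>Complex normed spaces and unital C*-algebras\<close>

class complex_normed_vector = real_normed_vector +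
  fixes scaleC :: "complex \<Rightarrow> 'a \<Rightarrow> 'a" (infixr "*\<^sub>C" 75)
  assumes scaleC_add_right: "c *\<^sub>C (x + y) = c *\<^sub>C x + c *\<^sub>C y"
    and scaleC_add_left: "(c + d) *\<^sub>C x = c *\<^sub>C x + d *\<^sub>C x"
    and scaleC_scaleC: "c *\<^sub>C (d *\<^sub>C x) = (c * d) *\<^sub>C x"
    and scaleR_scaleC: "r *\<^sub>R x = complex_of_real r *\<^sub>C x"
    and norm_scaleC: "norm (c *\<^sub>C x) = cmod c * norm x"

text \<open>The class \<open>real_normed_algebra_1\<close> contributes \<open>1 \<noteq> 0\<close>, i.e. the zero algebra is excluded;
  it carries no state.\<close>

class cstar_algebra = complex_normed_vector + real_normed_algebra_1 + banach +
  fixes star :: "'a \<Rightarrow> 'a"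
  assumes scaleC_mult_left: "(c *\<^sub>C a) * b = c *\<^sub>C (a * b)"
    and scaleC_mult_right: "a * (c *\<^sub>C b) = c *\<^sub>C (a * b)"
    and star_star: "star (star a) = a"
    and star_add: "star (a + b) = star a + star b"
    and star_scaleC: "star (c *\<^sub>C a) = cnj c *\<^sub>C star a"
    and star_mult: "star (a * b) = star b * star a"
    and norm_star_mult: "norm (star a * a) = (norm a)\<^sup>2"

instantiation complex :: cstar_algebra
begin

definition scaleC_complex :: "complex \<Rightarrow> complex \<Rightarrow> complex" where
  "scaleC_complex c z = c * z"

definition star_complex :: "complex \<Rightarrow> complex" where
  "star_complex z = cnj z"

instance
  by standard
    (auto simp: scaleC_complex_def star_complex_def algebra_simps norm_mult power2_eq_square
      scaleR_conv_of_real)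

end

definition clinear_on :: "'a set \<Rightarrow> ('a::complex_normed_vector \<Rightarrow> 'b::complex_normed_vector) \<Rightarrow> bool" where
  "clinear_on T f \<longleftrightarrow>
     (\<forall>x\<in>T. \<forall>y\<in>T. f (x + y) = f x + f y) \<and> (\<forall>c. \<forall>x\<in>T. f (c *\<^sub>C x) = c *\<^sub>C f x)"

definition cspan :: "'a::complex_normed_vector set \<Rightarrow> 'a set" where
  "cspan S = {\<Sum>x\<in>F. c x *\<^sub>C x | F c. finite F \<and> F \<subseteq> S}"

section \<open>The algebra \<open>C(X)\<close>\<close>

text \<open>The type \<open>'x \<Rightarrow>\<^sub>C complex\<close> of bounded continuous functions is \<open>C(X)\<close> when \<open>'x\<close> is compact.

  The library proves completeness only for metric domains.\<close>

instance bcontfun :: (topological_space, complete_space) complete_space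
proof
  fix f :: "nat \<Rightarrow> ('a, 'b) bcontfun"
  assume "Cauchy f"
  then obtain g where "uniform_limit UNIV f g sequentially"
    using uniformly_convergent_eq_cauchy[of "\<lambda>_. True" f]
    unfolding Cauchy_def uniform_limit_sequentially_iff
    by (metis dist_fun_lt_imp_dist_val_lt)
  from uniform_limit_bcontfunE[OF this sequentially_bot]
  obtain l' where "g = apply_bcontfun l'" "(f \<longlonglongrightarrow> l')" by metis
  then show "convergent f"
    by (intro convergentI)
qed

instance bcontfun :: (topological_space, banach) banach ..

lemma bounded_linear_scaleC: "bounded_linear (\<lambda>x::'a::complex_normed_vector. c *\<^sub>C x)"
proof (rule bounded_linear_intro[where K = "cmod c"])
  show "c *\<^sub>C (r *\<^sub>R x) = r *\<^sub>R (c *\<^sub>C x)" for r and x :: 'a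
    by (simp add: scaleR_scaleC scaleC_scaleC mult.commute)
qed (simp_all add: scaleC_add_right norm_scaleC mult.commute)

lemma norm_star_le: "norm (star x) \<le> norm x" for x :: "'a::cstar_algebra"
proof (cases "star x = 0")
  case False
  have "norm (star x) * norm (star x) \<le> norm x * norm (star x)"
    using norm_mult_ineq[of x "star x"] norm_star_mult[of "star x"]
    by (simp add: star_star power2_eq_square)
  then show ?thesis using False by simp
qed simp

lemma bounded_linear_star: "bounded_linear (star :: 'a::cstar_algebra \<Rightarrow> 'a)"
  by (rule bounded_linear_intro[where K = 1])
    (simp_all add: star_add star_scaleC scaleR_scaleC norm_star_le)

lemma apply_Bcontfun:
  assumes "continuous_on UNIV f" and "\<And>x. norm (f x) \<le> b"
  shows "apply_bcontfun (Bcontfun f) = f"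
  using bcontfun_normI[OF assms] by (rule Bcontfun_inverse)

instantiation bcontfun :: (topological_space, complex_normed_vector) complex_normed_vector
begin

definition scaleC_bcontfun :: "complex \<Rightarrow> ('a \<Rightarrow>\<^sub>C 'b) \<Rightarrow> 'a \<Rightarrow>\<^sub>C 'b" where
  "c *\<^sub>C f = Bcontfun (\<lambda>x. c *\<^sub>C apply_bcontfun f x)"

lemma apply_scaleC_bcontfun: "apply_bcontfun (c *\<^sub>C f) x = c *\<^sub>C apply_bcontfun f x"
  for f :: "'a \<Rightarrow>\<^sub>C 'b"
  unfolding scaleC_bcontfun_def
  by (subst apply_Bcontfun[where b = "cmod c * norm f"])
    (auto simp: norm_scaleC norm_bounded mult_left_mono
      intro: bounded_linear.continuous_on[OF bounded_linear_scaleC])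

instance
proof
  fix c d :: complex and f g :: "'a \<Rightarrow>\<^sub>C 'b" and r :: real
  have *: "norm (e *\<^sub>C h) \<le> cmod e * norm h" for e and h :: "'a \<Rightarrow>\<^sub>C 'b"
    by (rule norm_bound) (simp add: apply_scaleC_bcontfun norm_scaleC norm_bounded mult_left_mono)
  have assoc: "c *\<^sub>C (d *\<^sub>C f) = (c * d) *\<^sub>C f" for c d and f :: "'a \<Rightarrow>\<^sub>C 'b"
    by (rule bcontfun_eqI) (simp add: apply_scaleC_bcontfun scaleC_scaleC)
  show "c *\<^sub>C (d *\<^sub>C f) = (c * d) *\<^sub>C f" by (rule assoc)
  have real: "r *\<^sub>R f = complex_of_real r *\<^sub>C f" for r and f :: "'a \<Rightarrow>\<^sub>C 'b"
    by (rule bcontfun_eqI) (simp add: apply_scaleC_bcontfun scaleR_scaleC)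
  show "r *\<^sub>R f = complex_of_real r *\<^sub>C f" by (rule real)
  show "norm (c *\<^sub>C f) = cmod c * norm f"
  proof (cases "c = 0")
    case True
    then show ?thesis using *[of c f] by simp
  next
    case False
    have "norm f = norm (inverse c *\<^sub>C (c *\<^sub>C f))"
      using False real[of 1 f] by (simp add: assoc)
    also have "\<dots> \<le> cmod (inverse c) * norm (c *\<^sub>C f)" by (rule *)
    finally show ?thesis using *[of c f] False by (simp add: norm_inverse norm_divide field_simps)
  qed
qed (rule bcontfun_eqI; simp add: apply_scaleC_bcontfun scaleC_add_left scaleC_add_right)+

end

instantiation bcontfun :: (topological_space, cstar_algebra) cstar_algebra
begin

definition times_bcontfun :: "('a \<Rightarrow>\<^sub>C 'b) \<Rightarrow> ('a \<Rightarrow>\<^sub>C 'b) \<Rightarrow> 'a \<Rightarrow>\<^sub>C 'b" where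
  "f * g = Bcontfun (\<lambda>x. apply_bcontfun f x * apply_bcontfun g x)"

definition one_bcontfun :: "'a \<Rightarrow>\<^sub>C 'b" where
  "1 = const_bcontfun 1"

definition star_bcontfun :: "('a \<Rightarrow>\<^sub>C 'b) \<Rightarrow> 'a \<Rightarrow>\<^sub>C 'b" where
  "star f = Bcontfun (\<lambda>x. star (apply_bcontfun f x))"

lemma apply_times_bcontfun: "apply_bcontfun (f * g) x = apply_bcontfun f x * apply_bcontfun g x"
  for f g :: "'a \<Rightarrow>\<^sub>C 'b"
proof -
  have "norm (apply_bcontfun f x * apply_bcontfun g x) \<le> norm f * norm g" for x
    by (rule order_trans[OF norm_mult_ineq]) (intro mult_mono norm_bounded, auto)
  then show ?thesis
    unfolding times_bcontfun_def
    by (subst apply_Bcontfun[where b = "norm f * norm g"]) (auto intro!: continuous_intros)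
qed

lemma apply_one_bcontfun: "apply_bcontfun (1 :: 'a \<Rightarrow>\<^sub>C 'b) x = 1"
  by (simp add: one_bcontfun_def)

lemma apply_star_bcontfun: "apply_bcontfun (star f) x = star (apply_bcontfun f x)"
  for f :: "'a \<Rightarrow>\<^sub>C 'b"
  unfolding star_bcontfun_def
  by (subst apply_Bcontfun[where b = "norm f"])
    (auto intro: order_trans[OF norm_star_le norm_bounded]
      bounded_linear.continuous_on[OF bounded_linear_star])

instance
proof
  fix f g h :: "'a \<Rightarrow>\<^sub>C 'b" and r :: real
  have mult: "norm (f * g) \<le> norm f * norm g" for f g :: "'a \<Rightarrow>\<^sub>C 'b"
  proof (rule norm_bound)
    show "norm (apply_bcontfun (f * g) x) \<le> norm f * norm g" for x
      unfolding apply_times_bcontfun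
      by (rule order_trans[OF norm_mult_ineq]) (intro mult_mono norm_bounded, auto)
  qed
  show "norm (f * g) \<le> norm f * norm g" by (rule mult)
  show "(0 :: 'a \<Rightarrow>\<^sub>C 'b) \<noteq> 1"
  proof
    assume "(0 :: 'a \<Rightarrow>\<^sub>C 'b) = 1"
    then have "apply_bcontfun (0 :: 'a \<Rightarrow>\<^sub>C 'b) undefined = apply_bcontfun 1 undefined" by simp
    then show False by (simp add: apply_one_bcontfun)
  qed
  show "norm (1 :: 'a \<Rightarrow>\<^sub>C 'b) = 1"
  proof (rule antisym)
    show "norm (1 :: 'a \<Rightarrow>\<^sub>C 'b) \<le> 1" by (rule norm_bound) (simp add: apply_one_bcontfun)
    show "1 \<le> norm (1 :: 'a \<Rightarrow>\<^sub>C 'b)"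
      using norm_bounded[of "1 :: 'a \<Rightarrow>\<^sub>C 'b" undefined] by (simp add: apply_one_bcontfun)
  qed
  have star_bound: "norm (star f) \<le> norm f" for f :: "'a \<Rightarrow>\<^sub>C 'b"
    by (rule norm_bound)
      (auto simp: apply_star_bcontfun intro: order_trans[OF norm_star_le norm_bounded])
  show "norm (star f * f) = (norm f)\<^sup>2"
  proof (rule antisym)
    show "norm (star f * f) \<le> (norm f)\<^sup>2"
      using mult[of "star f" f] mult_right_mono[OF star_bound[of f], of "norm f"]
      by (simp add: power2_eq_square)
    have "norm (apply_bcontfun f x) \<le> sqrt (norm (star f * f))" for x
    proof (rule real_le_rsqrt)
      show "(norm (apply_bcontfun f x))\<^sup>2 \<le> norm (star f * f)"
        using norm_bounded[of "star f * f" x]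
        by (simp add: apply_times_bcontfun apply_star_bcontfun norm_star_mult)
    qed
    then have "norm f \<le> sqrt (norm (star f * f))" by (rule norm_bound)
    then show "(norm f)\<^sup>2 \<le> norm (star f * f)"
      using power_mono[of "norm f" "sqrt (norm (star f * f))" 2] by simp
  qed
qed (rule bcontfun_eqI;
     simp add: apply_times_bcontfun apply_star_bcontfun apply_one_bcontfun apply_scaleC_bcontfun
       scaleC_mult_left scaleC_mult_right star_star star_add star_scaleC star_mult
       algebra_simps)+

end

section \<open>The Hilbert space \<open>\<ell>\<^sup>2(I)\<close>\<close>

text \<open>Every complex Hilbert space is isomorphic to some \<open>\<ell>\<^sup>2(I)\<close>, and
  \<open>\<ell>\<^sup>2(I) \<otimes> \<ell>\<^sup>2(J) = \<ell>\<^sup>2(I \<times> J)\<close>.\<close>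

typedef 'i ell2 = "{f :: 'i \<Rightarrow> complex. (\<lambda>i. (cmod (f i))\<^sup>2) summable_on UNIV}"
  morphisms ell2_apply Abs_ell2
  by (rule exI[of _ "\<lambda>_. 0"]) simp

lemma ell2_summable: "(\<lambda>i. (cmod (ell2_apply x i))\<^sup>2) summable_on UNIV"
  using ell2_apply[of x] by simp

lemma ell2_eqI: "(\<And>i. ell2_apply x i = ell2_apply y i) \<Longrightarrow> x = y"
  by (metis ell2_apply_inject ext)

lemma ell2_apply_Abs: "(\<lambda>i. (cmod (f i))\<^sup>2) summable_on UNIV \<Longrightarrow> ell2_apply (Abs_ell2 f) = f"
  by (simp add: Abs_ell2_inverse)

lemma ell2_summable_add:
  assumes "(\<lambda>i. (cmod (f i))\<^sup>2) summable_on UNIV" "(\<lambda>i. (cmod (g i))\<^sup>2) summable_on UNIV"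
  shows "(\<lambda>i. (cmod (f i + g i))\<^sup>2) summable_on UNIV"
proof (rule summable_on_comparison_test)
  show "(\<lambda>i. 2 * (cmod (f i))\<^sup>2 + 2 * (cmod (g i))\<^sup>2) summable_on UNIV"
    using assms by (intro summable_on_add summable_on_cmult_right)
  fix i
  have "(cmod (f i + g i))\<^sup>2 \<le> (cmod (f i) + cmod (g i))\<^sup>2"
    by (intro power_mono norm_triangle_ineq) simp
  also have "\<dots> \<le> 2 * (cmod (f i))\<^sup>2 + 2 * (cmod (g i))\<^sup>2"
    using sum_squares_bound[of "cmod (f i)" "cmod (g i)"] by (simp add: power2_sum)
  finally show "(cmod (f i + g i))\<^sup>2 \<le> 2 * (cmod (f i))\<^sup>2 + 2 * (cmod (g i))\<^sup>2" .
qed simp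

lemma ell2_summable_scale:
  assumes "(\<lambda>i. (cmod (f i))\<^sup>2) summable_on UNIV"
  shows "(\<lambda>i. (cmod (c * f i))\<^sup>2) summable_on UNIV"
  using summable_on_cmult_right[OF assms, of "(cmod c)\<^sup>2"]
  by (simp add: norm_mult power_mult_distrib)

definition cinner :: "'i ell2 \<Rightarrow> 'i ell2 \<Rightarrow> complex" where
  "cinner x y = (\<Sum>\<^sub>\<infinity>i. cnj (ell2_apply x i) * ell2_apply y i)"

lemma ell2_summable_cinner: "(\<lambda>i. cnj (ell2_apply x i) * ell2_apply y i) summable_on UNIV"
proof (rule summable_on_iff_abs_summable_on_complex[THEN iffD2], rule summable_on_comparison_test)
  show "(\<lambda>i. (cmod (ell2_apply x i))\<^sup>2 + (cmod (ell2_apply y i))\<^sup>2) summable_on UNIV"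
    by (intro summable_on_add ell2_summable)
  fix i
  have "2 * (cmod (ell2_apply x i) * cmod (ell2_apply y i))
      \<le> (cmod (ell2_apply x i))\<^sup>2 + (cmod (ell2_apply y i))\<^sup>2"
    using sum_squares_bound[of "cmod (ell2_apply x i)" "cmod (ell2_apply y i)"] by simp
  moreover have "0 \<le> cmod (ell2_apply x i) * cmod (ell2_apply y i)" by simp
  ultimately show "cmod (cnj (ell2_apply x i) * ell2_apply y i)
      \<le> (cmod (ell2_apply x i))\<^sup>2 + (cmod (ell2_apply y i))\<^sup>2"
    unfolding norm_mult complex_mod_cnj by linarith
qed simp

instantiation ell2 :: (type) real_vector
begin

definition "0 = Abs_ell2 (\<lambda>_. 0)"
definition "x + y = Abs_ell2 (\<lambda>i. ell2_apply x i + ell2_apply y i)"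
definition "- x = Abs_ell2 (\<lambda>i. - ell2_apply x i)"
definition "x - y = Abs_ell2 (\<lambda>i. ell2_apply x i - ell2_apply y i)"
definition "r *\<^sub>R x = Abs_ell2 (\<lambda>i. complex_of_real r * ell2_apply x i)"

lemma ell2_apply_zero: "ell2_apply 0 i = 0"
  by (simp add: zero_ell2_def ell2_apply_Abs)

lemma ell2_apply_add: "ell2_apply (x + y) i = ell2_apply x i + ell2_apply y i"
  by (simp add: plus_ell2_def ell2_apply_Abs ell2_summable_add ell2_summable)

lemma ell2_apply_scaleR: "ell2_apply (r *\<^sub>R x) i = complex_of_real r * ell2_apply x i"
  by (simp only: scaleR_ell2_def ell2_apply_Abs ell2_summable_scale ell2_summable)

lemma ell2_apply_uminus: "ell2_apply (- x) i = - ell2_apply x i"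
  by (simp add: uminus_ell2_def ell2_apply_Abs ell2_summable)

lemma ell2_apply_diff: "ell2_apply (x - y) i = ell2_apply x i - ell2_apply y i"
  using ell2_summable_add[OF ell2_summable[of x] ell2_summable[of "- y"]]
  by (simp add: minus_ell2_def ell2_apply_Abs ell2_apply_uminus)

instance
  by standard (auto intro!: ell2_eqI simp: ell2_apply_add ell2_apply_zero ell2_apply_scaleR
       ell2_apply_uminus ell2_apply_diff algebra_simps)

end

instantiation ell2 :: (type) real_inner
begin

definition "inner x y = Re (cinner x y)"
definition "norm x = sqrt (\<Sum>\<^sub>\<infinity>i. (cmod (ell2_apply x i))\<^sup>2)"
definition "sgn x = x /\<^sub>R norm x" for x :: "'a ell2"
definition "dist x y = norm (x - y)" for x y :: "'a ell2"
definition "uniformity = (INF e\<in>{0 <..}. principal {(x :: 'a ell2, y). dist x y < e})"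
definition "open S = (\<forall>x\<in>S. \<forall>\<^sub>F (x', y) in uniformity. x' = x \<longrightarrow> y \<in> S)" for S :: "'a ell2 set"

lemma inner_ell2_self: "inner x x = (\<Sum>\<^sub>\<infinity>i. (cmod (ell2_apply x i))\<^sup>2)" for x :: "'a ell2"
proof -
  have "inner x x = (\<Sum>\<^sub>\<infinity>i. Re (cnj (ell2_apply x i) * ell2_apply x i))"
    unfolding inner_ell2_def cinner_def by (rule infsum_Re[symmetric]) (rule ell2_summable_cinner)
  also have "\<dots> = (\<Sum>\<^sub>\<infinity>i. (cmod (ell2_apply x i))\<^sup>2)"
    by (intro infsum_cong) (simp add: cmod_power2 flip: power2_eq_square)
  finally show ?thesis .
qed

instance
proof
  fix x y z :: "'a ell2" and r s :: real
  have inner_sum: "inner x y = (\<Sum>\<^sub>\<infinity>i. Re (cnj (ell2_apply x i) * ell2_apply y i))"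
    for x y :: "'a ell2"
    unfolding inner_ell2_def cinner_def by (rule infsum_Re[symmetric]) (rule ell2_summable_cinner)
  show "inner x y = inner y x"
    unfolding inner_sum by (intro infsum_cong) (simp add: algebra_simps)
  show "inner (x + y) z = inner x z + inner y z"
    unfolding inner_ell2_def cinner_def
    by (simp add: ell2_apply_add distrib_right infsum_add ell2_summable_cinner)
  have "cinner (r *\<^sub>R x) y = of_real r * cinner x y"
    unfolding cinner_def
    by (simp add: ell2_apply_scaleR mult.assoc infsum_cmult_right ell2_summable_cinner)
  then show "inner (r *\<^sub>R x) y = r * inner x y"
    by (simp add: inner_ell2_def)
  show "0 \<le> inner x x"
    unfolding inner_ell2_self by (intro infsum_nonneg) simp
  show "inner x x = 0 \<longleftrightarrow> x = 0"
  proof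
    assume "inner x x = 0"
    then have "(cmod (ell2_apply x i))\<^sup>2 = 0" for i
      unfolding inner_ell2_self
      by (intro nonneg_infsum_le_0D[of "\<lambda>i. (cmod (ell2_apply x i))\<^sup>2" UNIV])
        (auto simp: ell2_summable)
    then show "x = 0" by (intro ell2_eqI) (simp add: ell2_apply_zero)
  qed (simp add: inner_ell2_self ell2_apply_zero)
  show "norm x = sqrt (inner x x)"
    by (simp add: norm_ell2_def inner_ell2_self)
  show "open S = (\<forall>x\<in>S. \<forall>\<^sub>F (x', y) in uniformity. x' = x \<longrightarrow> y \<in> S)" for S :: "'a ell2 set"
    by (rule open_ell2_def)
qed (simp_all add: sgn_ell2_def dist_ell2_def uniformity_ell2_def)

end

instantiation ell2 :: (type) complex_normed_vector
begin

definition "c *\<^sub>C x = Abs_ell2 (\<lambda>i. c * ell2_apply x i)"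

lemma ell2_apply_scaleC: "ell2_apply (c *\<^sub>C x) i = c * ell2_apply x i"
  by (simp only: scaleC_ell2_def ell2_apply_Abs ell2_summable_scale ell2_summable)

instance
proof
  fix c :: complex and x :: "'a ell2"
  have "(\<Sum>\<^sub>\<infinity>i. (cmod (ell2_apply (c *\<^sub>C x) i))\<^sup>2) = (cmod c)\<^sup>2 * (\<Sum>\<^sub>\<infinity>i. (cmod (ell2_apply x i))\<^sup>2)"
    by (simp add: ell2_apply_scaleC norm_mult power_mult_distrib infsum_cmult_right ell2_summable)
  then show "norm (c *\<^sub>C x) = cmod c * norm x"
    by (simp add: norm_ell2_def real_sqrt_mult)
qed (auto intro!: ell2_eqI simp: ell2_apply_scaleC ell2_apply_add ell2_apply_scaleR algebra_simps)

end

lemma ell2_finite_sum_le: "finite F \<Longrightarrow> (\<Sum>i\<in>F. (cmod (ell2_apply x i))\<^sup>2) \<le> (norm x)\<^sup>2"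
  unfolding norm_ell2_def
  by (subst real_sqrt_pow2) (auto intro!: infsum_nonneg finite_sum_le_infsum ell2_summable)

lemma ell2_boundI:
  assumes "\<And>F. finite F \<Longrightarrow> (\<Sum>i\<in>F. (cmod (f i))\<^sup>2) \<le> b\<^sup>2" and "0 \<le> b"
  shows "(\<lambda>i. (cmod (f i))\<^sup>2) summable_on UNIV" and "norm (Abs_ell2 f) \<le> b"
proof -
  show *: "(\<lambda>i. (cmod (f i))\<^sup>2) summable_on UNIV"
    by (rule nonneg_bdd_above_summable_on) (auto intro!: bdd_aboveI assms(1))
  have "(\<Sum>\<^sub>\<infinity>i. (cmod (f i))\<^sup>2) \<le> b\<^sup>2"
    using * assms(1) by (intro infsum_le_finite_sums) auto
  then show "norm (Abs_ell2 f) \<le> b"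
    unfolding norm_ell2_def ell2_apply_Abs[OF *] using assms(2) real_le_lsqrt by blast
qed

instance ell2 :: (type) banach
proof
  fix X :: "nat \<Rightarrow> 'a ell2"
  assume X: "Cauchy X"
  have coord: "cmod (ell2_apply x i) \<le> norm x" for x :: "'a ell2" and i
    using ell2_finite_sum_le[of "{i}" x] by simp
  have "Cauchy (\<lambda>n. ell2_apply (X n) i)" for i
    using X unfolding Cauchy_def dist_norm
    by (metis coord ell2_apply_diff le_less_trans)
  then have "\<forall>i. \<exists>l. (\<lambda>n. ell2_apply (X n) i) \<longlonglongrightarrow> l"
    by (simp add: Cauchy_convergent_iff convergent_def)
  then obtain l where l: "\<And>i. (\<lambda>n. ell2_apply (X n) i) \<longlonglongrightarrow> l i" by metis
  have close: "\<exists>N. \<forall>n\<ge>N. \<forall>F. finite F \<longrightarrow> (\<Sum>i\<in>F. (cmod (ell2_apply (X n) i - l i))\<^sup>2) \<le> e\<^sup>2"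
    if "e > 0" for e :: real
  proof -
    obtain N where N: "\<And>m n. m \<ge> N \<Longrightarrow> n \<ge> N \<Longrightarrow> norm (X m - X n) < e"
      using X \<open>e > 0\<close> unfolding Cauchy_def dist_norm by metis
    have "(\<Sum>i\<in>F. (cmod (ell2_apply (X n) i - l i))\<^sup>2) \<le> e\<^sup>2" if "n \<ge> N" "finite F" for n F
    proof (rule LIMSEQ_le_const2)
      show "(\<lambda>m. \<Sum>i\<in>F. (cmod (ell2_apply (X n) i - ell2_apply (X m) i))\<^sup>2)
          \<longlonglongrightarrow> (\<Sum>i\<in>F. (cmod (ell2_apply (X n) i - l i))\<^sup>2)"
        by (intro tendsto_intros l)
      have "(\<Sum>i\<in>F. (cmod (ell2_apply (X n) i - ell2_apply (X m) i))\<^sup>2) \<le> e\<^sup>2" if "m \<ge> N" for m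
      proof -
        have "(\<Sum>i\<in>F. (cmod (ell2_apply (X n - X m) i))\<^sup>2) \<le> (norm (X n - X m))\<^sup>2"
          by (rule ell2_finite_sum_le) fact
        also have "\<dots> \<le> e\<^sup>2"
          using N[of n m] \<open>n \<ge> N\<close> that by (intro power_mono) auto
        finally show ?thesis by (simp add: ell2_apply_diff)
      qed
      then show "\<exists>M. \<forall>m\<ge>M. (\<Sum>i\<in>F. (cmod (ell2_apply (X n) i - ell2_apply (X m) i))\<^sup>2) \<le> e\<^sup>2"
        by blast
    qed
    then show ?thesis by blast
  qed
  obtain N where N: "\<And>F. finite F \<Longrightarrow> (\<Sum>i\<in>F. (cmod (ell2_apply (X N) i - l i))\<^sup>2) \<le> 1\<^sup>2"
    using close[of 1] by auto
  have "(\<lambda>i. (cmod (ell2_apply (X N) i - l i))\<^sup>2) summable_on UNIV"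
    using ell2_boundI(1)[of "\<lambda>i. ell2_apply (X N) i - l i" 1] N by simp
  then have "(\<lambda>i. (cmod (-1 * (ell2_apply (X N) i - l i)))\<^sup>2) summable_on UNIV"
    by (rule ell2_summable_scale)
  from ell2_summable_add[OF this ell2_summable[of "X N"]]
  have l_summable: "(\<lambda>i. (cmod (l i))\<^sup>2) summable_on UNIV" by simp
  have "X \<longlonglongrightarrow> Abs_ell2 l"
  proof (rule LIMSEQ_I)
    fix r :: real
    assume "r > 0"
    with close[of "r / 2"] obtain N where N:
      "\<And>n F. n \<ge> N \<Longrightarrow> finite F \<Longrightarrow> (\<Sum>i\<in>F. (cmod (ell2_apply (X n) i - l i))\<^sup>2) \<le> (r / 2)\<^sup>2"
      by auto
    have "norm (X n - Abs_ell2 l) < r" if "n \<ge> N" for n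
    proof -
      have "norm (Abs_ell2 (\<lambda>i. ell2_apply (X n) i - l i)) \<le> r / 2"
        using N[OF that] \<open>r > 0\<close> by (intro ell2_boundI) auto
      then show ?thesis
        using \<open>r > 0\<close> by (simp add: minus_ell2_def ell2_apply_Abs[OF l_summable])
    qed
    then show "\<exists>no. \<forall>n\<ge>no. norm (X n - Abs_ell2 l) < r" by blast
  qed
  then show "convergent X" by (rule convergentI)
qed

section \<open>Operators\<close>

instantiation blinfun :: (real_normed_vector, complex_normed_vector) complex_normed_vector
begin

definition "c *\<^sub>C T = Blinfun (\<lambda>x. c *\<^sub>C blinfun_apply T x)"

lemma blinfun_apply_scaleC: "blinfun_apply (c *\<^sub>C T) x = c *\<^sub>C blinfun_apply T x"
  for T :: "'a \<Rightarrow>\<^sub>L 'b"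
  unfolding scaleC_blinfun_def
  by (subst bounded_linear_Blinfun_apply)
    (auto intro: bounded_linear_compose[OF bounded_linear_scaleC] blinfun.bounded_linear_right)

instance
proof
  fix c d :: complex and S T :: "'a \<Rightarrow>\<^sub>L 'b" and r :: real
  have *: "norm (e *\<^sub>C V) \<le> cmod e * norm V" for e and V :: "'a \<Rightarrow>\<^sub>L 'b"
    by (rule norm_blinfun_bound)
      (auto simp: blinfun_apply_scaleC norm_scaleC mult.assoc intro!: mult_left_mono norm_blinfun)
  have assoc: "c *\<^sub>C (d *\<^sub>C T) = (c * d) *\<^sub>C T" for c d and T :: "'a \<Rightarrow>\<^sub>L 'b"
    by (rule blinfun_eqI) (simp add: blinfun_apply_scaleC scaleC_scaleC)
  show "c *\<^sub>C (d *\<^sub>C T) = (c * d) *\<^sub>C T" by (rule assoc)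
  have real: "r *\<^sub>R T = complex_of_real r *\<^sub>C T" for r and T :: "'a \<Rightarrow>\<^sub>L 'b"
    by (rule blinfun_eqI) (simp add: blinfun_apply_scaleC scaleR_scaleC blinfun.scaleR_left)
  show "r *\<^sub>R T = complex_of_real r *\<^sub>C T" by (rule real)
  show "norm (c *\<^sub>C T) = cmod c * norm T"
  proof (cases "c = 0")
    case True
    then show ?thesis using *[of c T] by simp
  next
    case False
    have "norm T = norm (inverse c *\<^sub>C (c *\<^sub>C T))"
      using False real[of 1 T] by (simp add: assoc)
    also have "\<dots> \<le> cmod (inverse c) * norm (c *\<^sub>C T)" by (rule *)
    finally show ?thesis using *[of c T] False by (simp add: norm_inverse norm_divide field_simps)
  qed
qed (rule blinfun_eqI;
     simp add: blinfun_apply_scaleC scaleC_add_left scaleC_add_right blinfun.add_left)+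

end

text \<open>\<open>blinfun\<close> is the type of bounded \<^emph>\<open>real\<close>-linear maps; \<open>bounded_operators\<close> is \<open>B(\<ell>\<^sup>2(I))\<close>.\<close>

type_synonym 'i op = "'i ell2 \<Rightarrow>\<^sub>L 'i ell2"

definition bounded_operators :: "'i op set" where
  "bounded_operators = {T. \<forall>c x. blinfun_apply T (c *\<^sub>C x) = c *\<^sub>C blinfun_apply T x}"

definition is_adjoint :: "'i op \<Rightarrow> 'i op \<Rightarrow> bool" where
  "is_adjoint S T \<longleftrightarrow>
     (\<forall>x y. cinner (blinfun_apply S x) y = cinner x (blinfun_apply T y))"

definition ell2_tensor :: "'i ell2 \<Rightarrow> 'j ell2 \<Rightarrow> ('i \<times> 'j) ell2" where
  "ell2_tensor x y = Abs_ell2 (\<lambda>(i, j). ell2_apply x i * ell2_apply y j)"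

definition op_tensor :: "'i op \<Rightarrow> 'j op \<Rightarrow> ('i \<times> 'j) op" (infixr "\<otimes>\<^sub>o" 70) where
  "S \<otimes>\<^sub>o T = (THE U. U \<in> bounded_operators \<and>
     (\<forall>x y. blinfun_apply U (ell2_tensor x y)
        = ell2_tensor (blinfun_apply S x) (blinfun_apply T y)))"

definition diag_op :: "('i \<Rightarrow> complex) \<Rightarrow> 'i op" where
  "diag_op g = Blinfun (\<lambda>x. Abs_ell2 (\<lambda>i. g i * ell2_apply x i))"

text \<open>The identification of the operators on \<open>(H \<otimes> K) \<otimes> L\<close> with those on \<open>H \<otimes> (K \<otimes> L)\<close>.\<close>

definition ell2_reindex :: "('j \<Rightarrow> 'i) \<Rightarrow> 'i ell2 \<Rightarrow>\<^sub>L 'j ell2" where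
  "ell2_reindex p = Blinfun (\<lambda>x. Abs_ell2 (\<lambda>j. ell2_apply x (p j)))"

definition op_assoc :: "(('i \<times> 'j) \<times> 'k) op \<Rightarrow> ('i \<times> 'j \<times> 'k) op" where
  "op_assoc T =
     ell2_reindex (\<lambda>(i, j, k). ((i, j), k)) o\<^sub>L T o\<^sub>L ell2_reindex (\<lambda>((i, j), k). (i, j, k))"

section \<open>Representations and minimal tensor products\<close>

definition unital_star_hom :: "('a::cstar_algebra \<Rightarrow> 'i op) \<Rightarrow> bool" where
  "unital_star_hom \<phi> \<longleftrightarrow>
     range \<phi> \<subseteq> bounded_operators \<and>
     (\<forall>a b. \<phi> (a + b) = \<phi> a + \<phi> b) \<and>
     (\<forall>c a. \<phi> (c *\<^sub>C a) = c *\<^sub>C \<phi> a) \<and>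
     (\<forall>a b. \<phi> (a * b) = \<phi> a o\<^sub>L \<phi> b) \<and>
     \<phi> 1 = id_blinfun \<and>
     (\<forall>a. is_adjoint (\<phi> (star a)) (\<phi> a))"

text \<open>For *-homomorphisms of C*-algebras, isometric is the same as injective (faithful); every
  C*-algebra has such a representation by the Gelfand-Naimark theorem.\<close>

definition faithful_rep :: "('a::cstar_algebra \<Rightarrow> 'i op) \<Rightarrow> bool" where
  "faithful_rep \<pi> \<longleftrightarrow> unital_star_hom \<pi> \<and> (\<forall>a. norm (\<pi> a) = norm a)"

text \<open>The minimal (spatial) tensor product of two C*-algebras, faithfully represented by \<open>\<rho>\<close> on
  \<open>H\<close> and by \<open>\<sigma>\<close> on \<open>K\<close>, is the norm closure in \<open>B(H \<otimes> K)\<close> of the span of the operators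
  \<open>\<rho> b \<otimes> \<sigma> a\<close>. It does not depend, up to a canonical isomorphism, on the choice of \<open>\<rho>\<close> and \<open>\<sigma>\<close>.
  In this picture \<open>b \<otimes> a\<close> is the operator \<open>\<rho> b \<otimes>\<^sub>o \<sigma> a\<close>.\<close>

definition min_tensor :: "('b \<Rightarrow> 'i op) \<Rightarrow> ('a \<Rightarrow> 'j op) \<Rightarrow> ('i \<times> 'j) op set" where
  "min_tensor \<rho> \<sigma> = closure (cspan {\<rho> b \<otimes>\<^sub>o \<sigma> a | b a. True})"

text \<open>\<open>tensor_ext \<rho> \<sigma> \<beta>\<close> is the continuous linear map on \<open>min_tensor \<rho> \<sigma>\<close> that sends \<open>b \<otimes> a\<close> to
  \<open>\<beta> b a\<close>, extended by \<open>0\<close> off \<open>min_tensor \<rho> \<sigma>\<close> to make it a unique function on the type. For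
  \<open>\<beta> b a = \<phi> b \<otimes> \<psi> a\<close> this is the map \<open>\<phi> \<otimes> \<psi>\<close>.\<close>

definition tensor_ext ::
  "('b \<Rightarrow> 'i op) \<Rightarrow> ('a \<Rightarrow> 'j op) \<Rightarrow> ('b \<Rightarrow> 'a \<Rightarrow> 'v::complex_normed_vector) \<Rightarrow> ('i \<times> 'j) op \<Rightarrow> 'v" where
  "tensor_ext \<rho> \<sigma> \<beta> = (THE F.
     clinear_on (min_tensor \<rho> \<sigma>) F \<and> continuous_on (min_tensor \<rho> \<sigma>) F \<and>
     (\<forall>b a. F (\<rho> b \<otimes>\<^sub>o \<sigma> a) = \<beta> b a) \<and> (\<forall>t. t \<notin> min_tensor \<rho> \<sigma> \<longrightarrow> F t = 0))"

section \<open>Compact quantum groups\<close>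

text \<open>\<open>A\<close> is the type \<open>'a\<close>, and \<open>\<pi>\<close> is the faithful representation used to form tensor products
  with \<open>A\<close>. The representation of \<open>A \<otimes> A\<close> is its inclusion into \<open>B(H \<otimes> H)\<close>.\<close>

definition compact_quantum_group ::
  "('a::cstar_algebra \<Rightarrow> 'i op) \<Rightarrow> ('a \<Rightarrow> ('i \<times> 'i) op) \<Rightarrow> bool" where
  "compact_quantum_group \<pi> \<Delta> \<longleftrightarrow>
     unital_star_hom \<Delta> \<and> range \<Delta> \<subseteq> min_tensor \<pi> \<pi> \<and>
     (\<forall>a. tensor_ext \<pi> \<pi> (\<lambda>b c. \<pi> b \<otimes>\<^sub>o \<Delta> c) (\<Delta> a)
        = op_assoc (tensor_ext \<pi> \<pi> (\<lambda>b c. \<Delta> b \<otimes>\<^sub>o \<pi> c) (\<Delta> a))) \<and>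
     closure (cspan {\<Delta> a o\<^sub>L (\<pi> 1 \<otimes>\<^sub>o \<pi> b) | a b. True}) = min_tensor \<pi> \<pi> \<and>
     closure (cspan {\<Delta> a o\<^sub>L (\<pi> b \<otimes>\<^sub>o \<pi> 1) | a b. True}) = min_tensor \<pi> \<pi>"

definition state :: "('a::cstar_algebra \<Rightarrow> complex) \<Rightarrow> bool" where
  "state \<phi> \<longleftrightarrow> clinear_on UNIV \<phi> \<and> (\<forall>a. \<phi> (star a * a) \<in> \<real>\<^sub>\<ge>\<^sub>0) \<and> \<phi> 1 = 1"

text \<open>At most one state satisfies these two invariance conditions, so this determines the Haar
  measure.\<close>

definition haar_measure ::
  "('a::cstar_algebra \<Rightarrow> 'i op) \<Rightarrow> ('a \<Rightarrow> ('i \<times> 'i) op) \<Rightarrow> ('a \<Rightarrow> complex) \<Rightarrow> bool" where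
  "haar_measure \<pi> \<Delta> h \<longleftrightarrow> state h \<and>
     (\<forall>a. tensor_ext \<pi> \<pi> (\<lambda>b c. h b *\<^sub>C c) (\<Delta> a) = h a *\<^sub>C 1) \<and>
     (\<forall>a. tensor_ext \<pi> \<pi> (\<lambda>b c. h c *\<^sub>C b) (\<Delta> a) = h a *\<^sub>C 1)"

definition faithful_state :: "('a::cstar_algebra \<Rightarrow> complex) \<Rightarrow> bool" where
  "faithful_state \<phi> \<longleftrightarrow> (\<forall>a. \<phi> (star a * a) = 0 \<longrightarrow> a = 0)"

section \<open>Actions on compact Hausdorff spaces\<close>

text \<open>The faithful representation of \<open>B = C(X)\<close> on \<open>\<ell>\<^sup>2(X)\<close> by multiplication operators.\<close>

definition mult_op :: "('x::topological_space \<Rightarrow>\<^sub>C complex) \<Rightarrow> 'x op" where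
  "mult_op f = diag_op (apply_bcontfun f)"

definition cqg_action ::
  "('a::cstar_algebra \<Rightarrow> 'i op) \<Rightarrow> ('a \<Rightarrow> ('i \<times> 'i) op) \<Rightarrow>
    (('x::topological_space \<Rightarrow>\<^sub>C complex) \<Rightarrow> ('x \<times> 'i) op) \<Rightarrow> bool" where
  "cqg_action \<pi> \<Delta> \<alpha> \<longleftrightarrow>
     unital_star_hom \<alpha> \<and> range \<alpha> \<subseteq> min_tensor mult_op \<pi> \<and>
     (\<forall>f. op_assoc (tensor_ext mult_op \<pi> (\<lambda>g a. \<alpha> g \<otimes>\<^sub>o \<pi> a) (\<alpha> f))
        = tensor_ext mult_op \<pi> (\<lambda>g a. mult_op g \<otimes>\<^sub>o \<Delta> a) (\<alpha> f)) \<and>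
     closure (cspan {\<alpha> f o\<^sub>L (mult_op 1 \<otimes>\<^sub>o \<pi> a) | f a. True}) = min_tensor mult_op \<pi>"

text \<open>\<open>\<alpha>\<^sub>x = (ev\<^sub>x \<otimes> id) \<alpha>\<close> and \<open>\<mu>\<^sub>x = (ev\<^sub>x \<otimes> h) \<alpha>\<close>.\<close>

definition action_at ::
  "('a::cstar_algebra \<Rightarrow> 'i op) \<Rightarrow> (('x::topological_space \<Rightarrow>\<^sub>C complex) \<Rightarrow> ('x \<times> 'i) op) \<Rightarrow>
    'x \<Rightarrow> ('x \<Rightarrow>\<^sub>C complex) \<Rightarrow> 'a" where
  "action_at \<pi> \<alpha> x f = tensor_ext mult_op \<pi> (\<lambda>g a. apply_bcontfun g x *\<^sub>C a) (\<alpha> f)"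

definition orbit_state ::
  "('a::cstar_algebra \<Rightarrow> 'i op) \<Rightarrow> ('a \<Rightarrow> complex) \<Rightarrow>
    (('x::topological_space \<Rightarrow>\<^sub>C complex) \<Rightarrow> ('x \<times> 'i) op) \<Rightarrow> 'x \<Rightarrow> ('x \<Rightarrow>\<^sub>C complex) \<Rightarrow> complex" where
  "orbit_state \<pi> h \<alpha> x f = tensor_ext mult_op \<pi> (\<lambda>g a. apply_bcontfun g x * h a) (\<alpha> f)"

definition kernel_zero_set ::
  "('a::cstar_algebra \<Rightarrow> 'i op) \<Rightarrow> (('x::topological_space \<Rightarrow>\<^sub>C complex) \<Rightarrow> ('x \<times> 'i) op) \<Rightarrow>
    'x \<Rightarrow> 'x set" where
  "kernel_zero_set \<pi> \<alpha> x = {y. \<forall>f. action_at \<pi> \<alpha> x f = 0 \<longrightarrow> apply_bcontfun f y = 0}"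

definition cqg_orbit ::
  "('a::cstar_algebra \<Rightarrow> 'i op) \<Rightarrow> ('a \<Rightarrow> complex) \<Rightarrow>
    (('x::topological_space \<Rightarrow>\<^sub>C complex) \<Rightarrow> ('x \<times> 'i) op) \<Rightarrow> 'x \<Rightarrow> 'x set" where
  "cqg_orbit \<pi> h \<alpha> x = {x'. orbit_state \<pi> h \<alpha> x = orbit_state \<pi> h \<alpha> x'}"

definition vanishing_ideal :: "'x set \<Rightarrow> ('x::topological_space \<Rightarrow>\<^sub>C complex) set" where
  "vanishing_ideal Y = {f. \<forall>y\<in>Y. apply_bcontfun f y = 0}"

text \<open>Elements of \<open>B/J\<^sub>Y\<close> are the cosets \<open>f + J\<^sub>Y\<close>. Such a coset determines \<open>f\<close> on \<open>Y\<close>, and \<open>B/J\<^sub>Y\<close>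
  is faithfully represented on \<open>\<ell>\<^sup>2(Y)\<close>, a subspace of \<open>\<ell>\<^sup>2(X)\<close>, by multiplication.\<close>

definition quotient_map ::
  "'x set \<Rightarrow> ('x::topological_space \<Rightarrow>\<^sub>C complex) \<Rightarrow> ('x \<Rightarrow>\<^sub>C complex) set" where
  "quotient_map Y f = {g. g - f \<in> vanishing_ideal Y}"

definition quotient_op :: "'x set \<Rightarrow> ('x::topological_space \<Rightarrow>\<^sub>C complex) set \<Rightarrow> 'x op" where
  "quotient_op Y q =
     diag_op (\<lambda>y. if y \<in> Y then apply_bcontfun (SOME f. f \<in> q) y else 0)"

definition invariant_set ::
  "('a::cstar_algebra \<Rightarrow> 'i op) \<Rightarrow> (('x::topological_space \<Rightarrow>\<^sub>C complex) \<Rightarrow> ('x \<times> 'i) op) \<Rightarrow>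
    'x set \<Rightarrow> bool" where
  "invariant_set \<pi> \<alpha> Y \<longleftrightarrow> closed Y \<and>
     (\<forall>f\<in>vanishing_ideal Y.
        tensor_ext mult_op \<pi> (\<lambda>g a. quotient_op Y (quotient_map Y g) \<otimes>\<^sub>o \<pi> a) (\<alpha> f) = 0)"

definition minimal_invariant_set ::
  "('a::cstar_algebra \<Rightarrow> 'i op) \<Rightarrow> (('x::topological_space \<Rightarrow>\<^sub>C complex) \<Rightarrow> ('x \<times> 'i) op) \<Rightarrow>
    'x set \<Rightarrow> bool" where
  "minimal_invariant_set \<pi> \<alpha> Y \<longleftrightarrow> Y \<noteq> {} \<and> invariant_set \<pi> \<alpha> Y \<and>
     (\<forall>Z. Z \<subseteq> Y \<and> Z \<noteq> {} \<and> invariant_set \<pi> \<alpha> Z \<longrightarrow> Z = Y)"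

section \<open>Supports of states on \<open>C(X)\<close>\<close>

definition regular_borel_probability :: "'x::topological_space measure \<Rightarrow> bool" where
  "regular_borel_probability M \<longleftrightarrow>
     sets M = sets borel \<and> emeasure M (space M) = 1 \<and>
     (\<forall>E\<in>sets borel. emeasure M E = (SUP K\<in>{K. K \<subseteq> E \<and> compact K}. emeasure M K)) \<and>
     (\<forall>E\<in>sets borel. emeasure M E = (INF U\<in>{U. E \<subseteq> U \<and> open U}. emeasure M U))"

text \<open>By the Riesz representation theorem, every state on \<open>C(X)\<close>, \<open>X\<close> compact Hausdorff, is
  represented by exactly one such measure.\<close>

definition represents :: "'x::topological_space measure \<Rightarrow> (('x \<Rightarrow>\<^sub>C complex) \<Rightarrow> complex) \<Rightarrow> bool" where
  "represents M \<phi> \<longleftrightarrow> regular_borel_probability M \<and> (\<forall>f. \<phi> f = (\<integral>y. apply_bcontfun f y \<partial>M))"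

definition support :: "'x::topological_space measure \<Rightarrow> 'x set" where
  "support M = {y. \<forall>U. open U \<and> y \<in> U \<longrightarrow> emeasure M U \<noteq> 0}"

end

theory Submission
  imports Defs
begin

text \<open>
  An element \<open>t\<close> of \<open>C(X) \<otimes> A\<close> is a function on \<open>X\<close> with values in \<open>A\<close>; so \<open>\<alpha>\<close> is a family of
  *-homomorphisms \<open>\<alpha>\<^sub>x : C(X) \<rightarrow> A\<close>, with \<open>\<mu>\<^sub>x = h \<circ> \<alpha>\<^sub>x\<close>, and evaluating the action identity at \<open>x\<close> gives
  \<open>(\<alpha>\<^sub>x \<otimes> id) \<alpha> = \<Delta> \<alpha>\<^sub>x\<close>. Slicing its right leg by \<open>h\<close> shows that \<open>\<alpha>\<^sub>x\<close> maps \<open>y \<mapsto> \<mu>\<^sub>y f\<close> to the scalar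
  \<open>\<mu>\<^sub>x f\<close>, so this function is constant on \<open>\<M>\<^sub>x\<close>. Slicing the left leg by \<open>h\<close> shows that \<open>\<mu>\<^sub>x\<close> is
  invariant, \<open>(\<mu>\<^sub>x \<otimes> id) \<alpha> = \<mu>\<^sub>x\<close>; so if \<open>f\<close> vanishes on the support of \<open>\<mu>\<^sub>x\<close>, then the nonnegative
  function \<open>y \<mapsto> \<alpha>\<^sub>y(f)\<^sup>* \<alpha>\<^sub>y(f)\<close> has \<open>\<mu>\<^sub>x\<close>-integral \<open>\<mu>\<^sub>x(f\<^sup>* f) = 0\<close>, hence vanishes there as well. A closed
  invariant \<open>Z\<close> inside the support contains a point \<open>z\<close> with \<open>\<mu>\<^sub>z = \<mu>\<^sub>x\<close>, and \<open>\<mu>\<^sub>z\<close> is supported on \<open>Z\<close>,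
  which gives minimality.

  All maps out of minimal tensor products are defined by their values on elementary tensors, so each
  needs a norm bound on the algebraic tensor product. They reduce to the contractivity of
  states and *-homomorphisms, which comes from writing \<open>1 - a\<^sup>* a\<close> as a square by the binomial series.
\<close>

text \<open>Representing C(X) on the \<open>ell2\<close> space over the points of X makes every
  element of C(X) \<otimes> A block diagonal, the block at a point being \<pi> of the value there.
  Norms become suprema over points, and \<open>\<alpha>\<^sub>x\<close> inherits products and
  adjoints from \<alpha> by passing to a block. One map does not fit this picture:
  \<open>\<alpha>\<^sub>x \<otimes> id\<close> lands in operators that are not diagonal over X. Its
  contractivity is the hardest bound and rests on partitions of unity. A second obstacle is that
  \<open>(\<mu>\<^sub>x \<otimes> id) \<alpha>\<close> takes values in A while the measure
  integrates complex functions. Each vector \<zeta> therefore supplies a scalar test function, the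
  squared norm of \<open>\<pi> (\<alpha>\<^sub>z f)\<close> applied to \<zeta>. It is continuous and
  nonnegative in z, so a zero integral makes it vanish on the support, and varying \<zeta> recovers
  \<open>\<alpha>\<^sub>z f = 0\<close>. In general h (star a * a) = 0 does not force a = 0. This is
  why the kernel of \<open>\<alpha>\<^sub>x\<close> and the ideal of the support are kept apart
  until h is assumed faithful.\<close>

lemma scaleC_1: "1 *\<^sub>C x = (x::'a::complex_normed_vector)"
  using scaleR_scaleC[of 1 x] by simp

lemma scaleC_0_left: "0 *\<^sub>C x = (0::'a::complex_normed_vector)"
  using scaleR_scaleC[of 0 x] by simp

lemma scaleC_0_right: "c *\<^sub>C (0::'a::complex_normed_vector) = 0"
  using norm_scaleC[of c 0] by simp

lemma scaleC_minus1: "(-1) *\<^sub>C x = - (x::'a::complex_normed_vector)"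
  using scaleR_scaleC[of "-1" x] by simp

lemma scaleC_diff_right: "c *\<^sub>C (x - y) = c *\<^sub>C x - c *\<^sub>C (y::'a::complex_normed_vector)"
  using scaleC_add_right[of c "x - y" y] by (simp add: algebra_simps)

section \<open>Inner product and orthonormal basis of \<open>\<ell>\<^sup>2(I)\<close>\<close>

lemma cinner_add_right: "cinner x (y + z) = cinner x y + cinner x z"
  by (simp add: cinner_def ell2_apply_add distrib_left infsum_add ell2_summable_cinner)

lemma cinner_scaleC_right: "cinner x (c *\<^sub>C y) = c * cinner x y"
  by (simp add: cinner_def ell2_apply_scaleC mult.left_commute infsum_cmult_right
      ell2_summable_cinner)

lemma cinner_commute: "cinner y x = cnj (cinner x y)"
  unfolding cinner_def by (subst infsum_cnj[symmetric]) (simp add: mult.commute)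

lemma cinner_add_left: "cinner (x + y) z = cinner x z + cinner y z"
  using cinner_add_right[of z x y] by (metis cinner_commute complex_cnj_add)

lemma cinner_0_right: "cinner x 0 = 0"
  using cinner_add_right[of x 0 0] by simp

lemma cinner_diff_right: "cinner x (y - z) = cinner x y - cinner x z"
  using cinner_add_right[of x "y - z" z] by simp

lemma cinner_sum_right: "cinner x (\<Sum>i\<in>F. f i) = (\<Sum>i\<in>F. cinner x (f i))"
  by (induction F rule: infinite_finite_induct) (simp_all add: cinner_0_right cinner_add_right)

lemma cinner_self: "cinner x x = of_real ((norm x)\<^sup>2)"
proof -
  have "Im (cinner x x) = 0"
    using cinner_commute[of x x] by (metis Reals_cnj_iff complex_is_Real_iff)
  moreover have "Re (cinner x x) = (norm x)\<^sup>2"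
    using power2_norm_eq_inner[of x] by (simp only: inner_ell2_def)
  ultimately show ?thesis by (simp add: complex_eq_iff)
qed

lemma cinner_eq_0_iff: "cinner x x = 0 \<longleftrightarrow> x = 0"
  by (simp add: cinner_self)

text \<open>The real inner product sees only the real part of \<open>cinner\<close>; a phase on
  \<open>y\<close> makes \<open>cinner x y\<close> real and nonnegative without changing
  norms.\<close>

lemma norm_cinner_le: "cmod (cinner x y) \<le> norm x * norm y"
proof (cases "cinner x y = 0")
  case False
  define c where "c = cnj (cinner x y) / cmod (cinner x y)"
  have c: "cmod c = 1" using False by (simp add: c_def norm_divide)
  have "c * cinner x y = cmod (cinner x y)"
    using False complex_norm_square[of "cinner x y"]
    by (simp add: c_def field_simps power2_eq_square)
  then have "cmod (cinner x y) = inner x (c *\<^sub>C y)"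
    by (simp add: inner_ell2_def cinner_scaleC_right)
  also have "\<dots> \<le> norm x * norm (c *\<^sub>C y)"
    by (rule norm_cauchy_schwarz)
  finally show ?thesis by (simp add: norm_scaleC c)
qed simp

lemma scaleR_ell2: "r *\<^sub>R x = complex_of_real r *\<^sub>C (x::'i ell2)"
  by (rule scaleR_scaleC)

lemma bounded_linear_cinner_right: "bounded_linear (cinner x)"
  by (rule bounded_linear_intro[where K = "norm x"])
    (simp_all add: cinner_add_right scaleR_scaleC cinner_scaleC_right scaleC_complex_def
      norm_cinner_le mult.commute[of _ "norm x"])

lemma ell2_cinner_eqI: "(\<And>z. cinner z x = cinner z y) \<Longrightarrow> x = y"
  by (metis cinner_diff_right cinner_eq_0_iff right_minus_eq)

lemma norm_ell2_le:
  assumes "\<And>F. finite F \<Longrightarrow> (\<Sum>i\<in>F. (cmod (ell2_apply x i))\<^sup>2) \<le> b\<^sup>2" and "0 \<le> b"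
  shows "norm x \<le> b"
  using ell2_boundI(2)[OF assms] by (simp add: ell2_apply_inverse)

definition ell2_unit :: "'i \<Rightarrow> 'i ell2" where
  "ell2_unit i = Abs_ell2 (\<lambda>j. if j = i then 1 else 0)"

lemma ell2_apply_unit: "ell2_apply (ell2_unit i) j = (if j = i then 1 else 0)"
proof -
  have "(\<lambda>j. (cmod (if j = i then 1 else 0))\<^sup>2) summable_on UNIV"
  proof (rule ell2_boundI(1)[where b = 1])
    fix F :: "'a set" assume "finite F"
    then have "(\<Sum>j\<in>F. (cmod (if j = i then 1 else 0))\<^sup>2) = (\<Sum>j\<in>F. if j = i then 1 else 0)"
      by (intro sum.cong) auto
    with \<open>finite F\<close> show "(\<Sum>j\<in>F. (cmod (if j = i then 1 else 0))\<^sup>2) \<le> 1\<^sup>2" by simp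
  qed simp
  then show ?thesis by (simp add: ell2_unit_def ell2_apply_Abs)
qed

lemma ell2_apply_sum: "ell2_apply (\<Sum>k\<in>F. f k) i = (\<Sum>k\<in>F. ell2_apply (f k) i)"
  by (induction F rule: infinite_finite_induct) (simp_all add: ell2_apply_zero ell2_apply_add)

lemma ell2_approx:
  assumes "e > 0"
  obtains F where "finite F" "norm (x - (\<Sum>i\<in>F. ell2_apply x i *\<^sub>C ell2_unit i)) \<le> e"
proof -
  let ?s = "\<lambda>i. (cmod (ell2_apply x i))\<^sup>2"
  have "(?s has_sum infsum ?s UNIV) UNIV"
    using ell2_summable by (rule has_sum_infsum)
  \<comment> \<open>Beyond F the finite sums of squares stay within \<open>e\<^sup>2\<close> of the
    total, so the tail outside F is at most that.\<close>
  then obtain F where F: "finite F" "\<And>G. finite G \<Longrightarrow> F \<subseteq> G \<Longrightarrow> dist (sum ?s G) (infsum ?s UNIV) < e\<^sup>2"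
    using assms unfolding has_sum_def tendsto_iff eventually_finite_subsets_at_top
    by (metis subset_UNIV zero_less_power)
  have "norm (x - (\<Sum>i\<in>F. ell2_apply x i *\<^sub>C ell2_unit i)) \<le> e"
  proof (rule norm_ell2_le)
    fix G :: "'a set" assume G: "finite G"
    have a: "ell2_apply (x - (\<Sum>i\<in>F. ell2_apply x i *\<^sub>C ell2_unit i)) j
        = (if j \<in> F then 0 else ell2_apply x j)" for j
      using F(1) by (simp add: ell2_apply_diff ell2_apply_sum ell2_apply_scaleC ell2_apply_unit
          if_distrib[of "\<lambda>c. _ * c"] cong: if_cong)
    have "(\<Sum>j\<in>G. (cmod (ell2_apply (x - (\<Sum>i\<in>F. ell2_apply x i *\<^sub>C ell2_unit i)) j))\<^sup>2)
        = (\<Sum>j\<in>G - F. ?s j)"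
      unfolding a using G by (intro sum.mono_neutral_cong_right) auto
    also have "\<dots> = sum ?s (F \<union> G) - sum ?s F"
      using F(1) G by (metis Un_Diff_cancel add_diff_cancel_left' finite_Diff sum.union_disjoint
          Diff_disjoint)
    also have "\<dots> \<le> infsum ?s UNIV - sum ?s F"
      using F(1) G by (intro diff_right_mono finite_sum_le_infsum ell2_summable) auto
    also have "\<dots> \<le> e\<^sup>2" using F(2)[of F] F(1) by (auto simp: dist_real_def abs_less_iff)
    finally show "(\<Sum>j\<in>G. (cmod (ell2_apply (x - (\<Sum>i\<in>F. ell2_apply x i *\<^sub>C ell2_unit i)) j))\<^sup>2) \<le> e\<^sup>2" .
  qed (use assms in simp)
  with F(1) show thesis by (rule that)
qed

text \<open>\<open>bounded_linear\<close> means real linearity, so complex homogeneity is asked for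
  separately; agreement at basis vectors alone would say nothing about their multiples by
  \<i>.\<close>

lemma bounded_linear_ell2_eqI:
  fixes f g :: "'i ell2 \<Rightarrow> 'b::complex_normed_vector"
  assumes f: "bounded_linear f" "\<And>c x. f (c *\<^sub>C x) = c *\<^sub>C f x"
    and g: "bounded_linear g" "\<And>c x. g (c *\<^sub>C x) = c *\<^sub>C g x"
    and eq: "\<And>i. f (ell2_unit i) = g (ell2_unit i)"
  shows "f x = g x"
proof (rule ccontr)
  assume ne: "f x \<noteq> g x"
  interpret d: bounded_linear "\<lambda>x. f x - g x" by (rule bounded_linear_sub[OF f(1) g(1)])
  obtain K where K: "K > 0" "\<And>x. norm (f x - g x) \<le> norm x * K" using d.pos_bounded by auto
  \<comment> \<open>With this accuracy \<open>f - g\<close> changes by at most half of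
    \<open>norm (f x - g x)\<close>, which contradicts its being nonzero.\<close>
  obtain F where F: "finite F"
    "norm (x - (\<Sum>i\<in>F. ell2_apply x i *\<^sub>C ell2_unit i)) \<le> norm (f x - g x) / (2 * K)"
    using ell2_approx[of "norm (f x - g x) / (2 * K)" x] ne K(1) by auto
  have "f (\<Sum>i\<in>F. ell2_apply x i *\<^sub>C ell2_unit i) - g (\<Sum>i\<in>F. ell2_apply x i *\<^sub>C ell2_unit i) = 0"
    unfolding d.sum by (simp add: f(2) g(2) eq)
  then have "norm (f x - g x) = norm (f (x - (\<Sum>i\<in>F. ell2_apply x i *\<^sub>C ell2_unit i))
      - g (x - (\<Sum>i\<in>F. ell2_apply x i *\<^sub>C ell2_unit i)))"
    unfolding d.diff by simp
  also have "\<dots> \<le> norm (f x - g x) / (2 * K) * K"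
    using K(1) by (intro order_trans[OF K(2)] mult_right_mono F(2)) auto
  also have "\<dots> = norm (f x - g x) / 2" using K(1) by simp
  finally show False using ne by simp
qed

section \<open>Tensor products of vectors and slices\<close>

text \<open>The double sum factors over a rectangle, so the finite index set is first enlarged to
  the product of its projections.\<close>

lemma ell2_tensor_sum_le:
  assumes "finite F"
  shows "(\<Sum>k\<in>F. (cmod (ell2_apply x (fst k) * ell2_apply y (snd k)))\<^sup>2) \<le> (norm x * norm y)\<^sup>2"
proof -
  let ?f = "\<lambda>k. (cmod (ell2_apply x (fst k) * ell2_apply y (snd k)))\<^sup>2"
  have "sum ?f F \<le> sum ?f (fst ` F \<times> snd ` F)"
    using assms by (intro sum_mono2) (auto simp: rev_image_eqI)
  also have "\<dots> = (\<Sum>i\<in>fst ` F. (cmod (ell2_apply x i))\<^sup>2) * (\<Sum>j\<in>snd ` F. (cmod (ell2_apply y j))\<^sup>2)"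
    by (simp add: sum_product sum.cartesian_product norm_mult power_mult_distrib case_prod_beta)
  also have "\<dots> \<le> (norm x)\<^sup>2 * (norm y)\<^sup>2"
    using assms by (intro mult_mono ell2_finite_sum_le) (auto intro: sum_nonneg)
  finally show ?thesis by (simp add: power_mult_distrib)
qed

lemma
  shows ell2_apply_tensor: "ell2_apply (ell2_tensor x y) (i, j) = ell2_apply x i * ell2_apply y j"
    and norm_ell2_tensor_le: "norm (ell2_tensor x y) \<le> norm x * norm y"
  unfolding ell2_tensor_def case_prod_beta
  by (simp_all add: ell2_apply_Abs ell2_boundI[OF ell2_tensor_sum_le])

lemma ell2_tensor_add_left: "ell2_tensor (x + x') y = ell2_tensor x y + ell2_tensor x' y"
  by (rule ell2_eqI) (auto simp: ell2_apply_tensor ell2_apply_add algebra_simps)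

lemma ell2_tensor_add_right: "ell2_tensor x (y + y') = ell2_tensor x y + ell2_tensor x y'"
  by (rule ell2_eqI) (auto simp: ell2_apply_tensor ell2_apply_add algebra_simps)

lemma ell2_tensor_scaleC_left: "ell2_tensor (c *\<^sub>C x) y = c *\<^sub>C ell2_tensor x y"
  by (rule ell2_eqI) (auto simp: ell2_apply_tensor ell2_apply_scaleC algebra_simps)

lemma ell2_tensor_scaleC_right: "ell2_tensor x (c *\<^sub>C y) = c *\<^sub>C ell2_tensor x y"
  by (rule ell2_eqI) (auto simp: ell2_apply_tensor ell2_apply_scaleC algebra_simps)

lemma ell2_unit_Pair: "ell2_unit (i, j) = ell2_tensor (ell2_unit i) (ell2_unit j)"
  by (rule ell2_eqI) (auto simp: ell2_apply_tensor ell2_apply_unit split: if_splits)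

text \<open>The component at i when \<open>\<ell>\<^sup>2(I \<times> J)\<close> is decomposed into
  copies of \<open>\<ell>\<^sup>2(J)\<close>; over I = X it is the fibre at a point.\<close>

definition ell2_slice :: "'i \<Rightarrow> ('i \<times> 'j) ell2 \<Rightarrow> 'j ell2" where
  "ell2_slice i u = Abs_ell2 (\<lambda>j. ell2_apply u (i, j))"

lemma ell2_apply_slice: "ell2_apply (ell2_slice i u) j = ell2_apply u (i, j)"
  for u :: "('i \<times> 'j) ell2"
proof -
  have "(\<lambda>j. (cmod (ell2_apply u (i, j)))\<^sup>2) summable_on UNIV"
  proof (rule ell2_boundI(1)[where b = "norm u"])
    fix F :: "'j set" assume "finite F"
    then show "(\<Sum>j\<in>F. (cmod (ell2_apply u (i, j)))\<^sup>2) \<le> (norm u)\<^sup>2"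
      using ell2_finite_sum_le[of "Pair i ` F" u] by (simp add: sum.reindex inj_on_def)
  qed simp
  then show ?thesis by (simp add: ell2_slice_def ell2_apply_Abs)
qed

lemma ell2_slice_eqI: "(\<And>i. ell2_slice i u = ell2_slice i v) \<Longrightarrow> u = v"
  by (rule ell2_eqI) (metis ell2_apply_slice surj_pair)

lemma ell2_slice_add: "ell2_slice i (u + v) = ell2_slice i u + ell2_slice i v"
  by (rule ell2_eqI) (simp add: ell2_apply_slice ell2_apply_add)

lemma ell2_slice_scaleC: "ell2_slice i (c *\<^sub>C u) = c *\<^sub>C ell2_slice i u"
  by (rule ell2_eqI) (simp add: ell2_apply_slice ell2_apply_scaleC)

lemma ell2_slice_tensor: "ell2_slice i (ell2_tensor x y) = ell2_apply x i *\<^sub>C y"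
  by (rule ell2_eqI) (simp add: ell2_apply_slice ell2_apply_tensor ell2_apply_scaleC)

lemma norm_ell2_power2: "(norm x)\<^sup>2 = (\<Sum>\<^sub>\<infinity>i. (cmod (ell2_apply x i))\<^sup>2)" for x :: "'i ell2"
  by (simp add: norm_ell2_def infsum_nonneg)

lemma sum_norm_ell2_slice_le:
  fixes u :: "('i \<times> 'j) ell2"
  assumes "finite F"
  shows "(\<Sum>i\<in>F. (norm (ell2_slice i u))\<^sup>2) \<le> (norm u)\<^sup>2"
proof -
  let ?f = "\<lambda>i j. (cmod (ell2_apply (ell2_slice i u) j))\<^sup>2"
  have "((\<lambda>j. \<Sum>i\<in>F. ?f i j) has_sum (\<Sum>i\<in>F. (norm (ell2_slice i u))\<^sup>2)) UNIV"
    using assms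
    by (induction F rule: finite_induct)
      (auto intro!: has_sum_add has_sum_infsum ell2_summable simp: norm_ell2_power2)
  then show ?thesis
  proof (rule has_sum_le_finite_sums)
    fix G :: "'j set" assume "finite G"
    then show "(\<Sum>j\<in>G. \<Sum>i\<in>F. ?f i j) \<le> (norm u)\<^sup>2"
      using ell2_finite_sum_le[of "F \<times> G" u] assms
      by (subst sum.swap) (simp add: sum.cartesian_product ell2_apply_slice case_prod_beta)
  qed
qed

lemma norm_ell2_slice_le: "norm (ell2_slice i u) \<le> norm u"
  using sum_norm_ell2_slice_le[of "{i}" u] by simp

lemma bounded_linear_ell2_slice: "bounded_linear (ell2_slice i)"
  by (rule bounded_linear_intro[where K = 1])
    (simp_all add: ell2_slice_add ell2_slice_scaleC scaleR_ell2 norm_ell2_slice_le)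

text \<open>Phrased for a bare function \<open>f\<close> so that it can also establish square
  summability, as the construction of \<open>ell2_amplify\<close> requires.\<close>

lemma ell2_slices_sum_bound:
  fixes f :: "'i \<times> 'j \<Rightarrow> complex" and u :: "('i \<times> 'k) ell2"
  assumes "finite F" and "0 \<le> C"
    and "\<And>i G. finite G \<Longrightarrow> (\<Sum>j\<in>G. (cmod (f (i, j)))\<^sup>2) \<le> (C * norm (ell2_slice i u))\<^sup>2"
  shows "(\<Sum>k\<in>F. (cmod (f k))\<^sup>2) \<le> (C * norm u)\<^sup>2"
proof -
  have "(\<Sum>k\<in>F. (cmod (f k))\<^sup>2) \<le> (\<Sum>k\<in>fst ` F \<times> snd ` F. (cmod (f k))\<^sup>2)"
    using assms(1) by (intro sum_mono2) (auto simp: rev_image_eqI)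
  also have "\<dots> = (\<Sum>i\<in>fst ` F. \<Sum>j\<in>snd ` F. (cmod (f (i, j)))\<^sup>2)"
    by (simp add: sum.cartesian_product)
  also have "\<dots> \<le> (\<Sum>i\<in>fst ` F. (C * norm (ell2_slice i u))\<^sup>2)"
    using assms by (intro sum_mono) auto
  also have "\<dots> = C\<^sup>2 * (\<Sum>i\<in>fst ` F. (norm (ell2_slice i u))\<^sup>2)"
    by (simp add: power_mult_distrib sum_distrib_left)
  also have "\<dots> \<le> C\<^sup>2 * (norm u)\<^sup>2"
    using assms(1) by (intro mult_left_mono sum_norm_ell2_slice_le) auto
  finally show ?thesis by (simp add: power_mult_distrib)
qed

text \<open>Squared norms of slices add up; this is how fibrewise estimates become operator norm
  estimates.\<close>

lemma norm_ell2_le_slices: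
  fixes u :: "('a \<times> 'c) ell2" and v :: "('a \<times> 'b) ell2"
  assumes "0 \<le> C" and "\<And>i. norm (ell2_slice i v) \<le> C * norm (ell2_slice i u)"
  shows "norm v \<le> C * norm u"
proof (rule norm_ell2_le)
  fix F :: "('a \<times> 'b) set" assume "finite F"
  then show "(\<Sum>k\<in>F. (cmod (ell2_apply v k))\<^sup>2) \<le> (C * norm u)\<^sup>2"
  proof (rule ell2_slices_sum_bound[OF _ assms(1)])
    fix i and G :: "'b set" assume "finite G"
    then have "(\<Sum>j\<in>G. (cmod (ell2_apply (ell2_slice i v) j))\<^sup>2) \<le> (norm (ell2_slice i v))\<^sup>2"
      by (rule ell2_finite_sum_le)
    also have "\<dots> \<le> (C * norm (ell2_slice i u))\<^sup>2"
      by (intro power_mono assms(2)) simp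
    finally show "(\<Sum>j\<in>G. (cmod (ell2_apply v (i, j)))\<^sup>2) \<le> (C * norm (ell2_slice i u))\<^sup>2"
      by (simp add: ell2_apply_slice)
  qed
qed (use assms(1) in simp)

lemma bounded_linear_ell2_tensor_right: "bounded_linear (ell2_tensor x)"
  by (rule bounded_linear_intro[where K = "norm x"])
    (simp_all add: ell2_tensor_add_right ell2_tensor_scaleC_right scaleR_ell2 norm_ell2_tensor_le
      mult.commute[of _ "norm x"])

lemma bounded_linear_ell2_tensor_left: "bounded_linear (\<lambda>x. ell2_tensor x y)"
  by (rule bounded_linear_intro[where K = "norm y"])
    (simp_all add: ell2_tensor_add_left ell2_tensor_scaleC_left scaleR_ell2 norm_ell2_tensor_le)

lemma bounded_linear_tensor_eqI:
  fixes f g :: "('i \<times> 'j) ell2 \<Rightarrow> 'b::complex_normed_vector"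
  assumes "bounded_linear f" "\<And>c x. f (c *\<^sub>C x) = c *\<^sub>C f x"
    and "bounded_linear g" "\<And>c x. g (c *\<^sub>C x) = c *\<^sub>C g x"
    and "\<And>x y. f (ell2_tensor x y) = g (ell2_tensor x y)"
  shows "f u = g u"
  by (rule bounded_linear_ell2_eqI[of f g, OF assms(1-4)]) (auto simp: ell2_unit_Pair assms(5))

lemma cinner_unit_right: "cinner x (ell2_unit i) = cnj (ell2_apply x i)"
proof -
  have "cinner x (ell2_unit i) = (\<Sum>\<^sub>\<infinity>j\<in>{i}. cnj (ell2_apply x j))"
    unfolding cinner_def by (rule infsum_cong_neutral) (auto simp: ell2_apply_unit)
  then show ?thesis by simp
qed

lemma cinner_tensor: "cinner (ell2_tensor x y) (ell2_tensor x' y') = cinner x x' * cinner y y'"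
proof -
  have 1: "cinner (ell2_tensor x y) (ell2_tensor x' (ell2_unit j))
      = cinner x x' * cnj (ell2_apply y j)" for j
    by (rule bounded_linear_ell2_eqI[of "\<lambda>x'. cinner (ell2_tensor x y) (ell2_tensor x' (ell2_unit j))"])
      (auto intro!: bounded_linear_compose[OF bounded_linear_cinner_right]
        bounded_linear_compose[OF bounded_linear_mult_left] bounded_linear_cinner_right
            bounded_linear_ell2_tensor_left
        simp: ell2_tensor_scaleC_left cinner_scaleC_right scaleC_complex_def cinner_unit_right
          ell2_apply_tensor simp flip: ell2_unit_Pair)
  show ?thesis
    by (rule bounded_linear_ell2_eqI[of "\<lambda>y'. cinner (ell2_tensor x y) (ell2_tensor x' y')"])
      (auto intro!: bounded_linear_compose[OF bounded_linear_cinner_right]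
        bounded_linear_compose[OF bounded_linear_mult_right] bounded_linear_cinner_right
            bounded_linear_ell2_tensor_right
        simp: ell2_tensor_scaleC_right cinner_scaleC_right scaleC_complex_def cinner_unit_right 1)
qed

lemma norm_ell2_tensor: "norm (ell2_tensor x y) = norm x * norm y"
proof -
  have "complex_of_real ((norm (ell2_tensor x y))\<^sup>2) = of_real ((norm x * norm y)\<^sup>2)"
    by (simp only: cinner_self[symmetric] cinner_tensor power_mult_distrib of_real_mult)
  then have "(norm (ell2_tensor x y))\<^sup>2 = (norm x * norm y)\<^sup>2" by (simp only: of_real_eq_iff)
  then show ?thesis by (simp add: power2_eq_iff_nonneg)
qed

lemma norm_ell2_unit: "norm (ell2_unit i) = 1"
proof -
  have "cinner (ell2_unit i) (ell2_unit i) = 1"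
    by (simp add: cinner_unit_right ell2_apply_unit)
  then have "(norm (ell2_unit i))\<^sup>2 = 1" by (simp only: cinner_self of_real_eq_1_iff)
  then show ?thesis using power2_eq_1_iff[of "norm (ell2_unit i)"] norm_ge_zero[of "ell2_unit i"]
    by linarith
qed

section \<open>Tensor products of operators\<close>

lemma bounded_operatorsI: "(\<And>c x. blinfun_apply T (c *\<^sub>C x) = c *\<^sub>C blinfun_apply T x)
    \<Longrightarrow> T \<in> bounded_operators"
  by (simp add: bounded_operators_def)

lemma bounded_operators_scaleC:
  "T \<in> bounded_operators \<Longrightarrow> blinfun_apply T (c *\<^sub>C x) = c *\<^sub>C blinfun_apply T x"
  by (simp add: bounded_operators_def)

lemma bounded_operators_compose:
  "S \<in> bounded_operators \<Longrightarrow> T \<in> bounded_operators \<Longrightarrow> S o\<^sub>L T \<in> bounded_operators"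
  by (simp add: bounded_operators_def)

lemma bounded_operators_add:
  "S \<in> bounded_operators \<Longrightarrow> T \<in> bounded_operators \<Longrightarrow> S + T \<in> bounded_operators"
  by (simp add: bounded_operators_def blinfun.add_left scaleC_add_right)

lemma bounded_operators_zero: "0 \<in> bounded_operators"
  by (simp add: bounded_operators_def scaleC_0_right)

lemma bounded_operators_sum:
  "(\<And>i. i \<in> F \<Longrightarrow> T i \<in> bounded_operators) \<Longrightarrow> sum T F \<in> bounded_operators"
  by (induction F rule: infinite_finite_induct)
    (simp_all add: bounded_operators_zero bounded_operators_add)

lemma bounded_operators_scaleC_closed:
  "T \<in> bounded_operators \<Longrightarrow> c *\<^sub>C T \<in> bounded_operators"
  by (simp add: bounded_operators_def blinfun_apply_scaleC scaleC_scaleC mult.commute)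

section \<open>Amplification, reindexing and existence of the operator tensor product\<close>

definition ell2_amplify :: "'j op \<Rightarrow> ('i \<times> 'j) op" where
  "ell2_amplify T = Blinfun (\<lambda>u. Abs_ell2 (\<lambda>(i, j). ell2_apply (blinfun_apply T (ell2_slice i u)) j))"

text \<open>This operator is \<open>1 \<otimes> T\<close>, built slice by slice because the
  existence of \<open>op_tensor\<close> is going to be derived from it.\<close>

lemma
  fixes u :: "('i \<times> 'j) ell2"
  shows ell2_slice_amplify: "ell2_slice i (blinfun_apply (ell2_amplify T) u)
      = blinfun_apply T (ell2_slice i u)"
    and norm_ell2_amplify_le: "norm (ell2_amplify T :: ('i \<times> 'j) op) \<le> norm T"
proof -
  define f where "f u = Abs_ell2 (\<lambda>(i, j). ell2_apply (blinfun_apply T (ell2_slice i u)) j)" for u ::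
      "('i \<times> 'j) ell2"
  have "(\<lambda>k. (cmod ((\<lambda>(i, j). ell2_apply (blinfun_apply T (ell2_slice i u)) j) k))\<^sup>2) summable_on UNIV"
    for u :: "('i \<times> 'j) ell2"
  proof (rule ell2_boundI(1)[where b = "norm T * norm u"], rule ell2_slices_sum_bound)
    fix i :: 'i and G :: "'j set" assume "finite G"
    from order_trans[OF ell2_finite_sum_le[OF this] power_mono[OF norm_blinfun norm_ge_zero]]
    show "(\<Sum>j\<in>G. (cmod (case (i, j) of (i, j) \<Rightarrow> ell2_apply (blinfun_apply T (ell2_slice i u)) j))\<^sup>2)
        \<le> (norm T * norm (ell2_slice i u))\<^sup>2"
      by simp
  qed simp_all
  then have f: "ell2_slice i (f u) = blinfun_apply T (ell2_slice i u)" for i u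
    by (intro ell2_eqI) (simp add: f_def ell2_apply_slice ell2_apply_Abs)
  have bound: "norm (f u) \<le> norm T * norm u" for u
    by (rule norm_ell2_le_slices) (simp_all add: f norm_blinfun)
  have "bounded_linear f"
    by (rule bounded_linear_intro[where K = "norm T"])
      (use bound in \<open>auto intro!: ell2_slice_eqI simp: f linear_add[OF bounded_linear.linear[OF
          bounded_linear_ell2_slice]]
        linear_scale[OF bounded_linear.linear[OF
            bounded_linear_ell2_slice]] blinfun.add_right blinfun.scaleR_right mult.commute\<close>)
  then have *: "blinfun_apply (ell2_amplify T) = f"
    by (simp add: ell2_amplify_def f_def[abs_def] bounded_linear_Blinfun_apply)
  show "ell2_slice i (blinfun_apply (ell2_amplify T) u) = blinfun_apply T (ell2_slice i u)"
    by (simp add: * f)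
  show "norm (ell2_amplify T :: ('i \<times> 'j) op) \<le> norm T"
    by (rule norm_blinfun_bound) (simp_all add: * bound)
qed

lemma ell2_amplify_bounded_operators:
  fixes T :: "'j op"
  assumes "T \<in> bounded_operators"
  shows "(ell2_amplify T :: ('i \<times> 'j) op) \<in> bounded_operators"
proof (rule bounded_operatorsI, rule ell2_slice_eqI)
  fix c i and u :: "('i \<times> 'j) ell2"
  show "ell2_slice i (blinfun_apply (ell2_amplify T) (c *\<^sub>C u))
      = ell2_slice i (c *\<^sub>C blinfun_apply (ell2_amplify T) u)"
    by (simp only: ell2_slice_amplify ell2_slice_scaleC bounded_operators_scaleC[OF assms])
qed

lemma ell2_amplify_tensor:
  assumes "T \<in> bounded_operators"
  shows "blinfun_apply (ell2_amplify T) (ell2_tensor x y) = ell2_tensor x (blinfun_apply T y)"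
  by (rule ell2_slice_eqI)
    (simp add: ell2_slice_amplify ell2_slice_tensor bounded_operators_scaleC[OF assms])

text \<open>Injectivity of \<open>p\<close> keeps a coordinate of \<open>u\<close> from being
  counted twice, hence the sum of squares below that of \<open>u\<close>.\<close>

lemma
  assumes "inj p"
  shows ell2_apply_reindex: "ell2_apply (blinfun_apply (ell2_reindex p) u) j = ell2_apply u (p j)"
    and norm_ell2_reindex_le: "norm (ell2_reindex p) \<le> 1"
proof -
  define f where "f u = Abs_ell2 (\<lambda>j. ell2_apply u (p j))" for u
  have *: "(\<Sum>j\<in>F. (cmod (ell2_apply u (p j)))\<^sup>2) \<le> (norm u)\<^sup>2" if "finite F" for F u
    using ell2_finite_sum_le[of "p ` F" u] that
    by (simp add: sum.reindex inj_on_subset[OF assms])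
  have f: "ell2_apply (f u) j = ell2_apply u (p j)" for u j
    unfolding f_def using ell2_boundI(1)[OF *] by (simp add: ell2_apply_Abs)
  have bound: "norm (f u) \<le> norm u" for u
    unfolding f_def by (rule ell2_boundI(2)) (auto intro: *)
  have "bounded_linear f"
    by (rule bounded_linear_intro[where K = 1])
      (use bound in \<open>auto intro!: ell2_eqI simp: f ell2_apply_add ell2_apply_scaleR\<close>)
  then have eq: "blinfun_apply (ell2_reindex p) = f"
    by (simp add: ell2_reindex_def f_def[abs_def] bounded_linear_Blinfun_apply)
  show "ell2_apply (blinfun_apply (ell2_reindex p) u) j = ell2_apply u (p j)"
    by (simp add: eq f)
  show "norm (ell2_reindex p) \<le> 1"
    by (rule norm_blinfun_bound) (simp_all add: eq bound)
qed

lemma ell2_reindex_scaleC: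
  "inj p \<Longrightarrow> blinfun_apply (ell2_reindex p) (c *\<^sub>C u) = c *\<^sub>C blinfun_apply (ell2_reindex p) u"
  by (rule ell2_eqI) (simp add: ell2_apply_reindex ell2_apply_scaleC)

lemma ell2_reindex_swap_tensor:
  "blinfun_apply (ell2_reindex prod.swap) (ell2_tensor x y) = ell2_tensor y x"
  by (rule ell2_eqI) (auto simp: ell2_apply_reindex ell2_apply_tensor)

lemma bounded_operators_eqI:
  assumes "U \<in> bounded_operators" "V \<in> bounded_operators"
    and "\<And>x y. blinfun_apply U (ell2_tensor x y) = blinfun_apply V (ell2_tensor x y)"
  shows "U = V"
proof (rule blinfun_eqI)
  show "blinfun_apply U u = blinfun_apply V u" for u
    by (rule bounded_linear_tensor_eqI[of U V])
      (simp_all add: assms bounded_operators_scaleC blinfun.bounded_linear_right)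
qed

text \<open>The definite description in \<open>op_tensor\<close> needs a witness:
  \<open>S \<otimes> 1\<close> is the amplification of S conjugated by the flip, and composing it
  with \<open>1 \<otimes> T\<close> gives the operator together with its norm bound. Uniqueness
  holds because the elementary tensors include the basis vectors.\<close>

lemma
  fixes S :: "'i op" and T :: "'j op"
  assumes S: "S \<in> bounded_operators" and T: "T \<in> bounded_operators"
  shows op_tensor_bounded_operators: "S \<otimes>\<^sub>o T \<in> bounded_operators"
    and op_tensor_apply: "blinfun_apply (S \<otimes>\<^sub>o T) (ell2_tensor x y)
        = ell2_tensor (blinfun_apply S x) (blinfun_apply T y)"
    and norm_op_tensor_le: "norm (S \<otimes>\<^sub>o T) \<le> norm S * norm T"
proof -
  define W where "W = (ell2_reindex prod.swap o\<^sub>L ell2_amplify S o\<^sub>L ell2_reindex prod.swap)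
      o\<^sub>L ell2_amplify T"
  have W: "W \<in> bounded_operators"
    by (intro bounded_operatorsI)
      (simp add: W_def ell2_reindex_scaleC bounded_operators_scaleC[OF ell2_amplify_bounded_operators]
        S T)
  have W_apply: "blinfun_apply W (ell2_tensor x y)
      = ell2_tensor (blinfun_apply S x) (blinfun_apply T y)" for x y
    by (simp add: W_def ell2_amplify_tensor S T ell2_reindex_swap_tensor)
  have eq: "S \<otimes>\<^sub>o T = W"
    unfolding op_tensor_def using W W_apply
    by (intro the_equality) (auto intro!: bounded_operators_eqI)
  show "S \<otimes>\<^sub>o T \<in> bounded_operators" by (simp add: eq W)
  show "blinfun_apply (S \<otimes>\<^sub>o T) (ell2_tensor x y)
      = ell2_tensor (blinfun_apply S x) (blinfun_apply T y)" by (simp add: eq W_apply)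
  have "norm (ell2_reindex prod.swap o\<^sub>L ell2_amplify S o\<^sub>L ell2_reindex prod.swap :: ('i \<times> 'j) op)
      \<le> (1 * norm S) * 1"
    by (intro order_trans[OF norm_blinfun_compose] mult_mono norm_ell2_reindex_le norm_ell2_amplify_le)
        auto
  then show "norm (S \<otimes>\<^sub>o T) \<le> norm S * norm T"
    unfolding eq W_def
    by (intro order_trans[OF norm_blinfun_compose[of _ "ell2_amplify T"]] mult_mono
        norm_ell2_amplify_le) auto
qed

lemma op_tensor_eqI:
  assumes "S \<in> bounded_operators" "T \<in> bounded_operators" "U \<in> bounded_operators"
    and "\<And>x y. blinfun_apply U (ell2_tensor x y) = ell2_tensor (blinfun_apply S x) (blinfun_apply T y)"
  shows "S \<otimes>\<^sub>o T = U"
  using assms by (intro bounded_operators_eqI) (auto simp: op_tensor_bounded_operators op_tensor_apply)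

lemma op_tensor_scaleC_left:
  "S \<in> bounded_operators \<Longrightarrow> T \<in> bounded_operators \<Longrightarrow> (c *\<^sub>C S) \<otimes>\<^sub>o T = c *\<^sub>C (S \<otimes>\<^sub>o T)"
  by (intro op_tensor_eqI)
    (auto simp: bounded_operators_scaleC_closed op_tensor_bounded_operators op_tensor_apply
      blinfun_apply_scaleC ell2_tensor_scaleC_left)

lemma op_tensor_scaleC_right:
  "S \<in> bounded_operators \<Longrightarrow> T \<in> bounded_operators \<Longrightarrow> S \<otimes>\<^sub>o (c *\<^sub>C T) = c *\<^sub>C (S \<otimes>\<^sub>o T)"
  by (intro op_tensor_eqI)
    (auto simp: bounded_operators_scaleC_closed op_tensor_bounded_operators op_tensor_apply
      blinfun_apply_scaleC ell2_tensor_scaleC_right)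

lemma op_tensor_add_left:
  "S \<in> bounded_operators \<Longrightarrow> S' \<in> bounded_operators \<Longrightarrow> T \<in> bounded_operators \<Longrightarrow>
    (S + S') \<otimes>\<^sub>o T = S \<otimes>\<^sub>o T + S' \<otimes>\<^sub>o T"
  by (intro op_tensor_eqI)
    (auto simp: bounded_operators_add op_tensor_bounded_operators op_tensor_apply
      blinfun.add_left ell2_tensor_add_left)

lemma op_tensor_add_right:
  "S \<in> bounded_operators \<Longrightarrow> T \<in> bounded_operators \<Longrightarrow> T' \<in> bounded_operators \<Longrightarrow>
    S \<otimes>\<^sub>o (T + T') = S \<otimes>\<^sub>o T + S \<otimes>\<^sub>o T'"
  by (intro op_tensor_eqI)
    (auto simp: bounded_operators_add op_tensor_bounded_operators op_tensor_apply
      blinfun.add_left ell2_tensor_add_right)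

lemma op_tensor_compose:
  "S \<in> bounded_operators \<Longrightarrow> S' \<in> bounded_operators \<Longrightarrow> T \<in> bounded_operators \<Longrightarrow> T' \<in> bounded_operators \<Longrightarrow>
    (S o\<^sub>L S') \<otimes>\<^sub>o (T o\<^sub>L T') = (S \<otimes>\<^sub>o T) o\<^sub>L (S' \<otimes>\<^sub>o T')"
  by (intro op_tensor_eqI)
    (auto simp: bounded_operators_compose op_tensor_bounded_operators op_tensor_apply)

lemma bounded_operators_id: "id_blinfun \<in> bounded_operators"
  by (simp add: bounded_operators_def)

lemma op_tensor_id: "id_blinfun \<otimes>\<^sub>o id_blinfun = id_blinfun"
  by (intro op_tensor_eqI) (auto simp: bounded_operators_id)

section \<open>Adjoints and diagonal operators\<close>

lemma is_adjoint_units: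
  assumes A: "A \<in> bounded_operators" and B: "B \<in> bounded_operators"
    and eq: "\<And>i j. cinner (blinfun_apply A (ell2_unit i)) (ell2_unit j)
        = cinner (ell2_unit i) (blinfun_apply B (ell2_unit j))"
  shows "is_adjoint A B"
proof -
  note bl = bounded_linear_compose[OF bounded_linear_cinner_right blinfun.bounded_linear_right]
  \<comment> \<open>Extension from basis vectors works in the linear right argument only. So the
    conjugated relation is extended first, which frees x; flipping it back puts y on the
    right.\<close>
  have 1: "cinner (ell2_unit j) (blinfun_apply A x) = cinner (blinfun_apply B (ell2_unit j)) x" for x j
  proof (rule bounded_linear_ell2_eqI[of "\<lambda>x. cinner (ell2_unit j) (blinfun_apply A x)",
        OF bl _ bounded_linear_cinner_right])
    fix i
    have "cinner (ell2_unit j) (blinfun_apply A (ell2_unit i))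
        = cnj (cinner (ell2_unit i) (blinfun_apply B (ell2_unit j)))"
      unfolding eq[symmetric] by (rule cinner_commute)
    also have "\<dots> = cinner (blinfun_apply B (ell2_unit j)) (ell2_unit i)"
      by (rule cinner_commute[symmetric])
    finally show "cinner (ell2_unit j) (blinfun_apply A (ell2_unit i))
        = cinner (blinfun_apply B (ell2_unit j)) (ell2_unit i)" .
  qed (simp_all add: bounded_operators_scaleC[OF A] cinner_scaleC_right scaleC_complex_def)
  have "cinner (blinfun_apply A x) y = cinner x (blinfun_apply B y)" for x y
  proof (rule bounded_linear_ell2_eqI[of "\<lambda>y. cinner (blinfun_apply A x) y",
        OF bounded_linear_cinner_right _ bl])
    fix j
    have "cinner (blinfun_apply A x) (ell2_unit j) = cnj (cinner (blinfun_apply B (ell2_unit j)) x)"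
      unfolding 1[symmetric] by (rule cinner_commute)
    also have "\<dots> = cinner x (blinfun_apply B (ell2_unit j))"
      by (rule cinner_commute[symmetric])
    finally show "cinner (blinfun_apply A x) (ell2_unit j) = cinner x (blinfun_apply B (ell2_unit j))" .
  qed (simp_all add: bounded_operators_scaleC[OF B] cinner_scaleC_right scaleC_complex_def)
  then show ?thesis by (simp add: is_adjoint_def)
qed

lemma is_adjoint_op_tensor:
  assumes "S \<in> bounded_operators" "S' \<in> bounded_operators" "T \<in> bounded_operators"
      "T' \<in> bounded_operators"
    and "is_adjoint S S'" "is_adjoint T T'"
  shows "is_adjoint (S \<otimes>\<^sub>o T) (S' \<otimes>\<^sub>o T')"
proof (rule is_adjoint_units)
  fix i j :: "'a \<times> 'b"
  obtain a b c d where "i = (a, b)" "j = (c, d)" by (metis surj_pair)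
  then show "cinner (blinfun_apply (S \<otimes>\<^sub>o T) (ell2_unit i)) (ell2_unit j)
      = cinner (ell2_unit i) (blinfun_apply (S' \<otimes>\<^sub>o T') (ell2_unit j))"
    using assms by (simp add: ell2_unit_Pair op_tensor_apply cinner_tensor is_adjoint_def)
qed (use assms in \<open>auto intro: op_tensor_bounded_operators\<close>)

lemma
  assumes "\<And>i. cmod (g i) \<le> K"
  shows ell2_apply_diag_op: "ell2_apply (blinfun_apply (diag_op g) u) i = g i * ell2_apply u i"
    and diag_op_bounded_operators: "diag_op g \<in> bounded_operators"
proof -
  define f where "f u = Abs_ell2 (\<lambda>i. g i * ell2_apply u i)" for u
  have K: "0 \<le> K" using norm_ge_zero[of "g undefined"] assms[of undefined] by linarith
  have *: "(\<Sum>j\<in>F. (cmod (g j * ell2_apply u j))\<^sup>2) \<le> (K * norm u)\<^sup>2" if "finite F" for F u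
  proof -
    have "(\<Sum>j\<in>F. (cmod (g j * ell2_apply u j))\<^sup>2) \<le> (\<Sum>j\<in>F. K\<^sup>2 * (cmod (ell2_apply u j))\<^sup>2)"
      by (intro sum_mono) (simp add: norm_mult power_mult_distrib mult_right_mono power_mono assms)
    also have "\<dots> \<le> K\<^sup>2 * (norm u)\<^sup>2"
      unfolding sum_distrib_left[symmetric] by (intro mult_left_mono ell2_finite_sum_le that) auto
    finally show ?thesis by (simp add: power_mult_distrib)
  qed
  have f: "ell2_apply (f u) j = g j * ell2_apply u j" for u j
    unfolding f_def using ell2_boundI(1)[OF *] K by (simp add: ell2_apply_Abs)
  have bound: "norm (f u) \<le> K * norm u" for u
    unfolding f_def using K by (intro ell2_boundI(2)) (auto intro: *)
  have "bounded_linear f"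
    by (rule bounded_linear_intro[where K = K])
      (use bound in \<open>auto intro!: ell2_eqI simp: f ell2_apply_add ell2_apply_scaleR algebra_simps\<close>)
  then have eq: "blinfun_apply (diag_op g) = f"
    by (simp add: diag_op_def f_def[abs_def] bounded_linear_Blinfun_apply)
  show "ell2_apply (blinfun_apply (diag_op g) u) i = g i * ell2_apply u i"
    by (simp add: eq f)
  show "diag_op g \<in> bounded_operators"
    by (auto intro!: bounded_operatorsI ell2_eqI simp: eq f ell2_apply_scaleC)
qed

text \<open>The operator is block diagonal over the first index. For \<open>mult_op\<close> the
  blocks are the fibres over points of X, and for a function cut off outside Y the same formula
  serves the quotient by \<open>J\<^sub>Y\<close>.\<close>

lemma ell2_slice_diag_op_tensor:
  assumes "\<And>i. cmod (g i) \<le> K" and T: "T \<in> bounded_operators"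
  shows "ell2_slice i (blinfun_apply (diag_op g \<otimes>\<^sub>o T) u) = g i *\<^sub>C blinfun_apply T (ell2_slice i u)"
proof (rule bounded_linear_tensor_eqI[where f = "\<lambda>u. ell2_slice i (blinfun_apply (diag_op g \<otimes>\<^sub>o T) u)"])
  note D = diag_op_bounded_operators[OF assms(1)]
  show "bounded_linear (\<lambda>u. ell2_slice i (blinfun_apply (diag_op g \<otimes>\<^sub>o T) u))"
    by (intro bounded_linear_compose[OF bounded_linear_ell2_slice] blinfun.bounded_linear_right)
  show "bounded_linear (\<lambda>u. g i *\<^sub>C blinfun_apply T (ell2_slice i u))"
    by (intro bounded_linear_compose[OF bounded_linear_scaleC]
        bounded_linear_compose[OF blinfun.bounded_linear_right] bounded_linear_ell2_slice)
  show "ell2_slice i (blinfun_apply (diag_op g \<otimes>\<^sub>o T) (c *\<^sub>C x))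
      = c *\<^sub>C ell2_slice i (blinfun_apply (diag_op g \<otimes>\<^sub>o T) x)" for c x
    by (simp add: bounded_operators_scaleC[OF op_tensor_bounded_operators[OF D T]] ell2_slice_scaleC)
  show "g i *\<^sub>C blinfun_apply T (ell2_slice i (c *\<^sub>C x))
      = c *\<^sub>C g i *\<^sub>C blinfun_apply T (ell2_slice i x)" for c x
    by (simp add: bounded_operators_scaleC[OF T] ell2_slice_scaleC scaleC_scaleC mult.commute)
  show "ell2_slice i (blinfun_apply (diag_op g \<otimes>\<^sub>o T) (ell2_tensor x y))
      = g i *\<^sub>C blinfun_apply T (ell2_slice i (ell2_tensor x y))" for x y
    by (simp add: op_tensor_apply[OF D T] ell2_slice_tensor ell2_apply_diag_op[OF assms(1)]
        bounded_operators_scaleC[OF T] scaleC_scaleC)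
qed

section \<open>Square roots, contractivity of *-homomorphisms and states\<close>

lemma star_minus: "star (- x) = - star (x::'a::cstar_algebra)"
  using linear_neg[OF bounded_linear.linear[OF bounded_linear_star]] .

lemma star_diff: "star (x - y) = star x - star (y::'a::cstar_algebra)"
  using linear_diff[OF bounded_linear.linear[OF bounded_linear_star]] .

lemma star_1: "star 1 = (1::'a::cstar_algebra)"
  by (metis mult.right_neutral star_mult star_star)

lemma star_power: "star (x ^ n) = star (x::'a::cstar_algebra) ^ n"
  by (induction n) (simp_all add: star_1 star_mult power_commutes)

lemma star_scaleR: "star (r *\<^sub>R x) = r *\<^sub>R star (x::'a::cstar_algebra)"
  by (simp add: scaleR_scaleC star_scaleC)

text \<open>The binomial series of the square root of 1 + z converges at
  \<open>z = - (star a * a)\<close> since \<open>norm z < 1\<close>, and real coefficients make its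
  sum self-adjoint. It stands in for functional calculus: what is needed later is only that
  \<open>1 - star a * a\<close> has the form \<open>star y * y\<close>.\<close>

lemma cstar_sqrt_exists:
  fixes a :: "'a::cstar_algebra"
  assumes "norm a < 1"
  obtains y where "star y = y" "y * y = 1 - star a * a"
proof -
  define z where "z = - (star a * a)"
  define c :: "nat \<Rightarrow> real" where "c n = (1/2) gchoose n" for n
  have z: "norm z < 1" "star z = z"
    using assms by (simp_all add: z_def norm_star_mult power_less_one_iff star_minus star_mult star_star)
  \<comment> \<open>A real point strictly between \<open>norm z\<close> and 1: convergence there
    gives absolute convergence at \<open>norm z\<close>.\<close>
  define x where "x = (norm z + 1) / 2"
  have x: "norm z < x" "\<bar>x\<bar> < 1" using z(1) norm_ge_zero[of z] by (simp_all add: x_def abs_less_iff)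
  have "summable (\<lambda>n. c n * x ^ n)"
    using sqrt_series[OF x(2)] by (simp add: c_def sums_iff)
  then have "summable (\<lambda>n. norm (c n * norm z ^ n))"
    by (rule powser_insidea) (use x in auto)
  then have sm: "summable (\<lambda>n. norm (c n *\<^sub>R z ^ n))"
    by (rule summable_comparison_test[rotated])
      (auto intro!: exI[of _ 0] mult_left_mono norm_power_ineq simp: abs_mult)
  define y where "y = (\<Sum>n. c n *\<^sub>R z ^ n)"
  have "star y = (\<Sum>n. star (c n *\<^sub>R z ^ n))"
    unfolding y_def by (rule bounded_linear.suminf[OF bounded_linear_star])
        (rule summable_norm_cancel[OF sm])
  then have "star y = y"
    by (simp add: star_scaleR star_power z(2) y_def)
  moreover have "(\<Sum>i\<le>k. c i *\<^sub>R z ^ i * c (k - i) *\<^sub>R z ^ (k - i)) = (if k = 0 then 1 else 0) + (if k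
      = 1 then z else 0)" for k
  proof -
    have "(\<Sum>i\<le>k. c i *\<^sub>R z ^ i * c (k - i) *\<^sub>R z ^ (k - i)) = (\<Sum>i\<le>k. c i * c (k - i)) *\<^sub>R z ^ k"
      by (simp add: scaleR_sum_left mult.commute flip: power_add)
    \<comment> \<open>Vandermonde with 1/2 + 1/2 = 1: the square of the series has the coefficients
      of the first power of 1 + z, which vanish from degree 2 on.\<close>
    also have "(\<Sum>i\<le>k. c i * c (k - i)) = of_nat 1 gchoose k"
      using gbinomial_Vandermonde[of "1/2 :: real" "1/2" k] by (simp add: c_def atLeast0AtMost)
    also have "\<dots> = of_nat (1 choose k)" by (rule binomial_gbinomial[symmetric])
    finally show ?thesis
      by (cases "k = 0 \<or> k = 1") (auto simp: binomial_eq_0)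
  qed
  then have "(\<lambda>k. (if k = 0 then 1 else 0) + (if k = 1 then z else 0)) sums (y * y)"
    using Cauchy_product_sums[OF sm sm] by (simp add: y_def)
  moreover have "(\<lambda>k. (if k = 0 then 1 else 0) + (if k = 1 then z else 0)) sums (1 + z)"
    by (intro sums_add sums_single)
  ultimately have "y * y = 1 + z" by (metis sums_unique2)
  with \<open>star y = y\<close> show thesis by (intro that[of y]) (simp_all add: z_def)
qed

lemma unital_star_hom_isometry_identity:
  assumes "unital_star_hom \<phi>"
  shows "cinner (blinfun_apply (\<phi> (star a * a)) \<xi>) \<xi> = of_real ((norm (blinfun_apply (\<phi> a) \<xi>))\<^sup>2)"
  using assms by (simp add: unital_star_hom_def is_adjoint_def cinner_self)

text \<open>For a strict contraction b, writing \<open>1 = star b * b + star y * y\<close> and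
  testing on \<xi> exhibits the squared norm of \<xi> as the sum of those of its images under
  \<open>\<phi> b\<close> and \<open>\<phi> y\<close>. A general element is divided by any r above
  its norm, and \<open>dense_ge\<close> passes to the limit.\<close>

lemma norm_unital_star_hom_le:
  fixes \<phi> :: "'a::cstar_algebra \<Rightarrow> 'i op"
  assumes \<phi>: "unital_star_hom \<phi>"
  shows "norm (\<phi> a) \<le> norm a"
proof -
  have add: "\<phi> (b + c) = \<phi> b + \<phi> c" and scale: "\<phi> (r *\<^sub>C b) = r *\<^sub>C \<phi> b"
    and one: "\<phi> 1 = id_blinfun" for b c r
    using \<phi> by (simp_all add: unital_star_hom_def)
  have 1: "norm (\<phi> b) \<le> 1" if b: "norm b < 1" for b
  proof (rule norm_blinfun_bound)
    fix \<xi>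
    obtain y where y: "star y = y" "y * y = 1 - star b * b"
      using cstar_sqrt_exists[OF b] by blast
    have "star b * b + star y * y = 1" by (simp add: y)
    from arg_cong[OF this, of \<phi>]
    have "\<phi> (star b * b) + \<phi> (star y * y) = id_blinfun"
      by (simp only: add one)
    from arg_cong[OF this, of "\<lambda>T. cinner (blinfun_apply T \<xi>) \<xi>"]
    have "cinner \<xi> \<xi> = of_real ((norm (blinfun_apply (\<phi> b) \<xi>))\<^sup>2 + (norm (blinfun_apply (\<phi> y) \<xi>))\<^sup>2)"
      by (simp add: blinfun.add_left cinner_add_left unital_star_hom_isometry_identity[OF \<phi>])
    then have "(norm \<xi>)\<^sup>2 = (norm (blinfun_apply (\<phi> b) \<xi>))\<^sup>2 + (norm (blinfun_apply (\<phi> y) \<xi>))\<^sup>2"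
      unfolding cinner_self of_real_eq_iff .
    then have "(norm (blinfun_apply (\<phi> b) \<xi>))\<^sup>2 \<le> (norm \<xi>)\<^sup>2" by simp
    then show "norm (blinfun_apply (\<phi> b) \<xi>) \<le> 1 * norm \<xi>" by simp
  qed simp
  show ?thesis
  proof (rule dense_ge)
    fix r assume r: "norm a < r"
    then have "0 < r" by (rule le_less_trans[OF norm_ge_zero])
    have "\<phi> a = \<phi> (of_real r *\<^sub>C (of_real (inverse r) *\<^sub>C a))"
      using \<open>0 < r\<close> by (simp add: scaleC_scaleC scaleC_1 flip: of_real_mult)
    then have "norm (\<phi> a) = r * norm (\<phi> (of_real (inverse r) *\<^sub>C a))"
      using \<open>0 < r\<close> by (simp only: scale[of "of_real r"] norm_scaleC norm_of_real abs_of_pos)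
    also have "\<dots> \<le> r * 1"
      using r \<open>0 < r\<close>
        by (intro mult_left_mono 1) (auto simp: norm_scaleC norm_divide norm_inverse field_simps)
    finally show "norm (\<phi> a) \<le> r" by simp
  qed
qed

section \<open>Positivity and contractivity of states\<close>

context
  fixes h :: "'a::cstar_algebra \<Rightarrow> complex"
  assumes h: "state h"
begin

lemma state_add: "h (a + b) = h a + h b"
  using h by (simp add: state_def clinear_on_def)

lemma state_scaleC: "h (c *\<^sub>C a) = c * h a"
  using h by (simp add: state_def clinear_on_def scaleC_complex_def)

lemma state_1: "h 1 = 1"
  using h by (simp add: state_def)

lemma state_diff: "h (a - b) = h a - h b"
  using state_add[of "a - b" b] by simp

lemma state_0: "h 0 = 0"
  using state_add[of 0 0] by simp

lemma state_nonneg: "0 \<le> Re (h (star a * a))" "Im (h (star a * a)) = 0"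
  using h by (simp_all add: state_def complex_nonneg_Reals_iff)

text \<open>Positivity forces h to be real on
  \<open>star (1 + c *\<^sub>C b) * (1 + c *\<^sub>C b)\<close>, so the imaginary part of its cross
  terms vanishes. Taking c = 1 and c = \<i> compares imaginary and real parts.\<close>

lemma state_star: "h (star a) = cnj (h a)"
proof -
  have *: "Im (c * h b) + Im (cnj c * h (star b)) = 0" for b c
  proof -
    have "star (1 + c *\<^sub>C b) * (1 + c *\<^sub>C b)
        = 1 + (c *\<^sub>C b + cnj c *\<^sub>C star b) + star (c *\<^sub>C b) * (c *\<^sub>C b)"
      by (simp add: star_add star_1 star_scaleC algebra_simps)
    then have eq: "h (star (1 + c *\<^sub>C b) * (1 + c *\<^sub>C b))
        = 1 + (c * h b + cnj c * h (star b)) + h (star (c *\<^sub>C b) * (c *\<^sub>C b))"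
      by (simp only: state_add state_scaleC state_1)
    show ?thesis
      using state_nonneg(2)[of "1 + c *\<^sub>C b"] state_nonneg(2)[of "c *\<^sub>C b"]
      by (simp only: eq plus_complex.sel one_complex.sel)
  qed
  from *[of 1 a] *[of \<i> a] show ?thesis by (simp add: complex_eq_iff)
qed

text \<open>The variance of b under h is nonnegative, so the squared modulus of \<open>h b\<close>
  is at most \<open>h (star b * b)\<close>; and that is at most 1 because
  \<open>1 - star b * b\<close> is a square.\<close>

lemma state_norm_le: "cmod (h a) \<le> norm a"
proof -
  have 1: "cmod (h b) \<le> 1" if b: "norm b < 1" for b
  proof -
    obtain y where y: "star y = y" "y * y = 1 - star b * b"
      using cstar_sqrt_exists[OF b] by blast
    have "0 \<le> Re (h (1 - star b * b))" using state_nonneg(1)[of y] by (simp add: y)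
    then have le: "Re (h (star b * b)) \<le> 1" by (simp add: state_diff state_1)
    have "star (b - h b *\<^sub>C 1) * (b - h b *\<^sub>C 1)
        = star b * b - h b *\<^sub>C star b - cnj (h b) *\<^sub>C b + (cnj (h b) * h b) *\<^sub>C 1"
      by (simp add: star_diff star_scaleC star_1 algebra_simps scaleC_mult_left scaleC_mult_right
          scaleC_scaleC scaleC_diff_right)
    then have "h (star (b - h b *\<^sub>C 1) * (b - h b *\<^sub>C 1))
        = h (star b * b) - h b * cnj (h b)"
      by (simp add: state_add state_diff state_scaleC state_star state_1)
    then have "0 \<le> Re (h (star b * b)) - (cmod (h b))\<^sup>2"
      using state_nonneg(1)[of "b - h b *\<^sub>C 1"] by (simp add: cmod_power2 flip: power2_eq_square)
    with le have "(cmod (h b))\<^sup>2 \<le> 1" by simp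
    then show ?thesis by (simp add: power_le_one_iff)
  qed
  show ?thesis
  proof (rule dense_ge)
    fix r assume r: "norm a < r"
    then have "0 < r" by (rule le_less_trans[OF norm_ge_zero])
    have "h a = h (of_real r *\<^sub>C (of_real (inverse r) *\<^sub>C a))"
      using \<open>0 < r\<close> by (simp add: scaleC_scaleC scaleC_1 flip: of_real_mult)
    then have "cmod (h a) = r * cmod (h (of_real (inverse r) *\<^sub>C a))"
      using \<open>0 < r\<close> by (simp only: state_scaleC[of "of_real r"] norm_mult norm_of_real abs_of_pos)
    also have "\<dots> \<le> r * 1"
      using r \<open>0 < r\<close>
        by (intro mult_left_mono 1) (auto simp: norm_scaleC norm_divide norm_inverse field_simps)
    finally show "cmod (h a) \<le> r" by simp
  qed
qed

end

section \<open>Existence of bounded maps on the minimal tensor product\<close>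

text \<open>A list of pairs is a formal element of the algebraic tensor product. No quotient is
  taken, since well-definedness will come out of a norm bound.\<close>

definition tensor_sum :: "('b \<Rightarrow> 'a \<Rightarrow> 'v::monoid_add) \<Rightarrow> ('b \<times> 'a) list \<Rightarrow> 'v" where
  "tensor_sum \<beta> ts = (\<Sum>(b, a)\<leftarrow>ts. \<beta> b a)"

lemma tensor_sum_simps [simp]:
  "tensor_sum \<beta> [] = 0"
  "tensor_sum \<beta> ((b, a) # ts) = \<beta> b a + tensor_sum \<beta> ts"
  "tensor_sum \<beta> (ts @ us) = tensor_sum \<beta> ts + tensor_sum \<beta> us"
  by (simp_all add: tensor_sum_def)

lemma tensor_sum_scale:
  assumes "\<And>c b a. \<beta> (c *\<^sub>C b) a = c *\<^sub>C \<beta> b a"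
  shows "tensor_sum \<beta> (map (\<lambda>(b, a). (c *\<^sub>C b, a)) ts)
      = c *\<^sub>C (tensor_sum \<beta> ts :: 'v::complex_normed_vector)"
  by (induction ts) (auto simp: assms scaleC_0_right scaleC_add_right)

lemma cspan_add_mem:
  assumes "t \<in> cspan S" "x \<in> S"
  shows "t + x \<in> cspan S"
proof -
  obtain F c where F: "finite F" "F \<subseteq> S" "t = (\<Sum>x\<in>F. c x *\<^sub>C x)"
    using assms(1) by (auto simp: cspan_def)
  \<comment> \<open>If x already occurs in F its coefficient grows by 1; otherwise it starts from
    0.\<close>
  define d where "d = c(x := (if x \<in> F then c x else 0) + 1)"
  have "(\<Sum>y\<in>insert x F. d y *\<^sub>C y) = d x *\<^sub>C x + (\<Sum>y\<in>F - {x}. c y *\<^sub>C y)"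
    using F(1) by (simp add: sum.insert_remove d_def)
  also have "\<dots> = t + x"
    using F by (simp add: d_def scaleC_add_left scaleC_1 sum.remove scaleC_0_left add.commute
        add.left_commute)
  finally show ?thesis
    using F assms(2) unfolding cspan_def by (intro CollectI exI[of _ "insert x F"] exI[of _ d]) auto
qed

text \<open>Homogeneity of \<open>\<rho>\<close> lets scalars be absorbed into left factors, so
  lists without coefficients reach the whole span.\<close>

locale rep_pair =
  fixes \<rho> :: "'b::complex_normed_vector \<Rightarrow> 'i op" and \<sigma> :: "'a \<Rightarrow> 'j op"
  assumes left_bounded: "\<rho> b \<in> bounded_operators"
    and left_scaleC: "\<rho> (c *\<^sub>C b) = c *\<^sub>C \<rho> b"
    and right_bounded: "\<sigma> a \<in> bounded_operators"
begin

abbreviation tens :: "('b \<times> 'a) list \<Rightarrow> ('i \<times> 'j) op" where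
  "tens \<equiv> tensor_sum (\<lambda>b a. \<rho> b \<otimes>\<^sub>o \<sigma> a)"

lemma tens_scale: "tens (map (\<lambda>(b, a). (c *\<^sub>C b, a)) ts) = c *\<^sub>C tens ts"
  by (rule tensor_sum_scale) (simp add: left_scaleC op_tensor_scaleC_left left_bounded right_bounded)

lemma cspan_eq_range_tens: "cspan {\<rho> b \<otimes>\<^sub>o \<sigma> a | b a. True} = range tens"
proof
  show "range tens \<subseteq> cspan {\<rho> b \<otimes>\<^sub>o \<sigma> a | b a. True}"
  proof safe
    fix ts show "tens ts \<in> cspan {\<rho> b \<otimes>\<^sub>o \<sigma> a | b a. True}"
    proof (induction ts)
      case Nil
      show ?case unfolding cspan_def by (intro CollectI exI[of _ "{}"]) simp
    next
      case (Cons p ts)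
      then show ?case by (cases p) (auto intro: cspan_add_mem simp: add.commute[of "\<rho> _ \<otimes>\<^sub>o \<sigma> _"])
    qed
  qed
  show "cspan {\<rho> b \<otimes>\<^sub>o \<sigma> a | b a. True} \<subseteq> range tens"
  proof
    fix t assume "t \<in> cspan {\<rho> b \<otimes>\<^sub>o \<sigma> a | b a. True}"
    then obtain F c where F: "finite F" "F \<subseteq> {\<rho> b \<otimes>\<^sub>o \<sigma> a | b a. True}" "t = (\<Sum>x\<in>F. c x *\<^sub>C x)"
      by (auto simp: cspan_def)
    from F(1,2) have "(\<Sum>x\<in>F. c x *\<^sub>C x) \<in> range tens"
    proof (induction F rule: finite_induct)
      case empty
      show ?case by (rule range_eqI[of _ _ "[]"]) simp
    next
      case (insert x F)
      then obtain ts b a where "(\<Sum>x\<in>F. c x *\<^sub>C x) = tens ts" "x = \<rho> b \<otimes>\<^sub>o \<sigma> a" by auto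
      with insert show ?case
        by (intro range_eqI[of _ _ "(c x *\<^sub>C b, a) # ts"])
          (simp add: left_scaleC op_tensor_scaleC_left left_bounded right_bounded)
    qed
    then show "t \<in> range tens" by (simp add: F(3))
  qed
qed

lemma min_tensor_eq: "min_tensor \<rho> \<sigma> = closure (range tens)"
  unfolding min_tensor_def cspan_eq_range_tens ..

lemma closed_min_tensor: "closed (min_tensor \<rho> \<sigma>)"
  by (simp add: min_tensor_def)

lemma tens_in_min_tensor: "tens ts \<in> min_tensor \<rho> \<sigma>"
  unfolding min_tensor_eq by (rule subsetD[OF closure_subset rangeI])

lemma tensor_in_min_tensor: "\<rho> b \<otimes>\<^sub>o \<sigma> a \<in> min_tensor \<rho> \<sigma>"
  using tens_in_min_tensor[of "[(b, a)]"] by simp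

lemma min_tensor_sequence:
  assumes "t \<in> min_tensor \<rho> \<sigma>"
  obtains ts where "(\<lambda>n. tens (ts n)) \<longlonglongrightarrow> t"
proof -
  obtain X where X: "\<forall>n. X n \<in> range tens" "X \<longlonglongrightarrow> t"
    using assms unfolding min_tensor_eq closure_sequential by blast
  then have "\<forall>n. \<exists>us. X n = tens us" by auto
  then obtain ts where "\<forall>n. X n = tens (ts n)" by (rule choice[THEN exE])
  then have "X = (\<lambda>n. tens (ts n))" by auto
  with X(2) show thesis by (intro that[of ts]) simp
qed

lemma min_tensor_limit: "(\<lambda>n. tens (ts n)) \<longlonglongrightarrow> t \<Longrightarrow> t \<in> min_tensor \<rho> \<sigma>"
  by (rule closed_sequentially[OF closed_min_tensor, of "\<lambda>n. tens (ts n)"])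
    (simp_all add: tens_in_min_tensor)

lemma min_tensor_add:
  assumes "s \<in> min_tensor \<rho> \<sigma>" "t \<in> min_tensor \<rho> \<sigma>"
  shows "s + t \<in> min_tensor \<rho> \<sigma>"
proof -
  obtain ss where ss: "(\<lambda>n. tens (ss n)) \<longlonglongrightarrow> s" using assms(1) by (rule min_tensor_sequence)
  obtain ts where ts: "(\<lambda>n. tens (ts n)) \<longlonglongrightarrow> t" using assms(2) by (rule min_tensor_sequence)
  from tendsto_add[OF ss ts] show ?thesis
    by (intro min_tensor_limit[of "\<lambda>n. ss n @ ts n"]) simp
qed

lemma min_tensor_scaleC:
  assumes "t \<in> min_tensor \<rho> \<sigma>"
  shows "c *\<^sub>C t \<in> min_tensor \<rho> \<sigma>"
proof -
  obtain ts where "(\<lambda>n. tens (ts n)) \<longlonglongrightarrow> t" using assms by (rule min_tensor_sequence)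
  from bounded_linear.tendsto[OF bounded_linear_scaleC this] show ?thesis
    by (intro min_tensor_limit[of "\<lambda>n. map (\<lambda>(b, a). (c *\<^sub>C b, a)) (ts n)"]) (simp only: tens_scale)
qed

lemma clinear_on_tens:
  fixes F :: "('i \<times> 'j) op \<Rightarrow> 'v::complex_normed_vector"
  assumes "clinear_on (min_tensor \<rho> \<sigma>) F"
  shows "F (tens ts) = tensor_sum (\<lambda>b a. F (\<rho> b \<otimes>\<^sub>o \<sigma> a)) ts"
proof (induction ts)
  case Nil
  have "F (c *\<^sub>C tens []) = c *\<^sub>C F (tens [])" for c
    using assms tens_in_min_tensor[of "[]"] by (simp add: clinear_on_def)
  from this[of 0] show ?case by (simp add: scaleC_0_left)
next
  case (Cons p ts)
  obtain b a where p: "p = (b, a)" by (cases p)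
  have "F (\<rho> b \<otimes>\<^sub>o \<sigma> a + tens ts) = F (\<rho> b \<otimes>\<^sub>o \<sigma> a) + F (tens ts)"
    using assms tens_in_min_tensor[of ts] tensor_in_min_tensor[of b a] by (simp add: clinear_on_def)
  with Cons show ?case by (simp add: p)
qed

text \<open>Elementary tensors span a dense subspace. Identities between slice maps are checked by
  this rule, which asks for linearity and continuity only on \<open>min_tensor\<close>, because
  \<open>tensor_ext\<close> is set to 0 elsewhere.\<close>

lemma min_tensor_eqI:
  fixes F G :: "('i \<times> 'j) op \<Rightarrow> 'v::complex_normed_vector"
  assumes F: "clinear_on (min_tensor \<rho> \<sigma>) F" "continuous_on (min_tensor \<rho> \<sigma>) F"
    and G: "clinear_on (min_tensor \<rho> \<sigma>) G" "continuous_on (min_tensor \<rho> \<sigma>) G"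
    and eq: "\<And>b a. F (\<rho> b \<otimes>\<^sub>o \<sigma> a) = G (\<rho> b \<otimes>\<^sub>o \<sigma> a)"
    and t: "t \<in> min_tensor \<rho> \<sigma>"
  shows "F t = G t"
proof -
  obtain ts where ts: "(\<lambda>n. tens (ts n)) \<longlonglongrightarrow> t" using t by (rule min_tensor_sequence)
  have "(\<lambda>n. F (tens (ts n))) \<longlonglongrightarrow> F t"
    by (rule continuous_on_tendsto_compose[OF F(2) ts t]) (simp add: tens_in_min_tensor)
  moreover have "(\<lambda>n. G (tens (ts n))) \<longlonglongrightarrow> G t"
    by (rule continuous_on_tendsto_compose[OF G(2) ts t]) (simp add: tens_in_min_tensor)
  ultimately show ?thesis
    by (simp add: clinear_on_tens[OF F(1)] clinear_on_tens[OF G(1)] eq LIMSEQ_unique)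
qed

end

text \<open>The bound on formal sums does two jobs. Applied to a formal difference it shows that the
  value depends only on the operator represented; and it makes the resulting map Lipschitz, hence
  extendable to the closure with values in a Banach space.\<close>

locale bounded_tensor_map = rep_pair \<rho> \<sigma>
  for \<rho> :: "'b::complex_normed_vector \<Rightarrow> 'i op" and \<sigma> :: "'a \<Rightarrow> 'j op" +
  fixes \<beta> :: "'b \<Rightarrow> 'a \<Rightarrow> 'v::{complex_normed_vector, banach}" and C :: real
  assumes form_scaleC: "\<beta> (c *\<^sub>C b) a = c *\<^sub>C \<beta> b a"
    and form_bound: "norm (tensor_sum \<beta> ts) \<le> C * norm (tens ts)"
begin

lemma tensor_ext_props:
  "clinear_on (min_tensor \<rho> \<sigma>) (tensor_ext \<rho> \<sigma> \<beta>) \<and>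
    continuous_on (min_tensor \<rho> \<sigma>) (tensor_ext \<rho> \<sigma> \<beta>) \<and>
    (\<forall>b a. tensor_ext \<rho> \<sigma> \<beta> (\<rho> b \<otimes>\<^sub>o \<sigma> a) = \<beta> b a) \<and>
    (\<forall>t. t \<notin> min_tensor \<rho> \<sigma> \<longrightarrow> tensor_ext \<rho> \<sigma> \<beta> t = 0)"
proof -
  let ?M = "min_tensor \<rho> \<sigma>" and ?B = "tensor_sum \<beta>"
  \<comment> \<open>Formal subtraction: the sign goes into the left factor.\<close>
  let ?neg = "map (\<lambda>(b, a). ((-1) *\<^sub>C b, a))"
  have B_scale: "?B (map (\<lambda>(b, a). (c *\<^sub>C b, a)) ts) = c *\<^sub>C ?B ts" for c ts
    by (rule tensor_sum_scale) (rule form_scaleC)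
  have diff: "norm (?B ts - ?B us) \<le> C * norm (tens ts - tens us)" for ts us
    using form_bound[of "ts @ ?neg us"]
    unfolding tensor_sum_simps B_scale tens_scale by (simp add: scaleC_minus1)
  define f where "f t = ?B (SOME ts. tens ts = t)" for t
  have f: "f (tens ts) = ?B ts" for ts
  proof -
    have "tens (SOME us. tens us = tens ts) = tens ts" by (rule someI) (rule refl)
    then show ?thesis using diff[of "SOME us. tens us = tens ts" ts] by (simp add: f_def)
  qed
  have "\<bar>C\<bar>-lipschitz_on (range tens) f"
  proof (rule lipschitz_onI)
    show "dist (f s) (f t) \<le> \<bar>C\<bar> * dist s t" if "s \<in> range tens" "t \<in> range tens" for s t
      using that by (auto simp: f dist_norm intro: order_trans[OF diff mult_right_mono[OF abs_ge_self
          norm_ge_zero]])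
  qed simp
  then have "uniformly_continuous_on (range tens) f" by (rule lipschitz_on_uniformly_continuous)
  then obtain g where g': "uniformly_continuous_on (closure (range tens)) g"
    "\<And>t. t \<in> range tens \<Longrightarrow> f t = g t"
    by (rule uniformly_continuous_on_extension_on_closure) (rule that)
  have g: "uniformly_continuous_on ?M g" "g (tens ts) = ?B ts" for ts
    using g'(1) g'(2)[of "tens ts"] by (simp_all add: min_tensor_eq f)
  note g_cont = uniformly_continuous_imp_continuous[OF g(1)]
  have g_lim: "(\<lambda>n. ?B (ts n)) \<longlonglongrightarrow> g t" if "(\<lambda>n. tens (ts n)) \<longlonglongrightarrow> t" for ts t
    using continuous_on_tendsto_compose[OF g_cont that min_tensor_limit[OF that]]
    by (simp add: tens_in_min_tensor g(2))
  have g_add: "g (s + t) = g s + g t" if st: "s \<in> ?M" "t \<in> ?M" for s t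
  proof -
    obtain ss where ss: "(\<lambda>n. tens (ss n)) \<longlonglongrightarrow> s" using st(1) by (rule min_tensor_sequence)
    obtain ts where ts: "(\<lambda>n. tens (ts n)) \<longlonglongrightarrow> t" using st(2) by (rule min_tensor_sequence)
    have "(\<lambda>n. ?B (ss n @ ts n)) \<longlonglongrightarrow> g (s + t)"
      using tendsto_add[OF ss ts] by (intro g_lim) simp
    moreover have "(\<lambda>n. ?B (ss n @ ts n)) \<longlonglongrightarrow> g s + g t"
      using tendsto_add[OF g_lim[OF ss] g_lim[OF ts]] by simp
    ultimately show ?thesis by (rule LIMSEQ_unique)
  qed
  have g_scale: "g (c *\<^sub>C t) = c *\<^sub>C g t" if "t \<in> ?M" for c t
  proof -
    obtain ts where ts: "(\<lambda>n. tens (ts n)) \<longlonglongrightarrow> t" using \<open>t \<in> ?M\<close> by (rule min_tensor_sequence)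
    have "(\<lambda>n. ?B (map (\<lambda>(b, a). (c *\<^sub>C b, a)) (ts n))) \<longlonglongrightarrow> g (c *\<^sub>C t)"
      using bounded_linear.tendsto[OF bounded_linear_scaleC ts] by (intro g_lim) (simp only: tens_scale)
    moreover have "(\<lambda>n. ?B (map (\<lambda>(b, a). (c *\<^sub>C b, a)) (ts n))) \<longlonglongrightarrow> c *\<^sub>C g t"
      using bounded_linear.tendsto[OF bounded_linear_scaleC g_lim[OF ts]] by (simp only: B_scale)
    ultimately show ?thesis by (rule LIMSEQ_unique)
  qed
  let ?P = "\<lambda>F. clinear_on ?M F \<and> continuous_on ?M F \<and>
    (\<forall>b a. F (\<rho> b \<otimes>\<^sub>o \<sigma> a) = \<beta> b a) \<and> (\<forall>t. t \<notin> ?M \<longrightarrow> F t = 0)"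
  have "\<exists>!F. ?P F"
  proof (rule ex_ex1I)
    show "\<exists>F. ?P F"
    proof (intro exI conjI allI impI)
      show "clinear_on ?M (\<lambda>t. if t \<in> ?M then g t else 0)"
        by (simp add: clinear_on_def g_add g_scale min_tensor_add min_tensor_scaleC)
      show "continuous_on ?M (\<lambda>t. if t \<in> ?M then g t else 0)"
        using g_cont by (rule continuous_on_eq) simp
      show "(if \<rho> b \<otimes>\<^sub>o \<sigma> a \<in> ?M then g (\<rho> b \<otimes>\<^sub>o \<sigma> a) else 0) = \<beta> b a" for b a
        using g(2)[of "[(b, a)]"] by (simp add: tensor_in_min_tensor)
    qed simp
    show "F = G" if FG: "?P F" "?P G" for F G
    proof (rule ext)
      show "F t = G t" for t
        using FG min_tensor_eqI[of F G t] by (cases "t \<in> ?M") simp_all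
    qed
  qed
  then show ?thesis
    unfolding tensor_ext_def by (rule theI'[of ?P])
qed

lemma
  shows tensor_ext_clinear: "clinear_on (min_tensor \<rho> \<sigma>) (tensor_ext \<rho> \<sigma> \<beta>)"
    and tensor_ext_continuous: "continuous_on (min_tensor \<rho> \<sigma>) (tensor_ext \<rho> \<sigma> \<beta>)"
    and tensor_ext_tensor: "tensor_ext \<rho> \<sigma> \<beta> (\<rho> b \<otimes>\<^sub>o \<sigma> a) = \<beta> b a"
  using tensor_ext_props by auto

end

lemma tensor_sum_hom:
  assumes "\<And>u v. f (u + v) = f u + f v" and "f 0 = 0"
  shows "f (tensor_sum \<beta> ts) = tensor_sum (\<lambda>b a. f (\<beta> b a)) ts"
  by (induction ts) (auto simp: assms)

lemma norm_op_le_cinner: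
  fixes T :: "'i op"
  assumes "0 \<le> K" and "\<And>\<xi> \<eta>. cmod (cinner \<xi> (blinfun_apply T \<eta>)) \<le> K * (norm \<xi> * norm \<eta>)"
  shows "norm T \<le> K"
proof (rule norm_blinfun_bound)
  show "norm (blinfun_apply T \<eta>) \<le> K * norm \<eta>" for \<eta>
  proof (cases "blinfun_apply T \<eta> = 0")
    case False
    have "norm (blinfun_apply T \<eta>) * norm (blinfun_apply T \<eta>) \<le> norm (blinfun_apply T \<eta>) * (K * norm \<eta>)"
      using assms(2)[of "blinfun_apply T \<eta>" \<eta>]
      by (simp add: cinner_self norm_power power2_eq_square algebra_simps norm_mult)
    with False show ?thesis by simp
  qed (use assms(1) in simp)
qed (rule assms(1))

context
  fixes \<phi> :: "'a::cstar_algebra \<Rightarrow> 'i op"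
  assumes \<phi>: "unital_star_hom \<phi>"
begin

lemma
  shows star_hom_bounded: "\<phi> a \<in> bounded_operators"
    and star_hom_add: "\<phi> (a + b) = \<phi> a + \<phi> b"
    and star_hom_scaleC: "\<phi> (c *\<^sub>C a) = c *\<^sub>C \<phi> a"
    and star_hom_mult: "\<phi> (a * b) = \<phi> a o\<^sub>L \<phi> b"
    and star_hom_1: "\<phi> 1 = id_blinfun"
    and star_hom_adjoint: "is_adjoint (\<phi> (star a)) (\<phi> a)"
  using \<phi> by (auto simp: unital_star_hom_def)

lemma bounded_linear_star_hom: "bounded_linear \<phi>"
  by (rule bounded_linear_intro[where K = 1])
    (simp_all add: star_hom_add star_hom_scaleC scaleR_scaleC norm_unital_star_hom_le[OF \<phi>])

lemma star_hom_0: "\<phi> 0 = 0"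
  by (rule linear_0[OF bounded_linear.linear[OF bounded_linear_star_hom]])

lemma star_hom_diff: "\<phi> (a - b) = \<phi> a - \<phi> b"
  by (rule linear_diff[OF bounded_linear.linear[OF bounded_linear_star_hom]])

lemma star_hom_tensor_sum: "\<phi> (tensor_sum \<beta> ts) = tensor_sum (\<lambda>b a. \<phi> (\<beta> b a)) ts"
  by (rule tensor_sum_hom) (simp_all add: star_hom_add star_hom_0)

end

lemma blinfun_tensor_sum: "blinfun_apply (tensor_sum \<beta> ts) u
    = tensor_sum (\<lambda>b a. blinfun_apply (\<beta> b a) u) ts"
  by (induction ts) (auto simp: blinfun.add_left)

lemma bcontfun_tensor_sum:
  "apply_bcontfun (tensor_sum \<beta> ts) x = tensor_sum (\<lambda>b a. apply_bcontfun (\<beta> b a) x) ts"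
  for \<beta> :: "'b \<Rightarrow> 'a \<Rightarrow> ('x::topological_space \<Rightarrow>\<^sub>C complex)"
  by (induction ts) (auto simp: plus_bcontfun.rep_eq)

section \<open>Multiplication operators and the algebra \<open>C(X, A)\<close>\<close>

lemma
  shows ell2_apply_mult_op: "ell2_apply (blinfun_apply (mult_op f) u) x
      = apply_bcontfun f x * ell2_apply u x"
    and mult_op_bounded: "mult_op f \<in> bounded_operators"
  unfolding mult_op_def by (rule ell2_apply_diag_op diag_op_bounded_operators, rule norm_bounded)+

lemma mult_op_unit: "blinfun_apply (mult_op f) (ell2_unit x) = apply_bcontfun f x *\<^sub>C ell2_unit x"
  by (rule ell2_eqI) (simp add: ell2_apply_mult_op ell2_apply_unit ell2_apply_scaleC)

lemma mult_op_scaleC: "mult_op (c *\<^sub>C f) = c *\<^sub>C mult_op f"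
  by (intro blinfun_eqI ell2_eqI)
    (simp add: ell2_apply_mult_op blinfun_apply_scaleC ell2_apply_scaleC apply_scaleC_bcontfun
        scaleC_complex_def)

lemma ell2_slice_mult_op_tensor:
  "T \<in> bounded_operators \<Longrightarrow>
    ell2_slice x (blinfun_apply (mult_op f \<otimes>\<^sub>o T) u) = apply_bcontfun f x *\<^sub>C blinfun_apply T
        (ell2_slice x u)"
  unfolding mult_op_def by (rule ell2_slice_diag_op_tensor[OF norm_bounded])

lemma mult_op_tensor_unit:
  "T \<in> bounded_operators \<Longrightarrow>
    blinfun_apply (mult_op f \<otimes>\<^sub>o T) (ell2_tensor (ell2_unit x) \<xi>)
      = ell2_tensor (ell2_unit x) (apply_bcontfun f x *\<^sub>C blinfun_apply T \<xi>)"
  by (simp add: op_tensor_apply mult_op_bounded mult_op_unit ell2_tensor_scaleC_left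
      ell2_tensor_scaleC_right)

lemma rep_pair_mult_op: "(\<And>a. \<sigma> a \<in> bounded_operators) \<Longrightarrow> rep_pair mult_op \<sigma>"
  by standard (simp_all add: mult_op_bounded mult_op_scaleC)

lemma rep_pair_star_hom: "unital_star_hom \<rho> \<Longrightarrow> unital_star_hom \<sigma> \<Longrightarrow> rep_pair \<rho> \<sigma>"
  by standard (simp_all add: star_hom_bounded star_hom_scaleC)

text \<open>Slicing at x turns the operator into its block there, so a uniform bound on blocks
  bounds the whole. With the reverse estimate that follows, the norm is the supremum over the
  fibres.\<close>

lemma norm_mult_op_tens_le:
  assumes \<tau>: "\<And>a. \<tau> a \<in> bounded_operators" and "0 \<le> K"
    and K: "\<And>x. norm (tensor_sum (\<lambda>f a. apply_bcontfun f x *\<^sub>C \<tau> a) ts) \<le> K"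
  shows "norm (tensor_sum (\<lambda>f a. mult_op f \<otimes>\<^sub>o \<tau> a) ts) \<le> K"
proof (rule norm_blinfun_bound[OF \<open>0 \<le> K\<close>], rule norm_ell2_le_slices[OF \<open>0 \<le> K\<close>])
  fix u x
  have "ell2_slice x (blinfun_apply (tensor_sum (\<lambda>f a. mult_op f \<otimes>\<^sub>o \<tau> a) ts) u)
      = blinfun_apply (tensor_sum (\<lambda>f a. apply_bcontfun f x *\<^sub>C \<tau> a) ts) (ell2_slice x u)"
    unfolding blinfun_tensor_sum
    by (subst tensor_sum_hom[where f = "ell2_slice x"])
      (simp_all add: ell2_slice_add linear_0[OF bounded_linear.linear[OF bounded_linear_ell2_slice]]
        ell2_slice_mult_op_tensor \<tau> blinfun_apply_scaleC)
  then show "norm (ell2_slice x (blinfun_apply (tensor_sum (\<lambda>f a. mult_op f \<otimes>\<^sub>o \<tau> a) ts) u))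
      \<le> K * norm (ell2_slice x u)"
    using order_trans[OF norm_blinfun mult_right_mono[OF K norm_ge_zero]] by simp
qed

text \<open>The vectors \<open>ell2_tensor (ell2_unit x) \<xi>\<close> form an isometric copy of the
  fibre space, on which the operator acts by its block at x.\<close>

lemma norm_tensor_sum_fiber_le:
  assumes \<tau>: "\<And>a. \<tau> a \<in> bounded_operators"
  shows "norm (tensor_sum (\<lambda>f a. apply_bcontfun f x *\<^sub>C \<tau> a) ts)
    \<le> norm (tensor_sum (\<lambda>f a. mult_op f \<otimes>\<^sub>o \<tau> a) ts)"
proof (rule norm_blinfun_bound)
  fix \<xi>
  let ?S = "tensor_sum (\<lambda>f a. apply_bcontfun f x *\<^sub>C \<tau> a) ts"
  let ?T = "tensor_sum (\<lambda>f a. mult_op f \<otimes>\<^sub>o \<tau> a) ts"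
  have "blinfun_apply ?T (ell2_tensor (ell2_unit x) \<xi>) = ell2_tensor (ell2_unit x) (blinfun_apply ?S \<xi>)"
    unfolding blinfun_tensor_sum
    by (subst tensor_sum_hom[where f = "ell2_tensor (ell2_unit x)"])
      (simp_all add: ell2_tensor_add_right linear_0[OF bounded_linear.linear[OF
          bounded_linear_ell2_tensor_right]]
        mult_op_tensor_unit \<tau> blinfun_apply_scaleC)
  then have "norm (blinfun_apply ?S \<xi>) = norm (blinfun_apply ?T (ell2_tensor (ell2_unit x) \<xi>))"
    by (simp add: norm_ell2_tensor norm_ell2_unit)
  also have "\<dots> \<le> norm ?T * norm \<xi>"
    using norm_blinfun[of ?T "ell2_tensor (ell2_unit x) \<xi>"] by (simp add: norm_ell2_tensor norm_ell2_unit)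
  finally show "norm (blinfun_apply ?S \<xi>) \<le> norm ?T * norm \<xi>" .
qed simp

text \<open>The choice of a representative in the coset is harmless: any two differ by a function
  that vanishes on Y.\<close>

lemma quotient_op_quotient_map:
  "quotient_op Y (quotient_map Y g) = diag_op (\<lambda>y. if y \<in> Y then apply_bcontfun g y else 0)"
proof -
  have "g \<in> quotient_map Y g"
    by (simp add: quotient_map_def vanishing_ideal_def)
  then have "(SOME f. f \<in> quotient_map Y g) \<in> quotient_map Y g" by (rule someI)
  then have "apply_bcontfun (SOME f. f \<in> quotient_map Y g) y = apply_bcontfun g y" if "y \<in> Y" for y
    using that by (auto simp: quotient_map_def vanishing_ideal_def minus_bcontfun.rep_eq)
  then have "(\<lambda>y. if y \<in> Y then apply_bcontfun (SOME f. f \<in> quotient_map Y g) y else 0)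
      = (\<lambda>y. if y \<in> Y then apply_bcontfun g y else 0)" by auto
  then show ?thesis by (simp add: quotient_op_def)
qed

lemma norm_quotient_le: "cmod (if y \<in> Y then apply_bcontfun g y else 0) \<le> norm g"
  by (simp add: norm_bounded)

section \<open>Slices and homomorphisms on C(X) \<otimes> A and A \<otimes> A\<close>

context
  fixes \<pi> :: "'a::cstar_algebra \<Rightarrow> 'i op"
  assumes faithful: "faithful_rep \<pi>"
begin

lemma rep_hom: "unital_star_hom \<pi>" and rep_isometric: "norm (\<pi> a) = norm a"
  using faithful by (auto simp: faithful_rep_def)

lemma rep_inject: "\<pi> a = \<pi> b \<longleftrightarrow> a = b"
  using rep_isometric[of "a - b"] by (auto simp: star_hom_diff[OF rep_hom])

lemmas rep_bounded = star_hom_bounded[OF rep_hom]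

lemma rep_pair_mult: "rep_pair mult_op \<pi>"
  by (rule rep_pair_mult_op) (rule rep_bounded)

lemma rep_pair_self: "rep_pair \<pi> \<pi>"
  by (rule rep_pair_star_hom; rule rep_hom)

lemma norm_fiber_le:
  "norm (tensor_sum (\<lambda>f a. apply_bcontfun f x *\<^sub>C a) ts) \<le> norm (tensor_sum (\<lambda>f a. mult_op f \<otimes>\<^sub>o \<pi> a) ts)"
  using norm_tensor_sum_fiber_le[of \<pi> x ts]
  by (simp add: rep_bounded star_hom_tensor_sum[OF rep_hom] star_hom_scaleC[OF rep_hom] flip:
      rep_isometric)

lemma fiber_map: "bounded_tensor_map mult_op \<pi> (\<lambda>f a. apply_bcontfun f x *\<^sub>C a) 1"
proof -
  interpret rep_pair mult_op \<pi> by (rule rep_pair_mult)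
  show ?thesis
    by standard (simp_all add: apply_scaleC_bcontfun scaleC_complex_def scaleC_scaleC norm_fiber_le)
qed

lemma fiber_state_tensor_sum:
  "state h \<Longrightarrow> tensor_sum (\<lambda>f a. apply_bcontfun f x * h a) ts
      = h (tensor_sum (\<lambda>f a. apply_bcontfun f x *\<^sub>C a) ts)"
  by (subst tensor_sum_hom[where f = h]) (simp_all add: state_add state_0 state_scaleC)

lemma fiber_state_map:
  assumes h: "state h"
  shows "bounded_tensor_map mult_op \<pi> (\<lambda>f a. apply_bcontfun f x * h a) 1"
proof -
  interpret rep_pair mult_op \<pi> by (rule rep_pair_mult)
  show ?thesis
    by standard (auto simp: apply_scaleC_bcontfun scaleC_complex_def fiber_state_tensor_sum[OF h]
        intro: order_trans[OF state_norm_le[OF h] norm_fiber_le])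
qed

text \<open>This is \<open>id \<otimes> h\<close>. The norm of its value is a supremum over points,
  and at each point h acts on a single fibre, where it is contractive.\<close>

lemma right_slice_map:
  assumes h: "state h"
  shows "bounded_tensor_map mult_op \<pi> (\<lambda>f a. h a *\<^sub>C f) 1"
proof -
  interpret rep_pair mult_op \<pi> by (rule rep_pair_mult)
  show ?thesis
  proof
    show "norm (tensor_sum (\<lambda>f a. h a *\<^sub>C f) ts) \<le> 1 * norm (tens ts)" for ts
      by (rule norm_bound)
        (auto simp: bcontfun_tensor_sum apply_scaleC_bcontfun scaleC_complex_def mult.commute[of "h _"]
          fiber_state_tensor_sum[OF h] intro: order_trans[OF state_norm_le[OF h] norm_fiber_le])
  qed (simp add: scaleC_scaleC mult.commute)
qed

text \<open>The slice by the vector functional of \<zeta> turns an A-valued function on X into a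
  scalar one, which a measure can integrate. The constant is the norm of that functional.\<close>

lemma vector_slice_map:
  "bounded_tensor_map mult_op \<pi> (\<lambda>f a. cinner \<zeta> (blinfun_apply (\<pi> a) \<zeta>) *\<^sub>C f) (norm \<zeta> * norm \<zeta>)"
proof -
  interpret rep_pair mult_op \<pi> by (rule rep_pair_mult)
  show ?thesis
  proof
    fix ts
    show "norm (tensor_sum (\<lambda>f a. cinner \<zeta> (blinfun_apply (\<pi> a) \<zeta>) *\<^sub>C f) ts)
        \<le> norm \<zeta> * norm \<zeta> * norm (tens ts)"
    proof (rule norm_bound)
      fix x
      let ?S = "tensor_sum (\<lambda>f a. apply_bcontfun f x *\<^sub>C \<pi> a) ts"
      have "apply_bcontfun (tensor_sum (\<lambda>f a. cinner \<zeta> (blinfun_apply (\<pi> a) \<zeta>) *\<^sub>C f) ts) x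
          = cinner \<zeta> (blinfun_apply ?S \<zeta>)"
        unfolding blinfun_tensor_sum bcontfun_tensor_sum
        by (subst tensor_sum_hom[where f = "cinner \<zeta>"])
          (simp_all add: cinner_add_right cinner_0_right apply_scaleC_bcontfun scaleC_complex_def
            blinfun_apply_scaleC cinner_scaleC_right mult.commute)
      also have "cmod \<dots> \<le> norm \<zeta> * (norm ?S * norm \<zeta>)"
        by (rule order_trans[OF norm_cinner_le mult_left_mono[OF norm_blinfun norm_ge_zero]])
      also have "\<dots> \<le> norm \<zeta> * (norm (tens ts) * norm \<zeta>)"
        by (intro mult_left_mono mult_right_mono norm_tensor_sum_fiber_le rep_bounded) simp_all
      finally show "cmod (apply_bcontfun (tensor_sum (\<lambda>f a. cinner \<zeta> (blinfun_apply (\<pi> a) \<zeta>) *\<^sub>C f) ts) x)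
          \<le> norm \<zeta> * norm \<zeta> * norm (tens ts)" by (simp add: algebra_simps)
    qed
  qed (simp add: scaleC_scaleC mult.commute)
qed

text \<open>Blocks over Y are kept and all others become 0, so the norm cannot grow.\<close>

lemma quotient_map_bounded:
  "bounded_tensor_map mult_op \<pi> (\<lambda>g a. quotient_op Y (quotient_map Y g) \<otimes>\<^sub>o \<pi> a) 1"
proof -
  interpret rep_pair mult_op \<pi> by (rule rep_pair_mult)
  let ?Q = "\<lambda>g. diag_op (\<lambda>y. if y \<in> Y then apply_bcontfun g y else 0)"
  note Q = diag_op_bounded_operators[OF norm_quotient_le]
  show ?thesis
    unfolding quotient_op_quotient_map
  proof
    fix c g a
    have "?Q (c *\<^sub>C g) = c *\<^sub>C ?Q g"
      by (intro blinfun_eqI ell2_eqI)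
        (simp add: ell2_apply_diag_op[OF norm_quotient_le] blinfun_apply_scaleC ell2_apply_scaleC
          apply_scaleC_bcontfun scaleC_complex_def)
    then show "?Q (c *\<^sub>C g) \<otimes>\<^sub>o \<pi> a = c *\<^sub>C (?Q g \<otimes>\<^sub>o \<pi> a)"
      by (simp add: op_tensor_scaleC_left Q rep_bounded)
  next
    fix ts
    let ?T = "tensor_sum (\<lambda>g a. ?Q g \<otimes>\<^sub>o \<pi> a) ts"
    show "norm ?T \<le> 1 * norm (tens ts)"
    proof (rule norm_blinfun_bound, simp, rule norm_ell2_le_slices, simp)
      fix u x
      have "ell2_slice x (blinfun_apply ?T u)
          = tensor_sum (\<lambda>g a. (if x \<in> Y then apply_bcontfun g x else 0) *\<^sub>C blinfun_apply (\<pi> a)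
              (ell2_slice x u)) ts"
        unfolding blinfun_tensor_sum
        by (subst tensor_sum_hom[where f = "ell2_slice x"])
          (simp_all add: ell2_slice_add linear_0[OF bounded_linear.linear[OF bounded_linear_ell2_slice]]
            ell2_slice_diag_op_tensor[OF norm_quotient_le] rep_bounded)
      also have "\<dots> = (if x \<in> Y then blinfun_apply (tensor_sum (\<lambda>f a. apply_bcontfun f x *\<^sub>C \<pi> a) ts)
          (ell2_slice x u) else 0)"
        unfolding blinfun_tensor_sum by (induction ts) (auto simp: blinfun_apply_scaleC scaleC_0_left)
      finally have "norm (ell2_slice x (blinfun_apply ?T u))
          \<le> norm (tensor_sum (\<lambda>f a. apply_bcontfun f x *\<^sub>C \<pi> a) ts) * norm (ell2_slice x u)"
        by (simp add: norm_blinfun)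
      also have "\<dots> \<le> norm (tens ts) * norm (ell2_slice x u)"
        by (intro mult_right_mono norm_tensor_sum_fiber_le rep_bounded) simp
      finally show "norm (ell2_slice x (blinfun_apply ?T u)) \<le> 1 * norm (tens ts) * norm (ell2_slice x u)"
        by simp
    qed
  qed
qed

text \<open>The homomorphism acts inside each fibre, where it is contractive.\<close>

lemma right_hom_map:
  assumes \<psi>: "unital_star_hom \<psi>"
  shows "bounded_tensor_map mult_op \<pi> (\<lambda>g a. mult_op g \<otimes>\<^sub>o \<psi> a) 1"
proof -
  interpret rep_pair mult_op \<pi> by (rule rep_pair_mult)
  show ?thesis
  proof
    fix ts
    have "norm (tensor_sum (\<lambda>g a. mult_op g \<otimes>\<^sub>o \<psi> a) ts) \<le> norm (tens ts)"
    proof (rule norm_mult_op_tens_le)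
      fix x
      have "tensor_sum (\<lambda>f a. apply_bcontfun f x *\<^sub>C \<psi> a) ts
          = \<psi> (tensor_sum (\<lambda>f a. apply_bcontfun f x *\<^sub>C a) ts)"
        by (simp add: star_hom_tensor_sum[OF \<psi>] star_hom_scaleC[OF \<psi>])
      then show "norm (tensor_sum (\<lambda>f a. apply_bcontfun f x *\<^sub>C \<psi> a) ts) \<le> norm (tens ts)"
        using order_trans[OF norm_unital_star_hom_le[OF \<psi>] norm_fiber_le] by simp
    qed (simp_all add: star_hom_bounded[OF \<psi>])
    then show "norm (tensor_sum (\<lambda>g a. mult_op g \<otimes>\<^sub>o \<psi> a) ts) \<le> 1 * norm (tens ts)" by simp
  qed (simp add: mult_op_scaleC op_tensor_scaleC_left mult_op_bounded star_hom_bounded[OF \<psi>])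
qed

text \<open>A state slices \<open>A \<otimes> A\<close> contractively, since after pairing the remaining leg with vectors it
  is applied to an element of \<open>A\<close> obtained by a vector slice, and vector slices are contractive.\<close>

lemma
  assumes h: "state h"
  shows left_state_map: "bounded_tensor_map \<pi> \<pi> (\<lambda>b c. h b *\<^sub>C c) 1"
    and right_state_map: "bounded_tensor_map \<pi> \<pi> (\<lambda>b c. h c *\<^sub>C b) 1"
proof -
  interpret rep_pair \<pi> \<pi> by (rule rep_pair_self)
  note hs = star_hom_scaleC[OF rep_hom] star_hom_tensor_sum[OF rep_hom]
  have cs: "cinner \<xi> (blinfun_apply (tensor_sum \<beta> ts) \<eta>)
      = tensor_sum (\<lambda>b a. cinner \<xi> (blinfun_apply (\<beta> b a) \<eta>)) ts"
    for \<beta> :: "'a \<Rightarrow> 'a \<Rightarrow> 'k op" and \<xi> \<eta> ts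
    by (induction ts) (auto simp: blinfun.add_left cinner_add_right cinner_0_right)
  have hsum: "h (tensor_sum \<beta> ts) = tensor_sum (\<lambda>b c. h (\<beta> b c)) ts" for \<beta> ts
    by (rule tensor_sum_hom) (simp_all add: state_add[OF h] state_0[OF h])
  have tc: "cinner (ell2_tensor \<zeta> \<xi>) (blinfun_apply (tens ts) (ell2_tensor \<theta> \<eta>))
      = tensor_sum (\<lambda>b c. cinner \<zeta> (blinfun_apply (\<pi> b) \<theta>) * cinner \<xi> (blinfun_apply
          (\<pi> c) \<eta>)) ts" for \<xi> \<zeta> \<eta> \<theta> ts
    by (simp add: cs op_tensor_apply rep_bounded cinner_tensor)
  have tb: "cmod (cinner (ell2_tensor \<zeta> \<xi>) (blinfun_apply (tens ts) (ell2_tensor \<theta> \<eta>)))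
      \<le> norm (tens ts) * (norm \<zeta> * norm \<theta>) * (norm \<xi> * norm \<eta>)" for \<xi> \<zeta> \<eta> \<theta> ts
  proof -
    have "cmod (cinner (ell2_tensor \<zeta> \<xi>) (blinfun_apply (tens ts) (ell2_tensor \<theta> \<eta>)))
        \<le> norm (ell2_tensor \<zeta> \<xi>) * (norm (tens ts) * norm (ell2_tensor \<theta> \<eta>))"
      by (rule order_trans[OF norm_cinner_le mult_left_mono[OF norm_blinfun norm_ge_zero]])
    then show ?thesis by (simp add: norm_ell2_tensor mult_ac)
  qed
  show "bounded_tensor_map \<pi> \<pi> (\<lambda>b c. h b *\<^sub>C c) 1"
  proof
    fix ts
    have "norm (\<pi> (tensor_sum (\<lambda>b c. h b *\<^sub>C c) ts)) \<le> norm (tens ts)"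
    proof (rule norm_op_le_cinner)
      fix \<xi> \<eta>
      let ?a = "tensor_sum (\<lambda>b c. cinner \<xi> (blinfun_apply (\<pi> c) \<eta>) *\<^sub>C b) ts"
      have "cinner \<xi> (blinfun_apply (\<pi> (tensor_sum (\<lambda>b c. h b *\<^sub>C c) ts)) \<eta>) = h ?a"
        by (simp add: hs cs hsum blinfun_apply_scaleC cinner_scaleC_right state_scaleC[OF h] mult.commute)
      also have "cmod \<dots> \<le> norm (\<pi> ?a)"
        using state_norm_le[OF h] by (simp add: rep_isometric)
      also have "\<dots> \<le> norm (tens ts) * (norm \<xi> * norm \<eta>)"
      proof (rule norm_op_le_cinner)
        fix \<zeta> \<theta>
        have "cinner \<zeta> (blinfun_apply (\<pi> ?a) \<theta>)
            = cinner (ell2_tensor \<zeta> \<xi>) (blinfun_apply (tens ts) (ell2_tensor \<theta> \<eta>))"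
          unfolding tc by (simp add: hs cs blinfun_apply_scaleC cinner_scaleC_right mult.commute)
        then show "cmod (cinner \<zeta> (blinfun_apply (\<pi> ?a) \<theta>))
            \<le> norm (tens ts) * (norm \<xi> * norm \<eta>) * (norm \<zeta> * norm \<theta>)"
          using tb[of \<zeta> \<xi> ts \<theta> \<eta>] by (simp add: mult_ac)
      qed simp
      finally show "cmod (cinner \<xi> (blinfun_apply (\<pi> (tensor_sum (\<lambda>b c. h b *\<^sub>C c) ts)) \<eta>))
          \<le> norm (tens ts) * (norm \<xi> * norm \<eta>)" .
    qed simp
    then show "norm (tensor_sum (\<lambda>b c. h b *\<^sub>C c) ts) \<le> 1 * norm (tens ts)"
      by (simp add: rep_isometric)
  qed (simp add: state_scaleC[OF h] scaleC_scaleC)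
  show "bounded_tensor_map \<pi> \<pi> (\<lambda>b c. h c *\<^sub>C b) 1"
  proof
    fix ts
    have "norm (\<pi> (tensor_sum (\<lambda>b c. h c *\<^sub>C b) ts)) \<le> norm (tens ts)"
    proof (rule norm_op_le_cinner)
      fix \<zeta> \<theta>
      let ?a = "tensor_sum (\<lambda>b c. cinner \<zeta> (blinfun_apply (\<pi> b) \<theta>) *\<^sub>C c) ts"
      have "cinner \<zeta> (blinfun_apply (\<pi> (tensor_sum (\<lambda>b c. h c *\<^sub>C b) ts)) \<theta>) = h ?a"
        by (simp add: hs cs hsum blinfun_apply_scaleC cinner_scaleC_right state_scaleC[OF h] mult.commute)
      also have "cmod \<dots> \<le> norm (\<pi> ?a)"
        using state_norm_le[OF h] by (simp add: rep_isometric)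
      also have "\<dots> \<le> norm (tens ts) * (norm \<zeta> * norm \<theta>)"
      proof (rule norm_op_le_cinner)
        fix \<xi> \<eta>
        have "cinner \<xi> (blinfun_apply (\<pi> ?a) \<eta>)
            = cinner (ell2_tensor \<zeta> \<xi>) (blinfun_apply (tens ts) (ell2_tensor \<theta> \<eta>))"
          unfolding tc by (simp add: hs cs blinfun_apply_scaleC cinner_scaleC_right)
        then show "cmod (cinner \<xi> (blinfun_apply (\<pi> ?a) \<eta>))
            \<le> norm (tens ts) * (norm \<zeta> * norm \<theta>) * (norm \<xi> * norm \<eta>)"
          using tb[of \<zeta> \<xi> ts \<theta> \<eta>] by simp
      qed simp
      finally show "cmod (cinner \<zeta> (blinfun_apply (\<pi> (tensor_sum (\<lambda>b c. h c *\<^sub>C b) ts)) \<theta>))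
          \<le> norm (tens ts) * (norm \<zeta> * norm \<theta>)" .
    qed simp
    then show "norm (tensor_sum (\<lambda>b c. h c *\<^sub>C b) ts) \<le> 1 * norm (tens ts)"
      by (simp add: rep_isometric)
  qed (simp add: scaleC_scaleC mult.commute)
qed

text \<open>Ties the abstract slice at x to the block of the operator t. The algebraic properties of
  \<alpha> reach \<open>action_at\<close> through this formula, as \<open>tensor_ext\<close> itself
  comes only with linearity and continuity.\<close>

lemma fiber_apply:
  assumes "t \<in> min_tensor mult_op \<pi>"
  shows "blinfun_apply t (ell2_tensor (ell2_unit x) \<xi>)
    = ell2_tensor (ell2_unit x) (blinfun_apply (\<pi> (tensor_ext mult_op \<pi>
        (\<lambda>f a. apply_bcontfun f x *\<^sub>C a) t)) \<xi>)"
proof -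
  interpret bounded_tensor_map mult_op \<pi> "\<lambda>f a. apply_bcontfun f x *\<^sub>C a" 1 by (rule fiber_map)
  let ?F = "tensor_ext mult_op \<pi> (\<lambda>f a. apply_bcontfun f x *\<^sub>C a)"
  have bl: "bounded_linear (\<lambda>a. ell2_tensor (ell2_unit x) (blinfun_apply (\<pi> a) \<xi>))"
    by (intro bounded_linear_compose[OF bounded_linear_ell2_tensor_right]
        bounded_linear_compose[OF blinfun.bounded_linear_left] bounded_linear_star_hom rep_hom)
  show ?thesis
  proof (rule min_tensor_eqI[OF _ _ _ _ _ assms])
    show "clinear_on (min_tensor mult_op \<pi>) (\<lambda>t. blinfun_apply t (ell2_tensor (ell2_unit x) \<xi>))"
      by (simp add: clinear_on_def blinfun.add_left blinfun_apply_scaleC)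
    show "continuous_on (min_tensor mult_op \<pi>) (\<lambda>t. blinfun_apply t (ell2_tensor (ell2_unit x) \<xi>))"
      by (intro continuous_intros)
    show "clinear_on (min_tensor mult_op \<pi>) (\<lambda>t. ell2_tensor (ell2_unit x) (blinfun_apply (\<pi> (?F t)) \<xi>))"
      using tensor_ext_clinear
      by (simp add: clinear_on_def star_hom_add[OF rep_hom] star_hom_scaleC[OF rep_hom] blinfun.add_left
          blinfun_apply_scaleC ell2_tensor_add_right ell2_tensor_scaleC_right)
    show "continuous_on (min_tensor mult_op \<pi>) (\<lambda>t. ell2_tensor (ell2_unit x) (blinfun_apply (\<pi> (?F t))
        \<xi>))"
      by (rule bounded_linear.continuous_on[OF bl tensor_ext_continuous])
    show "blinfun_apply (mult_op f \<otimes>\<^sub>o \<pi> a) (ell2_tensor (ell2_unit x) \<xi>)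
        = ell2_tensor (ell2_unit x) (blinfun_apply (\<pi> (?F (mult_op f \<otimes>\<^sub>o \<pi> a))) \<xi>)" for f a
      by (simp add: tensor_ext_tensor mult_op_tensor_unit rep_bounded star_hom_scaleC[OF rep_hom]
          blinfun_apply_scaleC)
  qed
qed

end

section \<open>Partitions of unity and amplification of *-homomorphisms of \<open>C(X)\<close>\<close>

lemma apply_Bcontfun_compact:
  fixes f :: "'x::topological_space \<Rightarrow> 'b::real_normed_vector"
  assumes "compact (UNIV :: 'x set)" and "continuous_on UNIV f"
  shows "apply_bcontfun (Bcontfun f) = f"
proof -
  have "bounded (range f)"
    using compact_imp_bounded[OF compact_continuous_image[OF assms(2,1)]] .
  then obtain b where "\<And>x. norm (f x) \<le> b" by (auto simp: bounded_iff)
  then show ?thesis by (rule apply_Bcontfun[OF assms(2)])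
qed

lemma compact_urysohn_point:
  fixes x :: "'x::t2_space"
  assumes "compact (UNIV :: 'x set)" and "closed Z" and "x \<notin> Z"
  obtains u :: "'x \<Rightarrow> real" where "continuous_on UNIV u" "u x = 1" "\<And>z. z \<in> Z \<Longrightarrow> u z = 0"
proof -
  have "Hausdorff_space (euclidean :: 'x topology)"
    unfolding Hausdorff_space_def disjnt_def using hausdorff[where 'a = 'x] by auto
  then have "normal_space (euclidean :: 'x topology)"
    by (intro compact_Hausdorff_or_regular_imp_normal_space) (simp_all add: compact_space_def assms(1))
  then obtain u where "continuous_map (euclidean :: 'x topology) euclideanreal u" "u ` Z \<subseteq> {0}" "u ` {x}
      \<subseteq> {1}"
    by (rule Urysohn_lemma_alt[of _ Z "{x}" 0 1]) (use assms in auto)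
  then show thesis by (intro that[of u]) auto
qed

lemma bcontfun_sum: "apply_bcontfun (sum f F) y = (\<Sum>i\<in>F. apply_bcontfun (f i) y)"
  for f :: "'i \<Rightarrow> ('x::topological_space \<Rightarrow>\<^sub>C complex)"
  by (induction F rule: infinite_finite_induct) (auto simp: plus_bcontfun.rep_eq)

text \<open>Squares are used because each \<open>s j\<close> will stand on both sides of an
  operator, which makes the resulting sum a compression. The index j is itself the point at which
  values are to be frozen.\<close>

lemma square_partition_of_unity:
  fixes G :: "('x::t2_space \<Rightarrow>\<^sub>C complex) set"
  assumes cpt: "compact (UNIV :: 'x set)" and "finite G" and "0 < \<epsilon>"
  obtains J and s :: "'x \<Rightarrow> ('x \<Rightarrow>\<^sub>C complex)" where
    "finite J" "\<And>j. star (s j) = s j" "(\<Sum>j\<in>J. s j * s j) = 1"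
    "\<And>g j y. g \<in> G \<Longrightarrow> j \<in> J \<Longrightarrow> apply_bcontfun (s j) y \<noteq> 0
      \<Longrightarrow> cmod (apply_bcontfun g y - apply_bcontfun g j) \<le> \<epsilon>"
proof -
  define U where "U x = (\<Inter>g\<in>G. {y. cmod (apply_bcontfun g y - apply_bcontfun g x) < \<epsilon>})" for x
  have U: "open (U x)" "x \<in> U x" for x
    using assms(2,3) unfolding U_def
    by (auto intro!: open_INT open_Collect_less continuous_intros)
  have "\<exists>u :: 'x \<Rightarrow> real. continuous_on UNIV u \<and> u x = 1 \<and> (\<forall>z. z \<notin> U x \<longrightarrow> u z = 0)" for x
    using compact_urysohn_point[OF cpt, of "- U x" x] U[of x] by (metis ComplD ComplI closed_Compl)
  then obtain u :: "'x \<Rightarrow> 'x \<Rightarrow> real" where u: "\<And>x. continuous_on UNIV (u x)" "\<And>x. u x x = 1"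
    "\<And>x z. z \<notin> U x \<Longrightarrow> u x z = 0" by metis
  have "open {y. u x y \<noteq> 0}" for x
    by (intro open_Collect_neq u(1) continuous_intros)
  moreover have "UNIV \<subseteq> (\<Union>x. {y. u x y \<noteq> 0})" using u(2) by (auto intro: exI zero_neq_one)
  ultimately obtain J where J: "finite J" "UNIV \<subseteq> (\<Union>x\<in>J. {y. u x y \<noteq> 0})"
    using compactE_image[OF cpt, of UNIV "\<lambda>x. {y. u x y \<noteq> 0}"] by (metis (no_types, lifting) subset_UNIV)
  \<comment> \<open>Positive because the sets where some \<open>u j\<close> is nonzero cover X;
    dividing by its root normalises the sum of squares to 1.\<close>
  define D where "D y = (\<Sum>j\<in>J. (u j y)\<^sup>2)" for y
  have D: "0 < D y" for y
  proof -
    obtain j where "j \<in> J" "u j y \<noteq> 0" using J(2) by auto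
    then show ?thesis unfolding D_def using J(1) by (intro sum_pos2[of _ j]) auto
  qed
  define s where "s j = Bcontfun (\<lambda>y. complex_of_real (u j y / sqrt (D y)))" for j
  have s: "apply_bcontfun (s j) y = complex_of_real (u j y / sqrt (D y))" for j y
  proof -
    have "continuous_on UNIV (\<lambda>y. complex_of_real (u j y / sqrt (D y)))"
      using D unfolding D_def
        by (intro continuous_intros u(1)) (metis less_irrefl real_sqrt_eq_zero_cancel_iff)
    then show ?thesis unfolding s_def by (simp add: apply_Bcontfun_compact[OF cpt])
  qed
  show thesis
  proof (rule that[of J s])
    show "star (s j) = s j" for j
      by (rule bcontfun_eqI) (simp add: apply_star_bcontfun star_complex_def s)
    show "(\<Sum>j\<in>J. s j * s j) = 1"
    proof (rule bcontfun_eqI)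
      fix y
      have "(\<Sum>j\<in>J. (u j y / sqrt (D y)) * (u j y / sqrt (D y))) = (\<Sum>j\<in>J. (u j y)\<^sup>2) / D y"
        using D[of y] by (simp add: sum_divide_distrib power2_eq_square)
      also have "\<dots> = 1" using D[of y] by (simp add: D_def)
      finally have "(\<Sum>j\<in>J. (u j y / sqrt (D y)) * (u j y / sqrt (D y))) = 1" .
      from arg_cong[OF this, of complex_of_real]
      show "apply_bcontfun (\<Sum>j\<in>J. s j * s j) y = apply_bcontfun 1 y"
        by (simp only: bcontfun_sum apply_times_bcontfun apply_one_bcontfun s of_real_sum of_real_mult
            of_real_1)
    qed
    show "cmod (apply_bcontfun g y - apply_bcontfun g j) \<le> \<epsilon>"
      if "g \<in> G" "j \<in> J" "apply_bcontfun (s j) y \<noteq> 0" for g j y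
    proof -
      have "y \<in> U j" using that(3) u(3)[of y j] by (auto simp: s)
      then show ?thesis using that(1) by (auto simp: U_def intro: less_imp_le)
    qed
  qed (rule J(1))
qed

lemma op_tensor_sum_left:
  "(\<And>j. S j \<in> bounded_operators) \<Longrightarrow> T \<in> bounded_operators \<Longrightarrow> (\<Sum>j\<in>J. S j) \<otimes>\<^sub>o T = (\<Sum>j\<in>J. S j \<otimes>\<^sub>o T)"
proof (induction J rule: infinite_finite_induct)
  case empty
  then have "(0 *\<^sub>C 0) \<otimes>\<^sub>o T = 0 *\<^sub>C (0 \<otimes>\<^sub>o T)"
    by (intro op_tensor_scaleC_left bounded_operators_zero)
  then show ?case by (simp add: scaleC_0_left)
qed (simp_all add: op_tensor_add_left bounded_operators_sum scaleC_0_left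
    op_tensor_scaleC_left[of 0 T 0, simplified scaleC_0_left] bounded_operators_zero)

lemma blinfun_compose_id: "T o\<^sub>L id_blinfun = T" "id_blinfun o\<^sub>L T = T"
  by (rule blinfun_eqI, simp)+

text \<open>By \<open>sum_1\<close> the operators \<open>Q j\<close> together form an isometry into
  the direct sum of copies of the space indexed by J, and the sum is the compression of the diagonal
  operator with entries \<open>C j\<close>. Concretely this is the Cauchy-Schwarz inequality over
  J.\<close>

lemma norm_compression_sum_le:
  fixes Q C :: "'j \<Rightarrow> 'i op"
  assumes "finite J" and adj: "\<And>j. is_adjoint (Q j) (Q j)"
    and sum_1: "(\<Sum>j\<in>J. Q j o\<^sub>L Q j) = id_blinfun"
    and "0 \<le> N" and N: "\<And>j. norm (C j) \<le> N"
  shows "norm (\<Sum>j\<in>J. Q j o\<^sub>L C j o\<^sub>L Q j) \<le> N"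
proof (rule norm_op_le_cinner[OF \<open>0 \<le> N\<close>])
  fix u v
  have blinfun_sum: "blinfun_apply (\<Sum>j\<in>J. T j) w
      = (\<Sum>j\<in>J. blinfun_apply (T j) w)" for T :: "'j \<Rightarrow> 'i op" and w
    by (rule blinfun.sum_left)
  have adj': "cinner x (blinfun_apply (Q j) y) = cinner (blinfun_apply (Q j) x) y" for j x y
    using adj[of j] by (simp add: is_adjoint_def)
  have L2: "L2_set (\<lambda>j. norm (blinfun_apply (Q j) w)) J = norm w" for w
  proof -
    have "cinner w (blinfun_apply (\<Sum>j\<in>J. Q j o\<^sub>L Q j) w)
        = (\<Sum>j\<in>J. cinner (blinfun_apply (Q j) w) (blinfun_apply (Q j) w))"
      by (simp add: blinfun_sum cinner_sum_right adj')
    also have "\<dots> = complex_of_real (\<Sum>j\<in>J. (norm (blinfun_apply (Q j) w))\<^sup>2)"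
      by (simp only: cinner_self of_real_sum)
    finally have "complex_of_real (\<Sum>j\<in>J. (norm (blinfun_apply (Q j) w))\<^sup>2)
        = cinner w (blinfun_apply (\<Sum>j\<in>J. Q j o\<^sub>L Q j) w)" by (rule sym)
    then have "(\<Sum>j\<in>J. (norm (blinfun_apply (Q j) w))\<^sup>2) = (norm w)\<^sup>2"
      unfolding sum_1 by (simp only: id_blinfun.rep_eq id_apply cinner_self of_real_eq_iff)
    then show ?thesis by (simp add: L2_set_def)
  qed
  have "cinner u (blinfun_apply (\<Sum>j\<in>J. Q j o\<^sub>L C j o\<^sub>L Q j) v)
      = (\<Sum>j\<in>J. cinner (blinfun_apply (Q j) u) (blinfun_apply (C j) (blinfun_apply (Q j) v)))"
    by (simp add: blinfun_sum cinner_sum_right adj')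
  also have "cmod \<dots> \<le> (\<Sum>j\<in>J. norm (blinfun_apply (Q j) u) * (N * norm (blinfun_apply (Q j) v)))"
    by (intro order_trans[OF norm_sum] sum_mono order_trans[OF norm_cinner_le] mult_left_mono
        order_trans[OF norm_blinfun] mult_right_mono N) simp_all
  also have "\<dots> = N * (\<Sum>j\<in>J. \<bar>norm (blinfun_apply (Q j) u)\<bar> * \<bar>norm (blinfun_apply (Q j) v)\<bar>)"
    by (simp add: sum_distrib_left mult_ac)
  also have "\<dots> \<le> N * (norm u * norm v)"
    using L2_set_mult_ineq[of "\<lambda>j. norm (blinfun_apply (Q j) u)" "\<lambda>j. norm (blinfun_apply (Q j) v)" J]
    by (intro mult_left_mono \<open>0 \<le> N\<close>) (simp add: L2)
  finally show "cmod (cinner u (blinfun_apply (\<Sum>j\<in>J. Q j o\<^sub>L C j o\<^sub>L Q j) v)) \<le> N * (norm u * norm v)" .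
qed

text \<open>The \<open>j\<close>-th summand of a partition of unity \<open>\<Sum> s\<^sub>j\<^sup>2 = 1\<close> is concentrated where the element
  of \<open>C(X, A)\<close> is nearly equal to its value at \<open>j\<close>; so, up to \<open>\<epsilon>\<close>, the amplification of \<open>\<phi>\<close> takes it to
  \<open>\<Sum> (\<phi> s\<^sub>j \<otimes> 1) (1 \<otimes> c\<^sub>j) (\<phi> s\<^sub>j \<otimes> 1)\<close> with \<open>c\<^sub>j\<close> the value at \<open>j\<close>.\<close>

lemma norm_amplified_hom_le:
  fixes \<phi> :: "('x::t2_space \<Rightarrow>\<^sub>C complex) \<Rightarrow> 'k op" and \<pi> :: "'a::cstar_algebra \<Rightarrow> 'i op"
  assumes cpt: "compact (UNIV :: 'x set)" and faithful: "faithful_rep \<pi>" and \<phi>: "unital_star_hom \<phi>"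
  shows "norm (tensor_sum (\<lambda>g a. \<phi> g \<otimes>\<^sub>o \<pi> a) ts) \<le> norm (tensor_sum (\<lambda>g a. mult_op g \<otimes>\<^sub>o \<pi> a) ts)"
    (is "norm ?L \<le> ?N")
proof -
  note \<pi> = rep_hom[OF faithful]
  \<comment> \<open>Changing every left factor by at most \<epsilon> costs \<epsilon> times the
    norms of the right factors, hence \<open>\<epsilon> * K\<close> in all.\<close>
  define K where "K = sum_list (map (\<lambda>(g, a). norm a) ts)"
  have K: "0 \<le> K" unfolding K_def by (intro sum_list_nonneg) auto
  have bound: "norm ?L \<le> ?N + \<epsilon> * K" if \<epsilon>: "0 < \<epsilon>" for \<epsilon>
  proof -
    obtain J and s :: "'x \<Rightarrow> ('x \<Rightarrow>\<^sub>C complex)" where J: "finite J" and s_star: "\<And>j. star (s j) = s j"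
      and s_sum: "(\<Sum>j\<in>J. s j * s j) = 1"
      and s_close: "\<And>g j y. g \<in> fst ` set ts \<Longrightarrow> j \<in> J \<Longrightarrow> apply_bcontfun (s j) y \<noteq> 0
        \<Longrightarrow> cmod (apply_bcontfun g y - apply_bcontfun g j) \<le> \<epsilon>"
      by (rule square_partition_of_unity[OF cpt _ \<epsilon>, of "fst ` set ts"]) (simp, rule that)
    define g' where "g' g = (\<Sum>j\<in>J. apply_bcontfun g j *\<^sub>C (s j * s j))" for g :: "'x \<Rightarrow>\<^sub>C complex"
    have s_cnj: "cnj (apply_bcontfun (s j) y) = apply_bcontfun (s j) y" for j y
      using arg_cong[OF s_star[of j], of "\<lambda>f. apply_bcontfun f y"]
      by (simp add: apply_star_bcontfun star_complex_def)
    have s_sum_at: "(\<Sum>j\<in>J. (cmod (apply_bcontfun (s j) y))\<^sup>2) = 1" for y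
    proof -
      have "complex_of_real (\<Sum>j\<in>J. (cmod (apply_bcontfun (s j) y))\<^sup>2)
          = apply_bcontfun (\<Sum>j\<in>J. s j * s j) y"
        by (simp add: bcontfun_sum apply_times_bcontfun complex_norm_square s_cnj del: of_real_power)
      also have "\<dots> = of_real 1" by (simp add: s_sum apply_one_bcontfun)
      finally show ?thesis by (simp only: of_real_eq_iff)
    qed
    have close: "norm (g - g' g) \<le> \<epsilon>" if g: "g \<in> fst ` set ts" for g
    proof (rule norm_bound)
      fix y
      have "apply_bcontfun g y = (\<Sum>j\<in>J. apply_bcontfun g y * apply_bcontfun (s j * s j) y)"
        using s_sum by (simp add: apply_one_bcontfun flip: sum_distrib_left bcontfun_sum)
      then have "apply_bcontfun (g - g' g) y
          = (\<Sum>j\<in>J. (apply_bcontfun g y - apply_bcontfun g j) * apply_bcontfun (s j * s j) y)"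
        by (simp add: minus_bcontfun.rep_eq g'_def bcontfun_sum apply_scaleC_bcontfun scaleC_complex_def
            left_diff_distrib sum_subtractf)
      also have "cmod \<dots> \<le> (\<Sum>j\<in>J. \<epsilon> * (cmod (apply_bcontfun (s j) y))\<^sup>2)"
      proof (intro order_trans[OF norm_sum] sum_mono)
        fix j assume "j \<in> J"
        then show "cmod ((apply_bcontfun g y - apply_bcontfun g j) * apply_bcontfun (s j * s j) y)
            \<le> \<epsilon> * (cmod (apply_bcontfun (s j) y))\<^sup>2"
          using s_close[OF g, of j y]
          by (cases "apply_bcontfun (s j) y = 0")
            (simp_all add: apply_times_bcontfun norm_mult power2_eq_square mult_right_mono)
      qed
      also have "\<dots> = \<epsilon>" by (simp add: s_sum_at flip: sum_distrib_left)
      finally show "cmod (apply_bcontfun (g - g' g) y) \<le> \<epsilon>" .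
    qed
    define Q where "Q j = \<phi> (s j) \<otimes>\<^sub>o (id_blinfun :: 'i op)" for j
    define C where "C us j = (id_blinfun :: 'k op) \<otimes>\<^sub>o \<pi> (tensor_sum (\<lambda>g a. apply_bcontfun g j *\<^sub>C a) us)"
      for us :: "(('x \<Rightarrow>\<^sub>C complex) \<times> 'a) list" and j
    note bo = star_hom_bounded[OF \<phi>] star_hom_bounded[OF \<pi>] bounded_operators_id
    have \<phi>_sum: "\<phi> (\<Sum>j\<in>J. f j) = (\<Sum>j\<in>J. \<phi> (f j))" for f :: "'x \<Rightarrow> ('x \<Rightarrow>\<^sub>C complex)"
      by (rule linear_sum[OF bounded_linear.linear[OF bounded_linear_star_hom[OF \<phi>]]])
    have summand: "\<phi> (g' g) \<otimes>\<^sub>o \<pi> a = (\<Sum>j\<in>J. Q j o\<^sub>L (id_blinfun \<otimes>\<^sub>o \<pi> (apply_bcontfun g j *\<^sub>C a)) o\<^sub>L Q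
        j)" for g a
    proof -
      have "\<phi> (apply_bcontfun g j *\<^sub>C (s j * s j)) \<otimes>\<^sub>o \<pi> a
          = Q j o\<^sub>L (id_blinfun \<otimes>\<^sub>o \<pi> (apply_bcontfun g j *\<^sub>C a)) o\<^sub>L Q j" for j
      proof -
        have "Q j o\<^sub>L (id_blinfun \<otimes>\<^sub>o \<pi> (apply_bcontfun g j *\<^sub>C a)) o\<^sub>L Q j
            = (\<phi> (s j) o\<^sub>L \<phi> (s j)) \<otimes>\<^sub>o \<pi> (apply_bcontfun g j *\<^sub>C a)"
          by (simp add: Q_def bo bounded_operators_compose blinfun_compose_id flip: op_tensor_compose)
        also have "\<dots> = apply_bcontfun g j *\<^sub>C ((\<phi> (s j) o\<^sub>L \<phi> (s j)) \<otimes>\<^sub>o \<pi> a)"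
          by (simp add: star_hom_scaleC[OF \<pi>] op_tensor_scaleC_right bo bounded_operators_compose)
        also have "\<dots> = \<phi> (apply_bcontfun g j *\<^sub>C (s j * s j)) \<otimes>\<^sub>o \<pi> a"
          by (simp add: star_hom_scaleC[OF \<phi>] star_hom_mult[OF \<phi>] op_tensor_scaleC_left bo
              bounded_operators_compose)
        finally show ?thesis by simp
      qed
      then show ?thesis
        unfolding g'_def \<phi>_sum by (simp add: op_tensor_sum_left bo)
    qed
    have approx: "tensor_sum (\<lambda>g a. \<phi> (g' g) \<otimes>\<^sub>o \<pi> a) us = (\<Sum>j\<in>J. Q j o\<^sub>L C us j o\<^sub>L Q j)" for us
    proof (induction us)
      case Nil
      have "(id_blinfun :: 'k op) \<otimes>\<^sub>o (0 *\<^sub>C 0 :: 'i op) = 0 *\<^sub>C (id_blinfun \<otimes>\<^sub>o 0)"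
        by (intro op_tensor_scaleC_right bounded_operators_zero bounded_operators_id)
      then show ?case by (simp add: C_def star_hom_0[OF \<pi>] scaleC_0_left)
    next
      case (Cons p us)
      obtain g a where p: "p = (g, a)" by (cases p)
      have "C (p # us) j = (id_blinfun \<otimes>\<^sub>o \<pi> (apply_bcontfun g j *\<^sub>C a)) + C us j" for j
        by (simp add: C_def p star_hom_add[OF \<pi>] op_tensor_add_right bo)
      then show ?case
        unfolding p tensor_sum_simps Cons.IH
        by (simp add: summand sum.distrib 
            bounded_bilinear.add_left[OF bounded_bilinear_blinfun_compose]
            bounded_bilinear.add_right[OF bounded_bilinear_blinfun_compose])
    qed
    have main: "norm (\<Sum>j\<in>J. Q j o\<^sub>L C ts j o\<^sub>L Q j) \<le> ?N"
    proof (rule norm_compression_sum_le[OF J])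
      show "is_adjoint (Q j) (Q j)" for j
        unfolding Q_def using star_hom_adjoint[OF \<phi>, of "s j"]
        by (intro is_adjoint_op_tensor bo) (auto simp: s_star is_adjoint_def)
      have "(\<Sum>j\<in>J. Q j o\<^sub>L Q j) = (\<Sum>j\<in>J. \<phi> (s j * s j) \<otimes>\<^sub>o id_blinfun)"
        by (simp add: Q_def star_hom_mult[OF \<phi>] bo blinfun_compose_id flip: op_tensor_compose)
      also have "\<dots> = \<phi> (\<Sum>j\<in>J. s j * s j) \<otimes>\<^sub>o id_blinfun"
        unfolding \<phi>_sum by (simp add: op_tensor_sum_left bo)
      finally show "(\<Sum>j\<in>J. Q j o\<^sub>L Q j) = id_blinfun"
        by (simp add: s_sum star_hom_1[OF \<phi>] op_tensor_id)
      \<comment> \<open>\<open>C ts j\<close> amplifies a single fibre, and fibre norms are at most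
        \<open>?N\<close>.\<close>
      show "norm (C ts j) \<le> ?N" for j
      proof -
        let ?c = "tensor_sum (\<lambda>g a. apply_bcontfun g j *\<^sub>C a) ts"
        have "norm (C ts j) \<le> norm (id_blinfun :: 'k op) * norm (\<pi> ?c)"
          unfolding C_def by (intro norm_op_tensor_le bo)
        also have "\<dots> \<le> 1 * norm ?c"
          by (intro mult_mono) (auto simp: rep_isometric[OF faithful] norm_blinfun_bound)
        also have "\<dots> \<le> ?N" using norm_fiber_le[OF faithful] by simp
        finally show ?thesis .
      qed
    qed simp
    have "norm (tensor_sum (\<lambda>g a. \<phi> g \<otimes>\<^sub>o \<pi> a) us - tensor_sum (\<lambda>g a. \<phi> (g' g) \<otimes>\<^sub>o \<pi> a) us)
        \<le> \<epsilon> * sum_list (map (\<lambda>(g, a). norm a) us)" if "set us \<subseteq> set ts" for us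
      using that
    proof (induction us)
      case (Cons p us)
      obtain g a where p: "p = (g, a)" by (cases p)
      have le: "norm (\<phi> (g - g' g)) * norm (\<pi> a) \<le> \<epsilon> * norm a"
      proof (intro mult_mono)
        have "g \<in> fst ` set ts" using Cons.prems by (force simp: p)
        then show "norm (\<phi> (g - g' g)) \<le> \<epsilon>"
          using close norm_unital_star_hom_le[OF \<phi>] order_trans by blast
      qed (use \<epsilon> in \<open>simp_all add: rep_isometric[OF faithful]\<close>)
      have "\<phi> g \<otimes>\<^sub>o \<pi> a = \<phi> (g - g' g) \<otimes>\<^sub>o \<pi> a + \<phi> (g' g) \<otimes>\<^sub>o \<pi> a"
        by (simp add: bo flip: op_tensor_add_left star_hom_add[OF \<phi>])
      then have "norm (tensor_sum (\<lambda>g a. \<phi> g \<otimes>\<^sub>o \<pi> a) (p # us) - tensor_sum (\<lambda>g a. \<phi> (g' g) \<otimes>\<^sub>o \<pi> a) (p #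
          us))
          = norm (\<phi> (g - g' g) \<otimes>\<^sub>o \<pi> a
            + (tensor_sum (\<lambda>g a. \<phi> g \<otimes>\<^sub>o \<pi> a) us - tensor_sum (\<lambda>g a. \<phi> (g' g) \<otimes>\<^sub>o \<pi> a) us))"
        by (simp add: p algebra_simps)
      also have "\<dots> \<le> norm (\<phi> (g - g' g)) * norm (\<pi> a) + \<epsilon> * sum_list (map (\<lambda>(g, a). norm a) us)"
        using Cons by (intro norm_triangle_mono norm_op_tensor_le bo) auto
      finally show ?case using le by (simp add: p distrib_left)
    qed simp
    from this[of ts] have "norm (?L - (\<Sum>j\<in>J. Q j o\<^sub>L C ts j o\<^sub>L Q j)) \<le> \<epsilon> * K"
      by (simp add: approx K_def)
    with main show ?thesis
      using norm_triangle_sub[of ?L "\<Sum>j\<in>J. Q j o\<^sub>L C ts j o\<^sub>L Q j"] by linarith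
  qed
  show ?thesis
  proof (rule field_le_epsilon)
    fix e :: real assume "0 < e"
    \<comment> \<open>K may be 0, hence the denominator \<open>K + 1\<close>.\<close>
    have "norm ?L \<le> ?N + e / (K + 1) * K"
      using \<open>0 < e\<close> K by (intro bound) simp
    also have "e / (K + 1) * K \<le> e" using \<open>0 < e\<close> K by (simp add: field_simps)
    finally show "norm ?L \<le> ?N + e" by simp
  qed
qed

text \<open>Serves for \<open>\<alpha> \<otimes> id\<close> in the action identity and, with \<phi>
  the composite of \<pi> and \<open>\<alpha>\<^sub>x\<close>, for
  \<open>\<alpha>\<^sub>x \<otimes> id\<close>.\<close>

lemma amplified_hom_map:
  fixes \<phi> :: "('x::t2_space \<Rightarrow>\<^sub>C complex) \<Rightarrow> 'k op"
  assumes "compact (UNIV :: 'x set)" and "faithful_rep \<pi>" and \<phi>: "unital_star_hom \<phi>"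
  shows "bounded_tensor_map mult_op \<pi> (\<lambda>g a. \<phi> g \<otimes>\<^sub>o \<pi> a) 1"
proof -
  interpret rep_pair mult_op \<pi> by (rule rep_pair_mult) fact
  show ?thesis
    by standard
      (simp_all add: norm_amplified_hom_le[OF assms] star_hom_scaleC[OF \<phi>] op_tensor_scaleC_left
        star_hom_bounded[OF \<phi>] rep_bounded[OF assms(2)])
qed

section \<open>Supports\<close>

context
  fixes M :: "'x::t2_space measure" and \<phi> :: "('x \<Rightarrow>\<^sub>C complex) \<Rightarrow> complex"
  assumes rep: "represents M \<phi>"
begin

lemma
  shows represents_sets: "sets M = sets borel"
    and represents_space: "space M = UNIV"
    and represents_emeasure_UNIV: "emeasure M UNIV = 1"
    and represents_inner_regular: "E \<in> sets borel \<Longrightarrow> emeasure M E = (SUP K\<in>{K. K \<subseteq> E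
        \<and> compact K}. emeasure M K)"
    and represents_integral: "\<phi> f = (\<integral>y. apply_bcontfun f y \<partial>M)"
proof -
  show sets: "sets M = sets borel" using rep by (simp add: represents_def regular_borel_probability_def)
  then show "space M = UNIV" using sets_eq_imp_space_eq[of M borel] by simp
  then show "emeasure M UNIV = 1" using rep by (simp add: represents_def regular_borel_probability_def)
  show "emeasure M E = (SUP K\<in>{K. K \<subseteq> E \<and> compact K}. emeasure M K)" if "E \<in> sets borel"
    using rep that by (simp add: represents_def regular_borel_probability_def)
  show "\<phi> f = (\<integral>y. apply_bcontfun f y \<partial>M)" using rep by (simp add: represents_def)
qed

lemma closed_support: "closed (support M)"
proof -
  have "- support M = \<Union>{U. open U \<and> emeasure M U = 0}" by (auto simp: support_def)
  then have "open (- support M)" by auto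
  then show ?thesis by (simp add: closed_def)
qed

text \<open>The complement is a union of possibly uncountably many null open sets, so countable
  additivity does not apply. Inner regularity reduces the claim to compact subsets, which finitely
  many of these sets cover.\<close>

lemma emeasure_compl_support: "emeasure M (- support M) = 0"
proof -
  have "emeasure M K = 0" if K: "K \<subseteq> - support M" "compact K" for K
  proof -
    have "\<exists>U. open U \<and> y \<in> U \<and> emeasure M U = 0" if "y \<in> K" for y
      using K(1) that by (auto simp: support_def)
    then obtain U where U: "\<And>y. y \<in> K \<Longrightarrow> open (U y) \<and> y \<in> U y \<and> emeasure M (U y) = 0" by metis
    obtain J where J: "J \<subseteq> K" "finite J" "K \<subseteq> (\<Union>y\<in>J. U y)"
      using compactE_image[OF K(2), of K U] U by blast
    have "emeasure M K \<le> emeasure M (\<Union>y\<in>J. U y)"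
      using J U by (intro emeasure_mono) (auto simp: represents_sets intro!: borel_open)
    also have "\<dots> \<le> (\<Sum>y\<in>J. emeasure M (U y))"
      using J U by (intro emeasure_subadditive_finite) (auto simp: represents_sets intro!: borel_open)
    also have "\<dots> = 0" using J(1) U by (intro sum.neutral) auto
    finally show ?thesis by simp
  qed
  then have "(SUP K\<in>{K. K \<subseteq> - support M \<and> compact K}. emeasure M K) = 0"
    by (intro antisym SUP_least) auto
  then show ?thesis
    using represents_inner_regular[of "- support M"] closed_support by auto
qed

lemma support_nonempty: "support M \<noteq> {}"
  using emeasure_compl_support represents_emeasure_UNIV by auto

lemma represents_eq_0:
  assumes "f \<in> vanishing_ideal (support M)"
  shows "\<phi> f = 0"
proof -
  have "AE y in M. apply_bcontfun f y = 0"
  proof (rule AE_I)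
    show "{y \<in> space M. apply_bcontfun f y \<noteq> 0} \<subseteq> - support M"
      using assms by (auto simp: vanishing_ideal_def)
    show "- support M \<in> sets M" using closed_support by (simp add: represents_sets)
  qed (rule emeasure_compl_support)
  then show ?thesis unfolding represents_integral by (rule integral_eq_zero_AE)
qed

text \<open>A zero integral makes \<open>r\<close> vanish almost everywhere. By continuity the set
  where it is nonzero is then an open null set, which cannot meet the support.\<close>

lemma represents_nonneg_eq_0D:
  assumes "\<phi> f = 0" and f: "\<And>y. apply_bcontfun f y = complex_of_real (r y)" "\<And>y. 0 \<le> r y"
  shows "f \<in> vanishing_ideal (support M)"
proof -
  have r: "r = (\<lambda>y. Re (apply_bcontfun f y))" by (auto simp: f(1))
  then have r_cont: "continuous_on UNIV r" by (auto intro!: continuous_intros)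
  have r_meas: "r \<in> borel_measurable M"
    using borel_measurable_continuous_onI[OF r_cont]
      by (simp add: measurable_cong_sets[OF represents_sets refl])
  interpret finite_measure M
    by standard (simp add: represents_space represents_emeasure_UNIV)
  have "integrable M r"
  proof (rule integrable_const_bound[OF _ r_meas])
    show "AE y in M. norm (r y) \<le> norm f"
      using norm_bounded[of f] f by simp
  qed
  moreover have "(\<integral>y. r y \<partial>M) = 0"
    using assms(1) by (simp add: represents_integral f(1))
  ultimately have "AE y in M. r y = 0"
    using integral_nonneg_eq_0_iff_AE[of M r] f(2) by simp
  then have "emeasure M {y. r y \<noteq> 0} = 0"
    using r_meas by (subst (asm) AE_iff_measurable[OF _ refl]) (auto
        simp: represents_space represents_sets
      intro!: borel_open open_Collect_neq r_cont continuous_intros)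
  moreover have "open {y. r y \<noteq> 0}" by (intro open_Collect_neq r_cont continuous_intros)
  ultimately have "r y = 0" if "y \<in> support M" for y
    using that by (auto simp: support_def)
  then show ?thesis by (simp add: vanishing_ideal_def f(1))
qed

end

section \<open>Fibres of an action\<close>

lemma bounded_linear_apply_bcontfun:
  "bounded_linear (\<lambda>f :: 'x::topological_space \<Rightarrow>\<^sub>C complex. apply_bcontfun f y)"
  by (rule bounded_linear_intro[where K = 1]) (simp_all add: plus_bcontfun.rep_eq scaleR_bcontfun.rep_eq
      norm_bounded)

lemma bounded_linear_state: "state h \<Longrightarrow> bounded_linear h"
  by (rule bounded_linear_intro[where K = 1])
    (simp_all add: state_add state_scaleC scaleR_scaleC scaleC_complex_def state_norm_le)

lemma ell2_slice_unit_tensor: "ell2_slice x (ell2_tensor (ell2_unit x) \<xi>) = \<xi>"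
  by (simp add: ell2_slice_tensor ell2_apply_unit scaleC_1)

lemma op_assoc_apply:
  "blinfun_apply (op_assoc T) u = blinfun_apply (ell2_reindex (\<lambda>(i, j, k). ((i, j), k)))
    (blinfun_apply T (blinfun_apply (ell2_reindex (\<lambda>((i, j), k). (i, j, k))) u))"
  by (simp add: op_assoc_def)

lemma inj_assoc: "inj (\<lambda>((i, j), k). (i, j, k))" "inj (\<lambda>(i, j, k). ((i, j), k))"
  by (auto simp: inj_def)

lemma ell2_reindex_assoc_tensor:
  "blinfun_apply (ell2_reindex (\<lambda>((i, j), k). (i, j, k))) (ell2_tensor x (ell2_tensor y z))
    = ell2_tensor (ell2_tensor x y) z"
  "blinfun_apply (ell2_reindex (\<lambda>(i, j, k). ((i, j), k))) (ell2_tensor (ell2_tensor x y) z)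
    = ell2_tensor x (ell2_tensor y z)"
  by (rule ell2_eqI; auto simp: ell2_apply_reindex[OF inj_assoc(1)] ell2_apply_reindex[OF inj_assoc(2)]
      ell2_apply_tensor)+

lemma clinear_on_compose_UNIV:
  assumes "clinear_on S f" and "\<And>u v. g (u + v) = g u + g v" and "\<And>c u. g (c *\<^sub>C u) = c *\<^sub>C g u"
  shows "clinear_on S (\<lambda>t. g (f t))"
  using assms by (simp add: clinear_on_def)

locale quantum_action =
  fixes \<pi> :: "'a::cstar_algebra \<Rightarrow> 'i op"
    and \<Delta> :: "'a \<Rightarrow> ('i \<times> 'i) op"
    and h :: "'a \<Rightarrow> complex"
    and \<alpha> :: "('x::t2_space \<Rightarrow>\<^sub>C complex) \<Rightarrow> ('x \<times> 'i) op"
  assumes cpt: "compact (UNIV :: 'x set)"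
    and faithful: "faithful_rep \<pi>"
    and cqg: "compact_quantum_group \<pi> \<Delta>"
    and haar: "haar_measure \<pi> \<Delta> h"
    and action: "cqg_action \<pi> \<Delta> \<alpha>"
begin

lemma
  shows \<Delta>_hom: "unital_star_hom \<Delta>"
    and state_h: "state h"
    and haar_left: "tensor_ext \<pi> \<pi> (\<lambda>b c. h b *\<^sub>C c) (\<Delta> a) = h a *\<^sub>C 1"
    and haar_right: "tensor_ext \<pi> \<pi> (\<lambda>b c. h c *\<^sub>C b) (\<Delta> a) = h a *\<^sub>C 1"
    and \<alpha>_hom: "unital_star_hom \<alpha>"
    and \<alpha>_mem: "\<alpha> f \<in> min_tensor mult_op \<pi>"
    and action_coassoc: "op_assoc (tensor_ext mult_op \<pi> (\<lambda>g a. \<alpha> g \<otimes>\<^sub>o \<pi> a) (\<alpha> f))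
        = tensor_ext mult_op \<pi> (\<lambda>g a. mult_op g \<otimes>\<^sub>o \<Delta> a) (\<alpha> f)"
  using cqg haar action
  by (auto simp: compact_quantum_group_def haar_measure_def cqg_action_def)

lemmas \<pi>_hom = rep_hom[OF faithful]
lemmas \<pi>_bounded = rep_bounded[OF faithful]

sublocale fib: bounded_tensor_map mult_op \<pi> "\<lambda>f a. apply_bcontfun f x *\<^sub>C a" 1 for x
  by (rule fiber_map[OF faithful])

abbreviation fib :: "'x \<Rightarrow> ('x \<times> 'i) op \<Rightarrow> 'a" where
  "fib x \<equiv> tensor_ext mult_op \<pi> (\<lambda>f a. apply_bcontfun f x *\<^sub>C a)"

abbreviation act :: "'x \<Rightarrow> ('x \<Rightarrow>\<^sub>C complex) \<Rightarrow> 'a" where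
  "act \<equiv> action_at \<pi> \<alpha>"

lemma act_eq: "act x f = fib x (\<alpha> f)"
  by (simp add: action_at_def)

lemma \<alpha>_unit: "blinfun_apply (\<alpha> f) (ell2_tensor (ell2_unit x) \<xi>)
    = ell2_tensor (ell2_unit x) (blinfun_apply (\<pi> (act x f)) \<xi>)"
  unfolding act_eq by (rule fiber_apply[OF faithful \<alpha>_mem])

lemma \<pi>_act: "blinfun_apply (\<pi> (act x f)) \<xi> = ell2_slice x (blinfun_apply (\<alpha> f) (ell2_tensor (ell2_unit x)
    \<xi>))"
  by (simp add: \<alpha>_unit ell2_slice_unit_tensor)

text \<open>Each \<open>\<alpha> f\<close> maps the summand over x into itself, so the block of a
  product is the product of the blocks, and likewise for adjoints.\<close>

lemma \<pi>_act_hom: "unital_star_hom (\<lambda>f. \<pi> (act x f))"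
  unfolding unital_star_hom_def
proof (intro conjI allI)
  fix f g :: "'x \<Rightarrow>\<^sub>C complex" and c
  show "range (\<lambda>f. \<pi> (act x f)) \<subseteq> bounded_operators" by (auto intro: \<pi>_bounded)
  show "\<pi> (act x (f + g)) = \<pi> (act x f) + \<pi> (act x g)"
    by (rule blinfun_eqI) (simp add: \<pi>_act star_hom_add[OF \<alpha>_hom] blinfun.add_left ell2_slice_add)
  show "\<pi> (act x (c *\<^sub>C f)) = c *\<^sub>C \<pi> (act x f)"
    by (rule blinfun_eqI) (simp add: \<pi>_act star_hom_scaleC[OF \<alpha>_hom] blinfun_apply_scaleC
        ell2_slice_scaleC)
  show "\<pi> (act x (f * g)) = \<pi> (act x f) o\<^sub>L \<pi> (act x g)"
    by (rule blinfun_eqI) (simp add: \<pi>_act[of x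
        "f * g"] star_hom_mult[OF \<alpha>_hom] \<alpha>_unit ell2_slice_unit_tensor)
  show "\<pi> (act x 1) = id_blinfun"
    by (rule blinfun_eqI) (simp add: \<pi>_act star_hom_1[OF \<alpha>_hom] ell2_slice_unit_tensor)
  have "cinner (blinfun_apply (\<pi> (act x (star f))) \<xi>) \<eta>
      = cinner \<xi> (blinfun_apply (\<pi> (act x f)) \<eta>)" for \<xi> \<eta>
  proof -
    have "cinner (blinfun_apply (\<alpha> (star f)) (ell2_tensor (ell2_unit x) \<xi>)) (ell2_tensor (ell2_unit x) \<eta>)
        = cinner (ell2_tensor (ell2_unit x) \<xi>) (blinfun_apply (\<alpha> f) (ell2_tensor (ell2_unit x) \<eta>))"
      using star_hom_adjoint[OF \<alpha>_hom, of f] by (simp add: is_adjoint_def)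
    then show ?thesis by (simp add: \<alpha>_unit cinner_tensor cinner_self norm_ell2_unit)
  qed
  then show "is_adjoint (\<pi> (act x (star f))) (\<pi> (act x f))" by (simp add: is_adjoint_def)
qed

lemma act_add: "act x (f + g) = act x f + act x g"
  using star_hom_add[OF \<pi>_act_hom, of x f g]
    by (simp add: rep_inject[OF faithful] flip: star_hom_add[OF \<pi>_hom])

lemma act_scaleC: "act x (c *\<^sub>C f) = c *\<^sub>C act x f"
  using star_hom_scaleC[OF \<pi>_act_hom, of x c f]
    by (simp add: rep_inject[OF faithful] flip: star_hom_scaleC[OF \<pi>_hom])

lemma act_mult: "act x (f * g) = act x f * act x g"
  using star_hom_mult[OF \<pi>_act_hom, of x f g]
    by (simp add: rep_inject[OF faithful] flip: star_hom_mult[OF \<pi>_hom])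

lemma act_1: "act x 1 = 1"
  using star_hom_1[OF \<pi>_act_hom, of x] by (simp add: rep_inject[OF faithful] flip: star_hom_1[OF \<pi>_hom])

lemma act_star: "act x (star f) = star (act x f)"
proof -
  have "blinfun_apply (\<pi> (act x (star f))) \<xi> = blinfun_apply (\<pi> (star (act x f))) \<xi>" for \<xi>
  proof (rule ell2_cinner_eqI)
    fix \<eta>
    have "cinner (blinfun_apply (\<pi> (act x (star f))) \<xi>) \<eta>
        = cinner (blinfun_apply (\<pi> (star (act x f))) \<xi>) \<eta>"
      using star_hom_adjoint[OF \<pi>_act_hom, of x f] star_hom_adjoint[OF \<pi>_hom, of "act x f"]
      by (simp add: is_adjoint_def)
    then show "cinner \<eta> (blinfun_apply (\<pi> (act x (star f))) \<xi>)
        = cinner \<eta> (blinfun_apply (\<pi> (star (act x f))) \<xi>)"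
      by (metis cinner_commute)
  qed
  then have "\<pi> (act x (star f)) = \<pi> (star (act x f))" by (rule blinfun_eqI)
  then show ?thesis by (simp add: rep_inject[OF faithful])
qed

lemma bounded_linear_act: "bounded_linear (act x)"
proof (rule bounded_linear_intro[where K = 1])
  show "norm (act x f) \<le> norm f * 1" for f
    using norm_unital_star_hom_le[OF \<pi>_act_hom, of x f] by (simp add: rep_isometric[OF faithful])
qed (simp_all add: act_add act_scaleC scaleR_scaleC)

lemma orbit_state_eq: "orbit_state \<pi> h \<alpha> x f = h (act x f)"
  unfolding orbit_state_def act_eq
proof (rule fib.min_tensor_eqI[OF _ _ _ _ _ \<alpha>_mem])
  interpret s: bounded_tensor_map mult_op \<pi> "\<lambda>g a. apply_bcontfun g x * h a" 1
    by (rule fiber_state_map[OF faithful state_h])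
  show "clinear_on (min_tensor mult_op \<pi>) (tensor_ext mult_op \<pi> (\<lambda>g a. apply_bcontfun g x * h a))"
    by (rule s.tensor_ext_clinear)
  show "continuous_on (min_tensor mult_op \<pi>) (tensor_ext mult_op \<pi> (\<lambda>g a. apply_bcontfun g x * h a))"
    by (rule s.tensor_ext_continuous)
  show "clinear_on (min_tensor mult_op \<pi>) (\<lambda>t. h (fib x t))"
    by (rule clinear_on_compose_UNIV[OF fib.tensor_ext_clinear])
      (simp_all add: state_add[OF state_h] state_scaleC[OF state_h] scaleC_complex_def)
  show "continuous_on (min_tensor mult_op \<pi>) (\<lambda>t. h (fib x t))"
    by (rule bounded_linear.continuous_on[OF bounded_linear_state[OF state_h] fib.tensor_ext_continuous])
  show "tensor_ext mult_op \<pi> (\<lambda>g a. apply_bcontfun g x * h a) (mult_op g \<otimes>\<^sub>o \<pi> a)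
      = h (fib x (mult_op g \<otimes>\<^sub>o \<pi> a))" for g a
    by (simp add: s.tensor_ext_tensor fib.tensor_ext_tensor state_scaleC[OF state_h])
qed

section \<open>Averages and vector slices of an action\<close>

abbreviation avg :: "('x \<times> 'i) op \<Rightarrow> ('x \<Rightarrow>\<^sub>C complex)" where
  "avg \<equiv> tensor_ext mult_op \<pi> (\<lambda>g a. h a *\<^sub>C g)"

sublocale avg: bounded_tensor_map mult_op \<pi> "\<lambda>g a. h a *\<^sub>C g" 1
  by (rule right_slice_map[OF faithful state_h])

text \<open>Hence \<open>avg (\<alpha> f)\<close> is the function
  \<open>y \<mapsto> \<mu>\<^sub>y f\<close>, now known to be an element of C(X) to which
  \<open>\<alpha>\<^sub>x\<close> can be applied.\<close>

lemma apply_avg: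
  assumes "t \<in> min_tensor mult_op \<pi>"
  shows "apply_bcontfun (avg t) x = h (fib x t)"
proof (rule fib.min_tensor_eqI[OF _ _ _ _ _ assms])
  show "clinear_on (min_tensor mult_op \<pi>) (\<lambda>t. apply_bcontfun (avg t) x)"
    by (rule clinear_on_compose_UNIV[OF avg.tensor_ext_clinear])
      (simp_all add: plus_bcontfun.rep_eq apply_scaleC_bcontfun)
  show "continuous_on (min_tensor mult_op \<pi>) (\<lambda>t. apply_bcontfun (avg t) x)"
    by (rule bounded_linear.continuous_on[OF bounded_linear_apply_bcontfun avg.tensor_ext_continuous])
  show "clinear_on (min_tensor mult_op \<pi>) (\<lambda>t. h (fib x t))"
    by (rule clinear_on_compose_UNIV[OF fib.tensor_ext_clinear])
      (simp_all add: state_add[OF state_h] state_scaleC[OF state_h] scaleC_complex_def)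
  show "continuous_on (min_tensor mult_op \<pi>) (\<lambda>t. h (fib x t))"
    by (rule bounded_linear.continuous_on[OF bounded_linear_state[OF state_h] fib.tensor_ext_continuous])
  show "apply_bcontfun (avg (mult_op g \<otimes>\<^sub>o \<pi> a)) x = h (fib x (mult_op g \<otimes>\<^sub>o \<pi> a))" for g a
    by (simp add: avg.tensor_ext_tensor fib.tensor_ext_tensor state_scaleC[OF state_h]
        apply_scaleC_bcontfun scaleC_complex_def)
qed

abbreviation vec :: "'i ell2 \<Rightarrow> ('x \<times> 'i) op \<Rightarrow> ('x \<Rightarrow>\<^sub>C complex)" where
  "vec \<zeta> \<equiv> tensor_ext mult_op \<pi> (\<lambda>g a. cinner \<zeta> (blinfun_apply (\<pi> a) \<zeta>) *\<^sub>C g)"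

sublocale vec: bounded_tensor_map mult_op \<pi> "\<lambda>g a. cinner \<zeta> (blinfun_apply (\<pi> a) \<zeta>) *\<^sub>C g"
    "norm \<zeta> * norm \<zeta>" for \<zeta>
  by (rule vector_slice_map[OF faithful])

lemma bounded_linear_vector_state: "bounded_linear (\<lambda>a. cinner \<zeta> (blinfun_apply (\<pi> a) \<zeta>))"
  by (intro bounded_linear_compose[OF bounded_linear_cinner_right]
      bounded_linear_compose[OF blinfun.bounded_linear_left] bounded_linear_star_hom \<pi>_hom)

lemma vector_state_linear:
  "cinner \<zeta> (blinfun_apply (\<pi> (a + b)) \<zeta>) = cinner \<zeta> (blinfun_apply (\<pi> a) \<zeta>) + cinner \<zeta> (blinfun_apply (\<pi>
      b) \<zeta>)"
  "cinner \<zeta> (blinfun_apply (\<pi> (c *\<^sub>C a)) \<zeta>) = c *\<^sub>C cinner \<zeta> (blinfun_apply (\<pi> a) \<zeta>)"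
  by (simp_all add: star_hom_add[OF \<pi>_hom] star_hom_scaleC[OF \<pi>_hom] blinfun.add_left blinfun_apply_scaleC
      cinner_add_right cinner_scaleC_right scaleC_complex_def)

text \<open>At t = \<alpha> f this exhibits the matrix coefficient of
  \<open>\<alpha>\<^sub>x f\<close> at \<zeta> as a continuous function of x, ready to be
  integrated.\<close>

lemma apply_vec:
  assumes "t \<in> min_tensor mult_op \<pi>"
  shows "apply_bcontfun (vec \<zeta> t) x = cinner \<zeta> (blinfun_apply (\<pi> (fib x t)) \<zeta>)"
proof (rule fib.min_tensor_eqI[OF _ _ _ _ _ assms])
  show "clinear_on (min_tensor mult_op \<pi>) (\<lambda>t. apply_bcontfun (vec \<zeta> t) x)"
    by (rule clinear_on_compose_UNIV[OF vec.tensor_ext_clinear])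
      (simp_all add: plus_bcontfun.rep_eq apply_scaleC_bcontfun)
  show "continuous_on (min_tensor mult_op \<pi>) (\<lambda>t. apply_bcontfun (vec \<zeta> t) x)"
    by (rule bounded_linear.continuous_on[OF bounded_linear_apply_bcontfun vec.tensor_ext_continuous])
  show "clinear_on (min_tensor mult_op \<pi>) (\<lambda>t. cinner \<zeta> (blinfun_apply (\<pi> (fib x t)) \<zeta>))"
    by (rule clinear_on_compose_UNIV[OF fib.tensor_ext_clinear]) (rule vector_state_linear)+
  show "continuous_on (min_tensor mult_op \<pi>) (\<lambda>t. cinner \<zeta> (blinfun_apply (\<pi> (fib x t)) \<zeta>))"
    by (rule bounded_linear.continuous_on[OF bounded_linear_vector_state fib.tensor_ext_continuous])
  show "apply_bcontfun (vec \<zeta> (mult_op g \<otimes>\<^sub>o \<pi> a)) x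
      = cinner \<zeta> (blinfun_apply (\<pi> (fib x (mult_op g \<otimes>\<^sub>o \<pi> a))) \<zeta>)" for g a
    by (simp add: vec.tensor_ext_tensor fib.tensor_ext_tensor vector_state_linear(2) apply_scaleC_bcontfun
        scaleC_complex_def)
qed

text \<open>\<open>coact x\<close> is \<open>\<alpha>\<^sub>x \<otimes> id\<close>.\<close>

abbreviation coact :: "'x \<Rightarrow> ('x \<times> 'i) op \<Rightarrow> ('i \<times> 'i) op" where
  "coact x \<equiv> tensor_ext mult_op \<pi> (\<lambda>g a. \<pi> (act x g) \<otimes>\<^sub>o \<pi> a)"

sublocale coact: bounded_tensor_map mult_op \<pi> "\<lambda>g a. \<pi> (act x g) \<otimes>\<^sub>o \<pi> a" 1 for x
  by (rule amplified_hom_map[OF cpt faithful \<pi>_act_hom])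

sublocale AA: rep_pair \<pi> \<pi>
  by (rule rep_pair_self[OF faithful])

text \<open>Slices of A \<otimes> A are 0 outside \<open>min_tensor \<pi> \<pi>\<close> by
  convention, so composing them with \<open>coact x\<close> is meaningful only after this.\<close>

lemma coact_mem:
  assumes t: "t \<in> min_tensor mult_op \<pi>"
  shows "coact x t \<in> min_tensor \<pi> \<pi>"
proof -
  obtain ts where ts: "(\<lambda>n. fib.tens (ts n)) \<longlonglongrightarrow> t" using t by (rule fib.min_tensor_sequence)
  have "coact x (fib.tens us) = AA.tens (map (\<lambda>(g, a). (act x g, a)) us)" for us
    unfolding fib.clinear_on_tens[OF coact.tensor_ext_clinear] coact.tensor_ext_tensor
    by (induction us) auto
  moreover have "(\<lambda>n. coact x (fib.tens (ts n))) \<longlonglongrightarrow> coact x t"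
    by (rule continuous_on_tendsto_compose[OF coact.tensor_ext_continuous ts t])
        (simp add: fib.tens_in_min_tensor)
  ultimately show ?thesis
    by (intro AA.min_tensor_limit[of "\<lambda>n. map (\<lambda>(g, a). (act x g, a)) (ts n)"]) simp
qed

text \<open>The action identity is an equality of operators on a triple tensor product. On
  \<open>ell2_tensor ?u w\<close>, with \<open>?u\<close> the basis vector at x, each side returns
  \<open>?u\<close> tensored with an operator applied to \<open>w\<close>; slicing at x cancels
  \<open>?u\<close>.\<close>

lemma coact_\<alpha>: "coact x (\<alpha> f) = \<Delta> (act x f)"
proof (rule blinfun_eqI)
  fix w
  let ?u = "ell2_unit x" and ?M = "min_tensor mult_op \<pi>"
  let ?L = "tensor_ext mult_op \<pi> (\<lambda>g a. \<alpha> g \<otimes>\<^sub>o \<pi> a)" and ?R =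
      "tensor_ext mult_op \<pi> (\<lambda>g a. mult_op g \<otimes>\<^sub>o \<Delta> a)"
  interpret L: bounded_tensor_map mult_op \<pi> "\<lambda>g a. \<alpha> g \<otimes>\<^sub>o \<pi> a" 1
    by (rule amplified_hom_map[OF cpt faithful \<alpha>_hom])
  interpret R: bounded_tensor_map mult_op \<pi> "\<lambda>g a. mult_op g \<otimes>\<^sub>o \<Delta> a" 1
    by (rule right_hom_map[OF faithful \<Delta>_hom])
  have bl_assoc: "bounded_linear (\<lambda>T. blinfun_apply (op_assoc T) v)" for v :: "('x \<times> 'i \<times> 'i) ell2"
    unfolding op_assoc_apply
    by (intro bounded_linear_compose[OF blinfun.bounded_linear_right] blinfun.bounded_linear_left)
  have bl_unit: "bounded_linear (\<lambda>T. ell2_tensor ?u (blinfun_apply T w))" for w :: "('i \<times> 'i) ell2"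
    by (intro bounded_linear_compose[OF bounded_linear_ell2_tensor_right] blinfun.bounded_linear_left)
  have assoc_scaleC: "blinfun_apply (op_assoc T) (c *\<^sub>C v) = c *\<^sub>C blinfun_apply (op_assoc T) v"
    if "T \<in> bounded_operators" for T :: "(('x \<times> 'i) \<times> 'i) op" and c v
    by (simp add: op_assoc_apply ell2_reindex_scaleC inj_assoc bounded_operators_scaleC[OF that])
  \<comment> \<open>Reassociation pairs \<open>?u\<close> with the first copy of the representation
    space, where \<open>\<alpha> g\<close> acts by its block at x.\<close>
  have elementary: "blinfun_apply (op_assoc (\<alpha> g \<otimes>\<^sub>o \<pi> a)) (ell2_tensor ?u w)
      = ell2_tensor ?u (blinfun_apply (\<pi> (act x g) \<otimes>\<^sub>o \<pi> a) w)" for g a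
  proof (rule bounded_linear_tensor_eqI[where f =
      "\<lambda>w. blinfun_apply (op_assoc (\<alpha> g \<otimes>\<^sub>o \<pi> a)) (ell2_tensor ?u w)"])
    note bo = star_hom_bounded[OF \<alpha>_hom] \<pi>_bounded op_tensor_bounded_operators
    show "bounded_linear (\<lambda>w. blinfun_apply (op_assoc (\<alpha> g \<otimes>\<^sub>o \<pi> a)) (ell2_tensor ?u w))"
      by (intro bounded_linear_compose[OF blinfun.bounded_linear_right] bounded_linear_ell2_tensor_right)
    show "bounded_linear (\<lambda>w. ell2_tensor ?u (blinfun_apply (\<pi> (act x g) \<otimes>\<^sub>o \<pi> a) w))"
      by (intro bounded_linear_compose[OF bounded_linear_ell2_tensor_right] blinfun.bounded_linear_right)
    show "blinfun_apply (op_assoc (\<alpha> g \<otimes>\<^sub>o \<pi> a)) (ell2_tensor ?u (c *\<^sub>C w))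
        = c *\<^sub>C blinfun_apply (op_assoc (\<alpha> g \<otimes>\<^sub>o \<pi> a)) (ell2_tensor ?u w)" for c w
      by (simp add: ell2_tensor_scaleC_right assoc_scaleC bo)
    show "ell2_tensor ?u (blinfun_apply (\<pi> (act x g) \<otimes>\<^sub>o \<pi> a) (c *\<^sub>C w))
        = c *\<^sub>C ell2_tensor ?u (blinfun_apply (\<pi> (act x g) \<otimes>\<^sub>o \<pi> a) w)" for c w
      by (simp add: bounded_operators_scaleC bo ell2_tensor_scaleC_right)
    show "blinfun_apply (op_assoc (\<alpha> g \<otimes>\<^sub>o \<pi> a)) (ell2_tensor ?u (ell2_tensor \<xi> \<eta>))
        = ell2_tensor ?u (blinfun_apply (\<pi> (act x g) \<otimes>\<^sub>o \<pi> a) (ell2_tensor \<xi> \<eta>))" for \<xi> \<eta>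
      by (simp add: op_assoc_apply ell2_reindex_assoc_tensor op_tensor_apply bo \<alpha>_unit)
  qed
  have left: "blinfun_apply (op_assoc (?L (\<alpha> f))) (ell2_tensor ?u w)
      = ell2_tensor ?u (blinfun_apply (coact x (\<alpha> f)) w)"
  proof (rule fib.min_tensor_eqI[OF _ _ _ _ _ \<alpha>_mem])
    show "clinear_on ?M (\<lambda>t. blinfun_apply (op_assoc (?L t)) (ell2_tensor ?u w))"
      by (rule clinear_on_compose_UNIV[OF L.tensor_ext_clinear])
        (simp_all add: op_assoc_apply blinfun.add_left blinfun.add_right blinfun_apply_scaleC
            ell2_reindex_scaleC inj_assoc)
    show "continuous_on ?M (\<lambda>t. blinfun_apply (op_assoc (?L t)) (ell2_tensor ?u w))"
      by (rule bounded_linear.continuous_on[OF bl_assoc L.tensor_ext_continuous])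
    show "clinear_on ?M (\<lambda>t. ell2_tensor ?u (blinfun_apply (coact x t) w))"
      by (rule clinear_on_compose_UNIV[OF coact.tensor_ext_clinear])
        (simp_all add: blinfun.add_left blinfun_apply_scaleC ell2_tensor_add_right
            ell2_tensor_scaleC_right)
    show "continuous_on ?M (\<lambda>t. ell2_tensor ?u (blinfun_apply (coact x t) w))"
      by (rule bounded_linear.continuous_on[OF bl_unit coact.tensor_ext_continuous])
    show "blinfun_apply (op_assoc (?L (mult_op g \<otimes>\<^sub>o \<pi> a))) (ell2_tensor ?u w)
        = ell2_tensor ?u (blinfun_apply (coact x (mult_op g \<otimes>\<^sub>o \<pi> a)) w)" for g a
      by (simp add: L.tensor_ext_tensor coact.tensor_ext_tensor elementary)
  qed
  have right: "blinfun_apply (?R (\<alpha> f)) (ell2_tensor ?u w)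
      = ell2_tensor ?u (blinfun_apply (\<Delta> (fib x (\<alpha> f))) w)"
  proof (rule fib.min_tensor_eqI[OF _ _ _ _ _ \<alpha>_mem])
    show "clinear_on ?M (\<lambda>t. blinfun_apply (?R t) (ell2_tensor ?u w))"
      by (rule clinear_on_compose_UNIV[OF R.tensor_ext_clinear])
        (simp_all add: blinfun.add_left blinfun_apply_scaleC)
    show "continuous_on ?M (\<lambda>t. blinfun_apply (?R t) (ell2_tensor ?u w))"
      by (rule bounded_linear.continuous_on[OF blinfun.bounded_linear_left R.tensor_ext_continuous])
    show "clinear_on ?M (\<lambda>t. ell2_tensor ?u (blinfun_apply (\<Delta> (fib x t)) w))"
      by (rule clinear_on_compose_UNIV[OF fib.tensor_ext_clinear])
        (simp_all add: star_hom_add[OF \<Delta>_hom] star_hom_scaleC[OF \<Delta>_hom] blinfun.add_left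
            blinfun_apply_scaleC
          ell2_tensor_add_right ell2_tensor_scaleC_right)
    show "continuous_on ?M (\<lambda>t. ell2_tensor ?u (blinfun_apply (\<Delta> (fib x t)) w))"
      by (rule bounded_linear.continuous_on[OF bounded_linear_compose[OF bl_unit
          bounded_linear_star_hom[OF \<Delta>_hom]] fib.tensor_ext_continuous])
    show "blinfun_apply (?R (mult_op g \<otimes>\<^sub>o \<pi> a)) (ell2_tensor ?u w)
        = ell2_tensor ?u (blinfun_apply (\<Delta> (fib x (mult_op g \<otimes>\<^sub>o \<pi> a))) w)" for g a
      by (simp add: R.tensor_ext_tensor fib.tensor_ext_tensor mult_op_tensor_unit star_hom_bounded[OF
          \<Delta>_hom]
          star_hom_scaleC[OF \<Delta>_hom] blinfun_apply_scaleC)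
  qed
  have "ell2_tensor ?u (blinfun_apply (coact x (\<alpha> f)) w) = ell2_tensor ?u (blinfun_apply (\<Delta> (act x f)) w)"
    using left right by (simp add: action_coassoc act_eq)
  from arg_cong[OF this, of "ell2_slice x"] show "blinfun_apply (coact x (\<alpha> f)) w
      = blinfun_apply (\<Delta> (act x f)) w"
    by (simp add: ell2_slice_unit_tensor)
qed

lemma clinear_on_coact_compose:
  assumes "clinear_on (min_tensor \<pi> \<pi>) F"
  shows "clinear_on (min_tensor mult_op \<pi>) (\<lambda>t. F (coact x t))"
  using assms coact.tensor_ext_clinear coact_mem by (simp add: clinear_on_def)

lemma continuous_on_coact_compose:
  assumes "continuous_on (min_tensor \<pi> \<pi>) F"
  shows "continuous_on (min_tensor mult_op \<pi>) (\<lambda>t. F (coact x t))"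
  by (rule continuous_on_compose2[OF assms coact.tensor_ext_continuous]) (auto intro: coact_mem)

lemma act_average: "act x (avg (\<alpha> f)) = h (act x f) *\<^sub>C 1"
proof -
  let ?S = "tensor_ext \<pi> \<pi> (\<lambda>b c. h c *\<^sub>C b)"
  interpret S: bounded_tensor_map \<pi> \<pi> "\<lambda>b c. h c *\<^sub>C b" 1
    by (rule right_state_map[OF faithful state_h])
  \<comment> \<open>The slice touches the right leg and \<open>\<alpha>\<^sub>x\<close> the left
    one, so they commute; Haar invariance evaluates the slice of \<Delta>.\<close>
  have "?S (coact x (\<alpha> f)) = act x (avg (\<alpha> f))"
  proof (rule fib.min_tensor_eqI[OF _ _ _ _ _ \<alpha>_mem])
    show "clinear_on (min_tensor mult_op \<pi>) (\<lambda>t. ?S (coact x t))"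
      by (rule clinear_on_coact_compose[OF S.tensor_ext_clinear])
    show "continuous_on (min_tensor mult_op \<pi>) (\<lambda>t. ?S (coact x t))"
      by (rule continuous_on_coact_compose[OF S.tensor_ext_continuous])
    show "clinear_on (min_tensor mult_op \<pi>) (\<lambda>t. act x (avg t))"
      by (rule clinear_on_compose_UNIV[OF avg.tensor_ext_clinear act_add act_scaleC])
    show "continuous_on (min_tensor mult_op \<pi>) (\<lambda>t. act x (avg t))"
      by (rule bounded_linear.continuous_on[OF bounded_linear_act avg.tensor_ext_continuous])
    show "?S (coact x (mult_op g \<otimes>\<^sub>o \<pi> a)) = act x (avg (mult_op g \<otimes>\<^sub>o \<pi> a))" for g a
      by (simp add: coact.tensor_ext_tensor S.tensor_ext_tensor avg.tensor_ext_tensor act_scaleC)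
  qed
  then show ?thesis by (simp add: coact_\<alpha> haar_right)
qed

text \<open>Invariance of \<open>\<mu>\<^sub>x\<close> in weak form, paired with the vector
  functional of \<zeta>, whose value at 1 is \<open>cinner \<zeta> \<zeta>\<close>. Both sides are
  numbers, and the left one is the integral of a scalar function.\<close>

lemma orbit_state_invariant:
  "h (act x (vec \<zeta> (\<alpha> f))) = h (act x f) * cinner \<zeta> \<zeta>"
proof -
  let ?S = "tensor_ext \<pi> \<pi> (\<lambda>b c. h b *\<^sub>C c)" and ?w = "\<lambda>a. cinner \<zeta> (blinfun_apply (\<pi> a) \<zeta>)"
  interpret S: bounded_tensor_map \<pi> \<pi> "\<lambda>b c. h b *\<^sub>C c" 1
    by (rule left_state_map[OF faithful state_h])
  have "?w (?S (coact x (\<alpha> f))) = h (act x (vec \<zeta> (\<alpha> f)))"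
  proof (rule fib.min_tensor_eqI[OF _ _ _ _ _ \<alpha>_mem])
    show "clinear_on (min_tensor mult_op \<pi>) (\<lambda>t. ?w (?S (coact x t)))"
      by (rule clinear_on_compose_UNIV[OF clinear_on_coact_compose[OF S.tensor_ext_clinear]])
        (rule vector_state_linear)+
    show "continuous_on (min_tensor mult_op \<pi>) (\<lambda>t. ?w (?S (coact x t)))"
      by (rule bounded_linear.continuous_on[OF
          bounded_linear_vector_state continuous_on_coact_compose[OF S.tensor_ext_continuous]])
    show "clinear_on (min_tensor mult_op \<pi>) (\<lambda>t. h (act x (vec \<zeta> t)))"
      by (rule clinear_on_compose_UNIV[OF vec.tensor_ext_clinear])
        (simp_all add: act_add act_scaleC state_add[OF state_h] state_scaleC[OF state_h]
            scaleC_complex_def)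
    show "continuous_on (min_tensor mult_op \<pi>) (\<lambda>t. h (act x (vec \<zeta> t)))"
      by (rule bounded_linear.continuous_on[OF bounded_linear_compose[OF bounded_linear_state[OF state_h]
          bounded_linear_act] vec.tensor_ext_continuous])
    show "?w (?S (coact x (mult_op g \<otimes>\<^sub>o \<pi> a))) = h (act x (vec \<zeta> (mult_op g \<otimes>\<^sub>o \<pi> a)))" for g a
      by (simp add: coact.tensor_ext_tensor S.tensor_ext_tensor vec.tensor_ext_tensor act_scaleC
          state_scaleC[OF state_h] vector_state_linear(2) scaleC_complex_def mult.commute)
  qed
  then show ?thesis
    by (simp add: coact_\<alpha> haar_left vector_state_linear(2) star_hom_1[OF \<pi>_hom] scaleC_complex_def)
qed

text \<open>The image of \<open>\<alpha> f\<close> in the quotient tensor product is block diagonal,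
  with block \<open>\<pi> (act y f)\<close> over points y of Y and 0 elsewhere; it vanishes exactly
  when its blocks do.\<close>

lemma invariant_set_iff:
  "invariant_set \<pi> \<alpha> Y \<longleftrightarrow> closed Y \<and> (\<forall>f\<in>vanishing_ideal Y. \<forall>y\<in>Y. act y f = 0)"
proof -
  let ?Q = "tensor_ext mult_op \<pi> (\<lambda>g a. quotient_op Y (quotient_map Y g) \<otimes>\<^sub>o \<pi> a)"
  interpret Q: bounded_tensor_map mult_op \<pi> "\<lambda>g a. quotient_op Y (quotient_map Y g) \<otimes>\<^sub>o \<pi> a" 1
    by (rule quotient_map_bounded[OF faithful])
  have slice: "ell2_slice y (blinfun_apply (?Q (\<alpha> f)) u)
      = of_bool (y \<in> Y) *\<^sub>C blinfun_apply (\<pi> (fib y (\<alpha> f))) (ell2_slice y u)" for f y u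
  proof (rule fib.min_tensor_eqI[OF _ _ _ _ _ \<alpha>_mem])
    show "clinear_on (min_tensor mult_op \<pi>) (\<lambda>t. ell2_slice y (blinfun_apply (?Q t) u))"
      by (rule clinear_on_compose_UNIV[OF Q.tensor_ext_clinear])
        (simp_all add: blinfun.add_left blinfun_apply_scaleC ell2_slice_add ell2_slice_scaleC)
    show "continuous_on (min_tensor mult_op \<pi>) (\<lambda>t. ell2_slice y (blinfun_apply (?Q t) u))"
      by (rule bounded_linear.continuous_on[OF bounded_linear_compose[OF
          bounded_linear_ell2_slice blinfun.bounded_linear_left] Q.tensor_ext_continuous])
    show "clinear_on (min_tensor mult_op \<pi>) (\<lambda>t. of_bool (y \<in> Y) *\<^sub>C blinfun_apply (\<pi> (fib y t))
        (ell2_slice y u))"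
      by (rule clinear_on_compose_UNIV[OF fib.tensor_ext_clinear])
        (simp_all add: star_hom_add[OF \<pi>_hom] star_hom_scaleC[OF \<pi>_hom] blinfun.add_left
            blinfun_apply_scaleC
          scaleC_add_right scaleC_scaleC mult.commute)
    show "continuous_on (min_tensor mult_op \<pi>) (\<lambda>t. of_bool (y \<in> Y) *\<^sub>C blinfun_apply (\<pi> (fib y t))
        (ell2_slice y u))"
      by (rule bounded_linear.continuous_on[OF bounded_linear_compose[OF bounded_linear_scaleC
          bounded_linear_compose[OF blinfun.bounded_linear_left
              bounded_linear_star_hom[OF \<pi>_hom]]] fib.tensor_ext_continuous])
    show "ell2_slice y (blinfun_apply (?Q (mult_op g \<otimes>\<^sub>o \<pi> a)) u)
        = of_bool (y \<in> Y) *\<^sub>C blinfun_apply (\<pi> (fib y (mult_op g \<otimes>\<^sub>o \<pi> a))) (ell2_slice y u)" for g a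
      unfolding Q.tensor_ext_tensor fib.tensor_ext_tensor
      unfolding quotient_op_quotient_map
      by (simp add: ell2_slice_diag_op_tensor[OF norm_quotient_le \<pi>_bounded] star_hom_scaleC[OF \<pi>_hom]
          blinfun_apply_scaleC scaleC_1 scaleC_0_left)
  qed
  have "?Q (\<alpha> f) = 0 \<longleftrightarrow> (\<forall>y\<in>Y. act y f = 0)" for f
  proof
    assume 0: "?Q (\<alpha> f) = 0"
    show "\<forall>y\<in>Y. act y f = 0"
    proof
      fix y assume "y \<in> Y"
      have "blinfun_apply (\<pi> (act y f)) \<xi> = 0" for \<xi>
        using slice[of y f "ell2_tensor (ell2_unit y) \<xi>"] \<open>y \<in> Y\<close>
        by (simp add: 0 act_eq ell2_slice_unit_tensor scaleC_1 linear_0[OF bounded_linear.linear[OF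
            bounded_linear_ell2_slice]])
      then have "\<pi> (act y f) = \<pi> 0" by (intro blinfun_eqI) (simp add: star_hom_0[OF \<pi>_hom])
      then show "act y f = 0" by (simp add: rep_inject[OF faithful])
    qed
  next
    assume 0: "\<forall>y\<in>Y. act y f = 0"
    show "?Q (\<alpha> f) = 0"
    proof (rule blinfun_eqI, rule ell2_slice_eqI)
      show "ell2_slice y (blinfun_apply (?Q (\<alpha> f)) u) = ell2_slice y (blinfun_apply 0 u)" for y u
        unfolding slice using 0
        by (cases "y \<in> Y") (simp_all add: scaleC_0_left scaleC_0_right star_hom_0[OF \<pi>_hom]
            linear_0[OF bounded_linear.linear[OF bounded_linear_ell2_slice]] flip: act_eq)
    qed
  qed
  then show ?thesis by (simp add: invariant_set_def)
qed

end

section \<open>The orbit measure of a point and its support\<close>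

lemma apply_star_mult_self:
  "apply_bcontfun (star f * f) y = complex_of_real ((cmod (apply_bcontfun f y))\<^sup>2)"
  for f :: "'x::topological_space \<Rightarrow>\<^sub>C complex"
  using complex_norm_square[of "apply_bcontfun f y"]
  by (simp add: apply_times_bcontfun apply_star_bcontfun star_complex_def mult.commute)

locale quantum_orbit = quantum_action \<pi> \<Delta> h \<alpha>
  for \<pi> :: "'a::cstar_algebra \<Rightarrow> 'i op" and \<Delta> h and \<alpha> :: "('x::t2_space \<Rightarrow>\<^sub>C complex) \<Rightarrow> ('x \<times> 'i) op" +
  fixes x :: 'x and M :: "'x measure"
  assumes rep: "represents M (orbit_state \<pi> h \<alpha> x)"
begin

lemma vanishing_star_mult_self:
  "star f * f \<in> vanishing_ideal Y \<longleftrightarrow> f \<in> vanishing_ideal Y" for f :: "'x \<Rightarrow>\<^sub>C complex"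
  by (simp add: vanishing_ideal_def apply_star_mult_self)

text \<open>The left side is the integral of the squared modulus of f. Passing to
  \<open>star f * f\<close> reduces complex functions to nonnegative ones, for which a zero integral
  can be interpreted.\<close>

lemma act_star_mult_self_iff:
  "h (act x (star f * f)) = 0 \<longleftrightarrow> f \<in> vanishing_ideal (support M)"
proof
  assume "h (act x (star f * f)) = 0"
  then have "star f * f \<in> vanishing_ideal (support M)"
    by (intro represents_nonneg_eq_0D[OF rep _ apply_star_mult_self]) (simp_all add: orbit_state_eq)
  then show "f \<in> vanishing_ideal (support M)" by (simp add: vanishing_star_mult_self)
next
  assume "f \<in> vanishing_ideal (support M)"
  then show "h (act x (star f * f)) = 0"
    using represents_eq_0[OF rep, of "star f * f"] by (simp add: vanishing_star_mult_self orbit_state_eq)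
qed

lemma support_subset_kernel: "support M \<subseteq> kernel_zero_set \<pi> \<alpha> x"
proof
  fix y assume y: "y \<in> support M"
  have "apply_bcontfun f y = 0" if "act x f = 0" for f
    using act_star_mult_self_iff[of f] that y
    by (simp add: act_mult state_0[OF state_h] vanishing_ideal_def)
  then show "y \<in> kernel_zero_set \<pi> \<alpha> x" by (simp add: kernel_zero_set_def)
qed

lemma kernel_subset_orbit: "kernel_zero_set \<pi> \<alpha> x \<subseteq> cqg_orbit \<pi> h \<alpha> x"
proof
  fix y assume y: "y \<in> kernel_zero_set \<pi> \<alpha> x"
  have "orbit_state \<pi> h \<alpha> x f = orbit_state \<pi> h \<alpha> y f" for f
  proof -
    \<comment> \<open>The function \<open>y \<mapsto> \<mu>\<^sub>y f\<close> minus the scalar to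
      which \<open>\<alpha>\<^sub>x\<close> sends it. It lies in the kernel, so it vanishes at y,
      and that is equality of the two states at f.\<close>
    let ?g = "avg (\<alpha> f) + (- h (act x f)) *\<^sub>C 1"
    have "act x ?g = (h (act x f) + (- h (act x f))) *\<^sub>C 1"
      unfolding act_add act_scaleC act_average act_1 by (rule scaleC_add_left[symmetric])
    then have "act x ?g = 0" by (simp add: scaleC_0_left)
    moreover have "\<forall>g. act x g = 0 \<longrightarrow> apply_bcontfun g y = 0"
      using y by (simp add: kernel_zero_set_def)
    ultimately have "apply_bcontfun ?g y = 0" by blast
    then show ?thesis
      by (simp add: plus_bcontfun.rep_eq apply_scaleC_bcontfun apply_one_bcontfun scaleC_complex_def
          apply_avg[OF \<alpha>_mem] orbit_state_eq act_eq)
  qed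
  then show "y \<in> cqg_orbit \<pi> h \<alpha> x" by (auto simp: cqg_orbit_def)
qed

lemma invariant_support: "invariant_set \<pi> \<alpha> (support M)"
  unfolding invariant_set_iff
proof (intro conjI ballI)
  show "closed (support M)" by (rule closed_support[OF rep])
  fix f y assume f: "f \<in> vanishing_ideal (support M)" and y: "y \<in> support M"
  have "blinfun_apply (\<pi> (act y f)) \<zeta> = 0" for \<zeta>
  proof -
    let ?k = "vec \<zeta> (\<alpha> (star f * f))"
    have k: "apply_bcontfun ?k z = complex_of_real ((norm (blinfun_apply (\<pi> (act z f)) \<zeta>))\<^sup>2)" for z
    proof -
      have "apply_bcontfun ?k z = cinner \<zeta> (blinfun_apply (\<pi> (act z (star f * f))) \<zeta>)"
        unfolding act_eq by (rule apply_vec[OF \<alpha>_mem])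
      also have "\<dots> = cnj (cinner (blinfun_apply (\<pi> (star (act z f) * act z f)) \<zeta>) \<zeta>)"
        unfolding act_mult act_star by (rule cinner_commute)
      also have "\<dots> = complex_of_real ((norm (blinfun_apply (\<pi> (act z f)) \<zeta>))\<^sup>2)"
        unfolding unital_star_hom_isometry_identity[OF \<pi>_hom] by simp
      finally show ?thesis .
    qed
    \<comment> \<open>By invariance this is a multiple of the integral of the squared modulus of f,
      which is 0 as f vanishes on the support.\<close>
    have "orbit_state \<pi> h \<alpha> x ?k = 0"
      using act_star_mult_self_iff[of f] f by (simp add: orbit_state_eq orbit_state_invariant)
    then have "?k \<in> vanishing_ideal (support M)"
      by (rule represents_nonneg_eq_0D[OF rep _ k]) simp
    then have "apply_bcontfun ?k y = 0" using y by (simp add: vanishing_ideal_def)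
    then show ?thesis unfolding k by simp
  qed
  then have "\<pi> (act y f) = \<pi> 0" by (intro blinfun_eqI) (simp add: star_hom_0[OF \<pi>_hom])
  then show "act y f = 0" by (simp add: rep_inject[OF faithful])
qed

text \<open>A Urysohn function separates a point of Y from the closed set Z, so inclusions of sets
  can be proved on their ideals.\<close>

lemma subset_vanishing_idealI:
  fixes Y Z :: "'x set"
  assumes "closed Z" and "\<And>f. f \<in> vanishing_ideal Z \<Longrightarrow> f \<in> vanishing_ideal Y"
  shows "Y \<subseteq> Z"
proof (rule ccontr)
  assume "\<not> Y \<subseteq> Z"
  then obtain y where y: "y \<in> Y" "y \<notin> Z" by auto
  obtain u :: "'x \<Rightarrow> real" where u: "continuous_on UNIV u" "u y = 1" "\<And>z. z \<in> Z \<Longrightarrow> u z = 0"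
    using compact_urysohn_point[OF cpt assms(1) y(2)] by blast
  define f where "f = Bcontfun (\<lambda>z. complex_of_real (u z))"
  have f: "apply_bcontfun f z = complex_of_real (u z)" for z
    unfolding f_def by (subst apply_Bcontfun_compact[OF cpt]) (auto intro!: continuous_intros u(1))
  have "f \<in> vanishing_ideal Z" by (simp add: vanishing_ideal_def f u(3))
  then have "f \<in> vanishing_ideal Y" by (rule assms(2))
  with y(1) u(2) show False by (auto simp: vanishing_ideal_def f)
qed

lemma minimal_support: "minimal_invariant_set \<pi> \<alpha> (support M)"
  unfolding minimal_invariant_set_def
proof (intro conjI allI impI)
  show "support M \<noteq> {}" by (rule support_nonempty[OF rep])
  show "invariant_set \<pi> \<alpha> (support M)" by (rule invariant_support)
  fix Z assume "Z \<subseteq> support M \<and> Z \<noteq> {} \<and> invariant_set \<pi> \<alpha> Z"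
  then have Z: "Z \<subseteq> support M" "Z \<noteq> {}" "invariant_set \<pi> \<alpha> Z" by auto
  then obtain z where z: "z \<in> Z" by auto
  \<comment> \<open>By the two inclusions already proved, every point of the support has the same
    orbit state as x.\<close>
  then have "z \<in> cqg_orbit \<pi> h \<alpha> x"
    using Z(1) support_subset_kernel kernel_subset_orbit by blast
  then have same: "h (act x f) = h (act z f)" for f
    by (simp add: cqg_orbit_def flip: orbit_state_eq)
  have "support M \<subseteq> Z"
  proof (rule subset_vanishing_idealI)
    show "closed Z" using Z(3) by (simp add: invariant_set_def)
    fix f assume "f \<in> vanishing_ideal Z"
    \<comment> \<open>The single point z suffices, since its state determines the same
      support.\<close>
    then have "act z f = 0" using Z(3) z by (simp add: invariant_set_iff)
    then have "h (act z (star f * f)) = 0"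
      by (simp add: act_mult state_0[OF state_h])
    then have "h (act x (star f * f)) = 0" by (simp only: same)
    then show "f \<in> vanishing_ideal (support M)" by (simp only: act_star_mult_self_iff)
  qed
  with Z(1) show "Z = support M" by simp
qed

text \<open>Faithfulness at \<open>a = \<alpha>\<^sub>x f\<close> upgrades
  \<open>h (star a * a) = 0\<close> to \<open>a = 0\<close>. So the ideal of the support lies in the
  kernel of \<open>\<alpha>\<^sub>x\<close>, and passing to zero sets reverses the
  inclusion.\<close>

lemma kernel_subset_support:
  assumes "faithful_state h"
  shows "kernel_zero_set \<pi> \<alpha> x \<subseteq> support M"
proof (rule subset_vanishing_idealI[OF closed_support[OF rep]])
  fix f assume "f \<in> vanishing_ideal (support M)"
  then have "h (star (act x f) * act x f) = 0"
    by (simp add: act_mult act_star flip: act_star_mult_self_iff)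
  then have "act x f = 0" using assms by (simp add: faithful_state_def)
  then show "f \<in> vanishing_ideal (kernel_zero_set \<pi> \<alpha> x)"
    by (simp add: vanishing_ideal_def kernel_zero_set_def)
qed

end

theorem theorem4p18:
  fixes \<pi> :: "'a::cstar_algebra \<Rightarrow> 'i op"
    and \<Delta> :: "'a \<Rightarrow> ('i \<times> 'i) op"
    and h :: "'a \<Rightarrow> complex"
    and \<alpha> :: "('x::t2_space \<Rightarrow>\<^sub>C complex) \<Rightarrow> ('x \<times> 'i) op"
    and x :: 'x
    and M :: "'x measure"
  assumes "compact (UNIV :: 'x set)"
    and "faithful_rep \<pi>"
    and "compact_quantum_group \<pi> \<Delta>"
    and "haar_measure \<pi> \<Delta> h"
    and "cqg_action \<pi> \<Delta> \<alpha>"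
    and "represents M (orbit_state \<pi> h \<alpha> x)"
  shows "support M \<subseteq> kernel_zero_set \<pi> \<alpha> x \<and>
    kernel_zero_set \<pi> \<alpha> x \<subseteq> cqg_orbit \<pi> h \<alpha> x \<and>
    minimal_invariant_set \<pi> \<alpha> (support M) \<and>
    (faithful_state h \<longrightarrow> support M = kernel_zero_set \<pi> \<alpha> x)"
proof -
  interpret quantum_orbit \<pi> \<Delta> h \<alpha> x M
    by standard (fact assms)+
  show ?thesis
    using support_subset_kernel kernel_subset_orbit minimal_support kernel_subset_support by blast
qed

end
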